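(* (Exact recovery.) Fix any constants $c_0,c_1\in(0,1)$ and $\delta>0$. Consider the $\mathbb{Z}_2$ Synchronization model, the Censored Block Model, or the binary symmetric Stochastic Block Model with $0<c_0p\le q<p\le1-c_1$, as $n\to\infty$. If $\bar nI^*\ge(1+\delta)\log n$, then with probability $1-o(1)$, every $\widehat Y\in\mathcal{Y}(A)$ satisfies $\|\widehat Y-Y^*\|_1=0$; in particular the SDP solution recovers $Y^*$ exactly.
   Context: Models. $\sigma^*\in\{\pm1\}^n$ is the (deterministic) ground-truth label vector, $Y^*=\sigma^*(\sigma^* )^\top$. The observed matrix $A\in\mathbb{R}^{n\times n}$ is symmetric with independent entries $\{A_{ij}:i\le j\}$: - $\mathbb{Z}_2$ Synchronization: $A_{ij}\sim N(\sigma_i^*\sigma_j^*,\tau^2)$, $\tau>0$ (may depend on $n$). - Censored Block Model: $A_{ij}=\sigma_i^*\sigma_j^*$ w.p. $\alpha(1-\epsilon)$, $-\sigma_i^*\sigma_j^*$ w.p. $\alpha\epsilon$, $0$ w.p. $1-\alpha$; $\alpha\in(0,1]$ may depend on $n$, $\epsilon\in(0,\frac12)$ is a constant. - Binary symmetric Stochastic Block Model: $\sum_i\sigma_i^*=0$, and $A_{ij}\sim\mathrm{Ber}(p)$ if $\sigma_i^*\sigma_j^*=1$, $A_{ij}\sim\mathrm{Ber}(q)$ if $\sigma_i^*\sigma_j^*=-1$; $0<q<p<1$ may depend on $n$. $I^*=(2\tau^2)^{-1}$, resp. $I^*=(\sqrt{\alpha(1-\epsilon)}-\sqrt{\alpha\epsilon})^2$,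 resp. $I^*=-2\log[\sqrt{pq}+\sqrt{(1-p)(1-q)}]$ for the three models. $\bar n=n$ for the first two models and $\bar n=n/2$ for the Stochastic Block Model. SDP: maximize $\langle A,Y\rangle=\sum_{i,j}A_{ij}Y_{ij}$ over $Y\in\mathbb{R}^{n\times n}$ with $Y\succeq0$ (symmetric positive semidefinite), $Y_{ii}=1$ for all $i$, and, for the Stochastic Block Model only, additionally $\sum_{i,j}Y_{ij}=0$. $\mathcal{Y}(A)$ is the set of SDP-feasible $Y$ with $\langle A,Y\rangle\ge\langle A,Y^*\rangle$. $\|M\|_1=\sum_{i,j}|M_{ij}|$. *)

theory Defs
  imports "HOL-Probability.Probability" "Jordan_Normal_Form.Matrix"
begin

(* Label vectors of length n are functions on nat of which only the values at i < n matter. *)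

definition label_vector :: "nat \<Rightarrow> (nat \<Rightarrow> real) \<Rightarrow> bool" where
  "label_vector n \<sigma> \<longleftrightarrow> (\<forall>i<n. \<sigma> i \<in> {-1, 1})"

definition truth_mat :: "nat \<Rightarrow> (nat \<Rightarrow> real) \<Rightarrow> real mat" where
  "truth_mat n \<sigma> = mat n n (\<lambda>(i, j). \<sigma> i * \<sigma> j)"


definition psd_mat :: "nat \<Rightarrow> real mat \<Rightarrow> bool" where
  "psd_mat n Y \<longleftrightarrow> Y \<in> carrier_mat n n \<and> transpose_mat Y = Y \<and>
     (\<forall>x\<in>carrier_vec n. 0 \<le> scalar_prod x (mult_mat_vec Y x))"

definition mat_inner :: "real mat \<Rightarrow> real mat \<Rightarrow> real" where
  "mat_inner A Y = (\<Sum>i<dim_row A. \<Sum>j<dim_col A. A $$ (i, j) * Y $$ (i, j))"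

definition entry_sum :: "real mat \<Rightarrow> real" where
  "entry_sum Y = (\<Sum>i<dim_row Y. \<Sum>j<dim_col Y. Y $$ (i, j))"

definition entry_norm1 :: "real mat \<Rightarrow> real" where
  "entry_norm1 Y = (\<Sum>i<dim_row Y. \<Sum>j<dim_col Y. \<bar>Y $$ (i, j)\<bar>)"

definition elliptope :: "nat \<Rightarrow> real mat set" where
  "elliptope n = {Y. psd_mat n Y \<and> (\<forall>i<n. Y $$ (i, i) = 1)}"

definition balanced_elliptope :: "nat \<Rightarrow> real mat set" where
  "balanced_elliptope n = {Y \<in> elliptope n. entry_sum Y = 0}"

(* Below, C is the feasible set of the SDP: elliptope n for synchronization and the
   censored block model, balanced_elliptope n for the stochastic block model. *)

definition sdp_solutions :: "real mat set \<Rightarrow> real mat \<Rightarrow> real mat set" where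
  "sdp_solutions C A = {Y \<in> C. \<forall>Z\<in>C. mat_inner A Z \<le> mat_inner A Y}"

definition sdp_superlevel :: "real mat set \<Rightarrow> real mat \<Rightarrow> real mat \<Rightarrow> real mat set" where
  "sdp_superlevel C Ystar A = {Y \<in> C. mat_inner A Ystar \<le> mat_inner A Y}"

definition exact_recovery :: "real mat set \<Rightarrow> real mat \<Rightarrow> real mat \<Rightarrow> bool" where
  "exact_recovery C Ystar A \<longleftrightarrow>
     (\<forall>Y\<in>sdp_superlevel C Ystar A. entry_norm1 (Y - Ystar) = 0) \<and>
     sdp_solutions C A = {Ystar}"


definition indep_symmetric_mat :: "'w measure \<Rightarrow> nat \<Rightarrow> ('w \<Rightarrow> real mat) \<Rightarrow> bool" where
  "indep_symmetric_mat M n A \<longleftrightarrow>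
     prob_space M \<and>
     (\<forall>\<omega>\<in>space M. A \<omega> \<in> carrier_mat n n \<and> transpose_mat (A \<omega>) = A \<omega>) \<and>
     prob_space.indep_vars M (\<lambda>_. borel) (\<lambda>(i, j) \<omega>. A \<omega> $$ (i, j)) {(i, j). i \<le> j \<and> j < n}"

(* normal_density takes the standard deviation as its second argument. *)

definition z2_synchronization ::
  "'w measure \<Rightarrow> nat \<Rightarrow> (nat \<Rightarrow> real) \<Rightarrow> real \<Rightarrow> ('w \<Rightarrow> real mat) \<Rightarrow> bool" where
  "z2_synchronization M n \<sigma> \<tau> A \<longleftrightarrow>
     label_vector n \<sigma> \<and> 0 < \<tau> \<and> indep_symmetric_mat M n A \<and>
     (\<forall>i j. i \<le> j \<and> j < n \<longrightarrow>
        distributed M lborel (\<lambda>\<omega>. A \<omega> $$ (i, j)) (normal_density (\<sigma> i * \<sigma> j) \<tau>))"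

definition censored_block_model ::
  "'w measure \<Rightarrow> nat \<Rightarrow> (nat \<Rightarrow> real) \<Rightarrow> real \<Rightarrow> real \<Rightarrow> ('w \<Rightarrow> real mat) \<Rightarrow> bool" where
  "censored_block_model M n \<sigma> \<alpha> \<epsilon> A \<longleftrightarrow>
     label_vector n \<sigma> \<and> 0 < \<alpha> \<and> \<alpha> \<le> 1 \<and> 0 < \<epsilon> \<and> \<epsilon> < 1/2 \<and> indep_symmetric_mat M n A \<and>
     (\<forall>i j. i \<le> j \<and> j < n \<longrightarrow>
        measure M {\<omega> \<in> space M. A \<omega> $$ (i, j) = \<sigma> i * \<sigma> j} = \<alpha> * (1 - \<epsilon>) \<and>
        measure M {\<omega> \<in> space M. A \<omega> $$ (i, j) = - (\<sigma> i * \<sigma> j)} = \<alpha> * \<epsilon> \<and>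
        measure M {\<omega> \<in> space M. A \<omega> $$ (i, j) = 0} = 1 - \<alpha>)"

definition stochastic_block_model ::
  "'w measure \<Rightarrow> nat \<Rightarrow> (nat \<Rightarrow> real) \<Rightarrow> real \<Rightarrow> real \<Rightarrow> ('w \<Rightarrow> real mat) \<Rightarrow> bool" where
  "stochastic_block_model M n \<sigma> p q A \<longleftrightarrow>
     label_vector n \<sigma> \<and> (\<Sum>i<n. \<sigma> i) = 0 \<and> 0 < q \<and> q < p \<and> p < 1 \<and> indep_symmetric_mat M n A \<and>
     (\<forall>i j. i \<le> j \<and> j < n \<longrightarrow>
        distr M borel (\<lambda>\<omega>. A \<omega> $$ (i, j)) =
        distr (measure_pmf (bernoulli_pmf (if \<sigma> i * \<sigma> j = 1 then p else q))) borel
          (of_bool :: bool \<Rightarrow> real))"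

definition z2_rate :: "real \<Rightarrow> real" where
  "z2_rate \<tau> = inverse (2 * \<tau>\<^sup>2)"

definition cbm_rate :: "real \<Rightarrow> real \<Rightarrow> real" where
  "cbm_rate \<alpha> \<epsilon> = (sqrt (\<alpha> * (1 - \<epsilon>)) - sqrt (\<alpha> * \<epsilon>))\<^sup>2"

definition sbm_rate :: "real \<Rightarrow> real \<Rightarrow> real" where
  "sbm_rate p q = - 2 * ln (sqrt (p * q) + sqrt ((1 - p) * (1 - q)))"

end

theory Submission
  imports Defs "HOL-Real_Asymp.Real_Asymp"
begin

text \<open>
  Conjugating by the labels and recentring, every model becomes a symmetric matrix \<open>B = \<mu> J + W\<close> with
  centred independent entries. \<open>Y*\<close> is the unique maximiser as soon as
  \<open>\<Sum>\<^sub>i\<^sub>j B\<^sub>i\<^sub>j (x\<^sub>i - x\<^sub>j)\<^sup>2 > 0\<close> for all nonconstant \<open>x\<close>, because a correlation matrix \<open>Z\<close> is a Gram matrix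
  and \<open>1 - Z\<^sub>i\<^sub>j\<close> is half a squared distance. Since \<open>\<mu> J\<close> vanishes on vectors of mean zero, it is enough that
  every row sum of \<open>B\<close> exceeds the largest eigenvalue of \<open>W\<close>. The exact Chernoff exponent of a row sum is the
  rate \<open>y = nbar I*\<close>, and asking the row sums to exceed a level \<open>s\<close> costs only \<open>O(sqrt y)\<close> in that exponent
  when \<open>s\<close> is of the order of the spectral norm of \<open>W\<close>, which is absorbed by \<open>\<delta>\<close>.

  The spectral norm is \<open>O(\<tau> sqrt n)\<close> for Gaussian entries by a union bound over a grid, and
  \<open>O(sqrt (n p))\<close> for bounded entries of variance \<open>p \<ge> c log n / n\<close>. The latter is a trace bound: only closed walks
  that use every edge at least twice contribute, and (following Bandeira and van Handel) their
  weighted number is at most the unweighted number of such walks in about \<open>n p\<close> vertices, which is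
  bounded through the spectral norm of a dense random matrix of that dimension.
\<close>

section \<open>The Laplacian certificate\<close>

text \<open>Sharp constants are demanded of the row sums alone. The norm of W enters their Chernoff
  bound only through a factor exp(theta s), so its order suffices, but an extra factor sqrt(log n)
  would already spoil the result, since n p may be as small as a multiple of log n. Sparse entries
  have sub-Gaussian constants far above their standard deviation, so the grid argument that serves
  Gaussian entries fails for them directly. It returns as a counting device: applied to a dense
  matrix it bounds the number of walks, which replaces a combinatorial enumeration. Feasible
  matrices agree on the diagonal, so diagonal observations do not influence optimality. They are
  kept in the row sums and in W alike, where they cancel, and give every row exactly n independent
  entries; the exponent then is nbar I* without correction terms. In the block model, subtracting a
  constant from A is free because feasible matrices have entry sum 0; the midpoint of p and q gives
  both kinds of entries the same mean after conjugation. A probability lower bound by inclusion of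
  events requires exact recovery to be a measurable event, which is obtained from compactness of the
  feasible set.\<close>

lemma psd_decomposition:
  fixes Q :: "nat \<Rightarrow> nat \<Rightarrow> real"
  assumes "\<And>i j. i < n \<Longrightarrow> j < n \<Longrightarrow> Q i j = Q j i"
    and "\<And>x. 0 \<le> (\<Sum>i<n. \<Sum>j<n. Q i j * x i * x j)"
  shows "\<exists>V. \<forall>i<n. \<forall>j<n. Q i j = (\<Sum>k<n. V k i * V k j)"
  using assms
proof (induction n arbitrary: Q)
  case 0
  then show ?case by simp
next
  case (Suc n)
  define c where "c = Q n n"
  define q where "q x = (\<Sum>i<n. Q i n * x i)" for x
  define S where "S x = (\<Sum>i<n. \<Sum>j<n. Q i j * x i * x j)" for x
  have psd: "0 \<le> S x + 2 * s * q x + s\<^sup>2 * c" for x s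
  proof -
    let ?y = "x(n := s)"
    have "(\<Sum>i<Suc n. \<Sum>j<Suc n. Q i j * ?y i * ?y j)
        = (\<Sum>i<n. (\<Sum>j<n. Q i j * x i * x j) + Q i n * x i * s)
          + ((\<Sum>j<n. Q n j * s * x j) + c * s * s)"
      by (simp add: c_def)
    also have "(\<Sum>j<n. Q n j * s * x j) = (\<Sum>j<n. Q j n * s * x j)"
      by (rule sum.cong) (use Suc.prems(1) in auto)
    also have "(\<Sum>i<n. (\<Sum>j<n. Q i j * x i * x j) + Q i n * x i * s)
          + ((\<Sum>j<n. Q j n * s * x j) + c * s * s) = S x + 2 * s * q x + s\<^sup>2 * c"
      by (simp add: sum.distrib S_def q_def sum_distrib_left power2_eq_square algebra_simps)
    finally show ?thesis using Suc.prems(2)[of ?y] by simp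
  qed
  have c0: "c \<ge> 0" using psd[of "\<lambda>_. 0" 1] by (simp add: S_def q_def)
  \<comment> \<open>With a zero corner entry the form is affine in \<open>s\<close>, so a nonzero
    slope would make it negative; the \<open>s\<close> inserted below would give the value
    -1.\<close>
  have q0: "Q i n = 0" if "c = 0" "i < n" for i
  proof -
    let ?x = "\<lambda>j. if j = i then 1 else (0::real)"
    have qi: "q ?x = Q i n" using that by (simp add: q_def if_distrib cong: if_cong)
    have "0 \<le> S ?x + 2 * s * Q i n" for s using psd[of ?x s] that qi by simp
    from this[of "- (S ?x + 1) / (2 * Q i n)"] show ?thesis
      by (cases "Q i n = 0") (auto simp: field_simps)
  qed
  \<comment> \<open>The Schur complement: its form at \<open>x\<close> is the minimum over the last
    coordinate, attained at \<open>s = - q x / c\<close>. For \<open>c = 0\<close> the quotient is 0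
    and the last column vanishes as well, so the formula stays correct.\<close>
  define Q' where "Q' i j = Q i j - Q i n * Q j n / c" for i j
  have "\<exists>V. \<forall>i<n. \<forall>j<n. Q' i j = (\<Sum>k<n. V k i * V k j)"
  proof (rule Suc.IH)
    show "Q' i j = Q' j i" if "i < n" "j < n" for i j
      using Suc.prems(1) that by (simp add: Q'_def)
    show "0 \<le> (\<Sum>i<n. \<Sum>j<n. Q' i j * x i * x j)" for x
    proof -
      have "(\<Sum>i<n. \<Sum>j<n. Q' i j * x i * x j) = S x - (\<Sum>i<n. \<Sum>j<n. (Q i n * x i) * (Q j n * x j)) / c"
        unfolding Q'_def S_def sum_divide_distrib sum_subtractf[symmetric]
        by (intro sum.cong refl) (simp add: algebra_simps)
      also have "(\<Sum>i<n. \<Sum>j<n. (Q i n * x i) * (Q j n * x j)) = (q x)\<^sup>2"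
        by (simp add: q_def power2_eq_square sum_product)
      also have "S x - (q x)\<^sup>2 / c = S x + 2 * (- q x / c) * q x + (- q x / c)\<^sup>2 * c"
        by (cases "c = 0") (simp_all add: power2_eq_square field_simps)
      finally show ?thesis using psd[of x "- q x / c"] by simp
    qed
  qed
  then obtain V where V: "\<And>i j. i < n \<Longrightarrow> j < n \<Longrightarrow> Q' i j = (\<Sum>k<n. V k i * V k j)" by blast
  \<comment> \<open>A Cholesky step: the new row is the last column divided by
    \<open>sqrt c\<close>, and the old rows get 0 in the new coordinate.\<close>
  define U where "U k i = (if k = n then Q i n / sqrt c else if i = n then 0 else V k i)" for k i
  have "Q i j = (\<Sum>k<Suc n. U k i * U k j)" if "i < Suc n" "j < Suc n" for i j
  proof -
    have sq: "sqrt c * sqrt c = c" "\<bar>c\<bar> = c" using c0 by simp_all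
    have U: "(\<Sum>k<Suc n. U k i * U k j) = (\<Sum>k<n. U k i * U k j) + Q i n * Q j n / c"
      by (simp add: U_def sq)
    consider "i < n" "j < n" | "i = n" | "j = n" using \<open>i < Suc n\<close> \<open>j < Suc n\<close> by linarith
    then show ?thesis
    proof cases
      case 1
      then have "(\<Sum>k<n. U k i * U k j) = Q' i j" by (simp add: V U_def)
      then show ?thesis using U by (simp add: Q'_def)
    next
      case 2
      then have "(\<Sum>k<n. U k i * U k j) = 0" by (simp add: U_def)
      moreover have "Q i j = Q i n * Q j n / c"
        using 2 q0[of j] that Suc.prems(1)[of n j]
        by (cases "c = 0"; cases "j = n") (simp_all add: c_def)
      ultimately show ?thesis using U by simp
    next
      case 3
      then have "(\<Sum>k<n. U k i * U k j) = 0" by (simp add: U_def)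
      moreover have "Q i j = Q i n * Q j n / c"
        using 3 q0[of i] that by (cases "c = 0"; cases "i = n") (simp_all add: c_def)
      ultimately show ?thesis using U by simp
    qed
  qed
  then show ?case by blast
qed

section \<open>Feasible matrices and strict optimality of the planted one\<close>

lemma psd_mat_quadratic_form:
  assumes "psd_mat n Y"
  shows "0 \<le> (\<Sum>i<n. \<Sum>j<n. Y $$ (i, j) * x i * x j)"
proof -
  have Y: "Y \<in> carrier_mat n n" using assms by (simp add: psd_mat_def)
  have "0 \<le> scalar_prod (vec n x) (mult_mat_vec Y (vec n x))"
    using assms by (simp add: psd_mat_def)
  also have "\<dots> = (\<Sum>i<n. x i * (\<Sum>j<n. Y $$ (i, j) * x j))"
    using Y by (auto simp: scalar_prod_def atLeast0LessThan intro!: sum.cong)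
  also have "\<dots> = (\<Sum>i<n. \<Sum>j<n. Y $$ (i, j) * x i * x j)"
    by (simp add: sum_distrib_left algebra_simps)
  finally show ?thesis .
qed

lemma psd_mat_sym:
  assumes "psd_mat n Y" "i < n" "j < n"
  shows "Y $$ (i, j) = Y $$ (j, i)"
proof -
  have "transpose_mat Y $$ (j, i) = Y $$ (i, j)"
    using assms by (intro index_transpose_mat) (auto simp: psd_mat_def)
  then show ?thesis using assms by (simp add: psd_mat_def)
qed

lemma label_square: "label_vector n \<sigma> \<Longrightarrow> i < n \<Longrightarrow> \<sigma> i * \<sigma> i = 1"
  by (auto simp: label_vector_def)

lemma truth_mat_in_elliptope:
  assumes "label_vector n \<sigma>"
  shows "truth_mat n \<sigma> \<in> elliptope n"
proof -
  have "0 \<le> scalar_prod x (mult_mat_vec (truth_mat n \<sigma>) x)" if "x \<in> carrier_vec n" for x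
  proof -
    have "scalar_prod x (mult_mat_vec (truth_mat n \<sigma>) x)
        = (\<Sum>i<n. x $ i * (\<Sum>j<n. \<sigma> i * \<sigma> j * x $ j))"
      using that by (auto simp: scalar_prod_def truth_mat_def atLeast0LessThan intro!: sum.cong)
    also have "\<dots> = (\<Sum>i<n. \<sigma> i * x $ i) * (\<Sum>j<n. \<sigma> j * x $ j)"
      by (simp add: sum_product sum_distrib_left algebra_simps)
    finally show ?thesis by simp
  qed
  then show ?thesis
    using assms by (auto simp: elliptope_def psd_mat_def truth_mat_def label_square)
qed

lemma truth_mat_in_balanced_elliptope:
  assumes "label_vector n \<sigma>" "(\<Sum>i<n. \<sigma> i) = 0"
  shows "truth_mat n \<sigma> \<in> balanced_elliptope n"
proof -
  have "entry_sum (truth_mat n \<sigma>) = (\<Sum>i<n. \<sigma> i) * (\<Sum>j<n. \<sigma> j)"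
    by (simp add: entry_sum_def truth_mat_def sum_product)
  then show ?thesis
    using assms truth_mat_in_elliptope by (simp add: balanced_elliptope_def)
qed

lemma entry_norm1_diff_eq_0_iff:
  assumes "Y \<in> carrier_mat n n" "Z \<in> carrier_mat n n"
  shows "entry_norm1 (Y - Z) = 0 \<longleftrightarrow> Y = Z"
proof
  assume "entry_norm1 (Y - Z) = 0"
  then have "\<forall>i<n. \<forall>j<n. Y $$ (i, j) = Z $$ (i, j)"
    using assms by (simp add: entry_norm1_def sum_nonneg_eq_0_iff sum_nonneg)
  then show "Y = Z" using assms by (intro eq_matI) auto
qed (use assms in \<open>simp add: entry_norm1_def\<close>)

text \<open>Both clauses of \<open>exact_recovery\<close> reduce to strict optimality of
  \<open>Y0\<close>, since \<open>Y0\<close> itself is feasible. This is the form that the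
  certificate establishes and that the measurability proof analyses.\<close>

lemma exact_recovery_iff:
  assumes "C \<subseteq> carrier_mat n n" "Y0 \<in> C"
  shows "exact_recovery C Y0 A \<longleftrightarrow> (\<forall>Y\<in>C. Y \<noteq> Y0 \<longrightarrow> mat_inner A Y < mat_inner A Y0)"
proof
  assume R: "exact_recovery C Y0 A"
  show "\<forall>Y\<in>C. Y \<noteq> Y0 \<longrightarrow> mat_inner A Y < mat_inner A Y0"
  proof (intro ballI impI, rule ccontr)
    fix Y assume Y: "Y \<in> C" "Y \<noteq> Y0" "\<not> mat_inner A Y < mat_inner A Y0"
    then have "entry_norm1 (Y - Y0) = 0"
      using R by (auto simp: exact_recovery_def sdp_superlevel_def)
    then show False using Y assms entry_norm1_diff_eq_0_iff by blast
  qed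
next
  assume L: "\<forall>Y\<in>C. Y \<noteq> Y0 \<longrightarrow> mat_inner A Y < mat_inner A Y0"
  have "entry_norm1 (Y - Y0) = 0" if "Y \<in> sdp_superlevel C Y0 A" for Y
  proof -
    have "Y = Y0" using L that by (force simp: sdp_superlevel_def)
    then show ?thesis using assms entry_norm1_diff_eq_0_iff by blast
  qed
  moreover have "sdp_solutions C A = {Y0}"
    using L assms(2) by (force simp: sdp_solutions_def)
  ultimately show "exact_recovery C Y0 A" by (simp add: exact_recovery_def)
qed

text \<open>Conjugation by the labels turns the planted matrix into the all-ones matrix and
  \<open>Y\<close> into a correlation matrix \<open>Z\<close>, so the loss in the objective is the
  sum of \<open>B i j * (1 - Z i j)\<close>. Each Gram coordinate \<open>V k\<close> contributes
  half a Laplacian form to it. The shift \<open>\<rho>\<close> drops out because it multiplies a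
  difference of entry sums; on the plain elliptope it is taken to be 0.\<close>

lemma exact_recovery_if_laplacian_positive:
  assumes label: "label_vector n \<sigma>" and A: "A \<in> carrier_mat n n"
    and C: "C \<subseteq> elliptope n" "truth_mat n \<sigma> \<in> C"
    and shift: "\<And>Y. Y \<in> C \<Longrightarrow> \<rho> * entry_sum Y = \<rho> * entry_sum (truth_mat n \<sigma>)"
    and pos: "\<And>x. \<exists>i<n. \<exists>j<n. x i \<noteq> x j \<Longrightarrow>
      0 < (\<Sum>i<n. \<Sum>j<n. \<sigma> i * \<sigma> j * (A $$ (i, j) - \<rho>) * (x i - x j)\<^sup>2)"
  shows "exact_recovery C (truth_mat n \<sigma>) A"
proof -
  let ?T = "truth_mat n \<sigma>"
  have carrier: "C \<subseteq> carrier_mat n n" using C(1) by (auto simp: elliptope_def psd_mat_def)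
  have "mat_inner A Y < mat_inner A ?T" if Y: "Y \<in> C" "Y \<noteq> ?T" for Y
  proof -
    have psd: "psd_mat n Y" and diag: "\<And>i. i < n \<Longrightarrow> Y $$ (i, i) = 1"
      using Y(1) C(1) by (auto simp: elliptope_def)
    have Yc: "Y \<in> carrier_mat n n" using Y(1) carrier by blast
    define Z where "Z i j = \<sigma> i * \<sigma> j * Y $$ (i, j)" for i j
    have "\<exists>V. \<forall>i<n. \<forall>j<n. Z i j = (\<Sum>k<n. V k i * V k j)"
    proof (rule psd_decomposition)
      show "Z i j = Z j i" if "i < n" "j < n" for i j
        using psd_mat_sym[OF psd that] by (simp add: Z_def)
      show "0 \<le> (\<Sum>i<n. \<Sum>j<n. Z i j * x i * x j)" for x
        using psd_mat_quadratic_form[OF psd, of "\<lambda>i. \<sigma> i * x i"]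
        by (simp add: Z_def algebra_simps)
    qed
    then obtain V where V: "\<And>i j. i < n \<Longrightarrow> j < n \<Longrightarrow> Z i j = (\<Sum>k<n. V k i * V k j)" by blast
    have Zd: "Z i i = 1" if "i < n" for i
      using that diag label by (simp add: Z_def label_square)
    have dist: "1 - Z i j = (\<Sum>k<n. (V k i - V k j)\<^sup>2) / 2" if "i < n" "j < n" for i j
    proof -
      have "(\<Sum>k<n. (V k i - V k j)\<^sup>2) = Z i i + Z j j - 2 * Z i j"
        unfolding V[OF that(1) that(1)] V[OF that(2) that(2)] V[OF that]
        by (simp add: power2_eq_square algebra_simps sum.distrib sum_subtractf sum_distrib_left)
      then show ?thesis using that Zd by simp
    qed
    define B where "B i j = \<sigma> i * \<sigma> j * (A $$ (i, j) - \<rho>)" for i j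
    let ?q = "\<lambda>k. \<Sum>i<n. \<Sum>j<n. B i j * (V k i - V k j)\<^sup>2"
    have nonneg: "0 \<le> ?q k" for k
    proof (cases "\<exists>i<n. \<exists>j<n. V k i \<noteq> V k j")
      case True
      show ?thesis unfolding B_def by (rule less_imp_le[OF pos[OF True]])
    next
      case False
      have 0: "(V k i - V k j)\<^sup>2 = 0" if "i < n" "j < n" for i j
      proof -
        have "V k i = V k j" using False that by metis
        then show ?thesis by (metis diff_self zero_power2)
      qed
      have "?q k = (\<Sum>i<n. \<Sum>j<n. 0)"
        by (intro sum.cong refl) (simp del: power_eq_0_iff zero_eq_power2 add: 0)
      then show ?thesis by simp
    qed
    \<comment> \<open>Strictness: if all Gram coordinates were constant, every \<open>Z i j\<close>
      would be 1 and \<open>Y\<close> would be the planted matrix.\<close>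
    have "\<exists>k<n. \<exists>i<n. \<exists>j<n. V k i \<noteq> V k j"
    proof (rule ccontr)
      assume "\<not> ?thesis"
      then have const: "V k i = V k j" if "k < n" "i < n" "j < n" for k i j using that by metis
      have "Y $$ (i, j) = ?T $$ (i, j)" if ij: "i < n" "j < n" for i j
      proof -
        have "(\<Sum>k<n. (V k i - V k j)\<^sup>2) = (\<Sum>k<n. 0)"
          by (rule sum.cong) (use const[OF _ ij] in auto)
        then have "Z i j = 1" using dist[OF ij] by simp
        then have "\<sigma> i * \<sigma> j * (\<sigma> i * \<sigma> j * Y $$ (i, j)) = \<sigma> i * \<sigma> j" by (simp add: Z_def)
        also have "\<sigma> i * \<sigma> j * (\<sigma> i * \<sigma> j * Y $$ (i, j)) = (\<sigma> i * \<sigma> i) * (\<sigma> j * \<sigma> j) * Y $$ (i, j)"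
          by (simp add: algebra_simps)
        finally show ?thesis using ij label by (simp add: label_square truth_mat_def)
      qed
      then have "Y = ?T" using Yc by (intro eq_matI) (auto simp: truth_mat_def)
      then show False using Y by simp
    qed
    then obtain k where k: "k < n" "\<exists>i<n. \<exists>j<n. V k i \<noteq> V k j" by metis
    have "0 < ?q k" unfolding B_def by (rule pos[OF k(2)])
    then have "0 < (\<Sum>k<n. ?q k)"
      using nonneg k(1) by (simp add: sum_pos2[where i = k and I = "{..<n}"])
    also have "(\<Sum>k<n. ?q k) = (\<Sum>i<n. \<Sum>k<n. \<Sum>j<n. B i j * (V k i - V k j)\<^sup>2)"
      by (rule sum.swap)
    also have "\<dots> = (\<Sum>i<n. \<Sum>j<n. \<Sum>k<n. B i j * (V k i - V k j)\<^sup>2)"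
      by (rule sum.cong[OF refl], rule sum.swap)
    also have "\<dots> = (\<Sum>i<n. \<Sum>j<n. 2 * (B i j * (1 - Z i j)))"
      by (intro sum.cong refl) (simp add: dist sum_distrib_left[symmetric])
    also have "\<dots> = 2 * (\<Sum>i<n. \<Sum>j<n. B i j * (1 - Z i j))"
      by (simp add: sum_distrib_left)
    finally have "0 < (\<Sum>i<n. \<Sum>j<n. B i j * (1 - Z i j))" by simp
    also have "(\<Sum>i<n. \<Sum>j<n. B i j * (1 - Z i j))
        = (\<Sum>i<n. \<Sum>j<n. (A $$ (i, j) - \<rho>) * (\<sigma> i * \<sigma> j - Y $$ (i, j)))"
    proof (intro sum.cong refl)
      fix i j assume "i \<in> {..<n}" "j \<in> {..<n}"
      then have "\<sigma> i \<in> {-1, 1}" "\<sigma> j \<in> {-1, 1}" using label by (simp_all add: label_vector_def)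
      then show "B i j * (1 - Z i j) = (A $$ (i, j) - \<rho>) * (\<sigma> i * \<sigma> j - Y $$ (i, j))"
        unfolding B_def Z_def by (auto simp: algebra_simps)
    qed
    also have "\<dots> = mat_inner A ?T - mat_inner A Y - (\<rho> * entry_sum ?T - \<rho> * entry_sum Y)"
      using A Yc by (simp add: mat_inner_def entry_sum_def truth_mat_def sum_subtractf sum.distrib
          sum_distrib_left algebra_simps)
    also have "\<dots> = mat_inner A ?T - mat_inner A Y" using shift[OF Y(1)] by simp
    finally show ?thesis by simp
  qed
  then show ?thesis using exact_recovery_iff[OF carrier C(2)] by blast
qed

text \<open>The form depends on differences only, so \<open>x\<close> may be centred to
  \<open>y\<close>. Expanding the square gives twice the row sums weighted by
  \<open>(y i)\<^sup>2\<close> minus the form of \<open>B\<close> at \<open>y\<close>, in which the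
  \<open>\<mu>\<close> part vanishes. Nonconstancy of \<open>x\<close> leaves some
  \<open>y i\<close> nonzero, and one strict row inequality is enough.\<close>

lemma laplacian_positive_if_degrees_dominate:
  fixes B W :: "nat \<Rightarrow> nat \<Rightarrow> real"
  assumes sym: "\<And>i j. i < n \<Longrightarrow> j < n \<Longrightarrow> B i j = B j i"
    and B: "\<And>i j. i < n \<Longrightarrow> j < n \<Longrightarrow> B i j = \<mu> + W i j"
    and W: "\<And>x. (\<Sum>i<n. \<Sum>j<n. W i j * x i * x j) \<le> t * (\<Sum>i<n. (x i)\<^sup>2)"
    and D: "\<And>i. i < n \<Longrightarrow> t < (\<Sum>j<n. B i j)"
    and x: "\<exists>i<n. \<exists>j<n. x i \<noteq> x j"
  shows "0 < (\<Sum>i<n. \<Sum>j<n. B i j * (x i - x j)\<^sup>2)"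
proof -
  define m where "m = (\<Sum>i<n. x i) / n"
  define y where "y i = x i - m" for i
  have n: "n > 0" using x by auto
  have y0: "(\<Sum>i<n. y i) = 0" using n by (simp add: y_def m_def sum_subtractf)
  obtain i0 where i0: "i0 < n" "y i0 \<noteq> 0" using x unfolding y_def by (metis eq_iff_diff_eq_0)
  have "(\<Sum>i<n. \<Sum>j<n. B i j * (x i - x j)\<^sup>2) = (\<Sum>i<n. \<Sum>j<n. B i j * (y i - y j)\<^sup>2)"
    by (simp add: y_def)
  also have "\<dots> = (\<Sum>i<n. \<Sum>j<n. B i j * (y i)\<^sup>2) + (\<Sum>i<n. \<Sum>j<n. B i j * (y j)\<^sup>2)
      - 2 * (\<Sum>i<n. \<Sum>j<n. B i j * y i * y j)"
    by (simp add: power2_eq_square algebra_simps sum.distrib sum_subtractf sum_distrib_left)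
  also have "(\<Sum>i<n. \<Sum>j<n. B i j * (y j)\<^sup>2) = (\<Sum>i<n. \<Sum>j<n. B i j * (y i)\<^sup>2)"
    by (subst sum.swap) (intro sum.cong refl, use sym in auto)
  also have "(\<Sum>i<n. \<Sum>j<n. B i j * y i * y j) = (\<Sum>i<n. \<Sum>j<n. \<mu> * y i * y j + W i j * y i * y j)"
    by (intro sum.cong refl) (auto simp: B algebra_simps)
  also have "\<dots> = \<mu> * ((\<Sum>i<n. y i) * (\<Sum>j<n. y j)) + (\<Sum>i<n. \<Sum>j<n. W i j * y i * y j)"
    unfolding sum.distrib sum_product by (simp add: sum_distrib_left mult.assoc)
  finally have eq: "(\<Sum>i<n. \<Sum>j<n. B i j * (x i - x j)\<^sup>2)
      = 2 * ((\<Sum>i<n. (\<Sum>j<n. B i j) * (y i)\<^sup>2) - (\<Sum>i<n. \<Sum>j<n. W i j * y i * y j))"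
    by (simp add: y0 sum_distrib_right)
  have "t * (\<Sum>i<n. (y i)\<^sup>2) < (\<Sum>i<n. (\<Sum>j<n. B i j) * (y i)\<^sup>2)"
    unfolding sum_distrib_left
  proof (rule sum_strict_mono_ex1)
    show "\<forall>i\<in>{..<n}. t * (y i)\<^sup>2 \<le> (\<Sum>j<n. B i j) * (y i)\<^sup>2"
      using D by (simp add: less_imp_le mult_right_mono)
    show "\<exists>i\<in>{..<n}. t * (y i)\<^sup>2 < (\<Sum>j<n. B i j) * (y i)\<^sup>2"
      using i0 D[of i0] by (intro bexI[of _ i0] mult_strict_right_mono) simp_all
  qed simp
  then show ?thesis using W[of y] unfolding eq by (simp del: sum_distrib_right)
qed

section \<open>Measurability of exact recovery\<close>

text \<open>Embeds matrices into a function space with the product topology. The value 0 outside the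
  index range fixes the irrelevant coordinates, so that the image of the elliptope is a closed
  subset of a compact cube.\<close>

definition mat_fun :: "nat \<Rightarrow> real mat \<Rightarrow> nat \<times> nat \<Rightarrow> real" where
  "mat_fun n Y = (\<lambda>(i, j). if i < n \<and> j < n then Y $$ (i, j) else 0)"

lemma continuous_on_coordinate [continuous_intros]:
  "continuous_on S (\<lambda>y :: 'a \<Rightarrow> 'b :: topological_space. y p)"
  by (rule continuous_on_product_then_coordinatewise) (rule continuous_on_id)

lemma compact_function_cube: "compact {y :: 'a \<Rightarrow> real. \<forall>p. y p \<in> {-1..1}}"
proof -
  have "compactin (product_topology (\<lambda>_. euclidean) UNIV) (PiE UNIV (\<lambda>_::'a. {-1..1::real}))"
    by (simp add: compactin_PiE)
  then show ?thesis
    by (simp add: euclidean_product_topology compactin_euclidean_iff PiE_UNIV_domain Pi_def)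
qed

text \<open>The form is nonnegative at e_i + e_j and at e_i - e_j, which is the 2 by 2 minor
  condition with unit diagonal. The test vector adds its two contributions, so \<open>i = j\<close>
  needs no separate case.\<close>

lemma elliptope_entry_bound:
  assumes "Y \<in> elliptope n" "i < n" "j < n"
  shows "\<bar>Y $$ (i, j)\<bar> \<le> 1"
proof -
  have Y: "psd_mat n Y" "Y $$ (i, i) = 1" "Y $$ (j, j) = 1" using assms by (auto simp: elliptope_def)
  have "0 \<le> 1 + s * s + 2 * s * Y $$ (i, j)" for s
  proof -
    define x where "x k = (if k = i then 1 else 0) + (if k = j then s else 0)" for k
    have S: "(\<Sum>k<n. f k * x k) = f i + s * f j" for f
    proof -
      have "f k * x k = (if k = i then f k else 0) + (if k = j then s * f k else 0)" for k
        by (simp add: x_def distrib_left)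
      then show ?thesis using assms by (simp add: sum.distrib)
    qed
    have "(\<Sum>k<n. \<Sum>l<n. Y $$ (k, l) * x k * x l) = (\<Sum>k<n. (\<Sum>l<n. Y $$ (k, l) * x l) * x k)"
      by (simp add: sum_distrib_right sum_distrib_left algebra_simps)
    also have "\<dots> = 1 + s * s + 2 * s * Y $$ (i, j)"
      unfolding S using Y psd_mat_sym[OF Y(1) assms(2,3)] by (simp add: algebra_simps)
    finally show ?thesis using psd_mat_quadratic_form[OF Y(1), of x] by simp
  qed
  from this[of 1] this[of "-1"] show ?thesis by simp
qed

text \<open>Every condition on the right, one for each test vector included, is closed in the
  product topology; compactness is read off from this form.\<close>

lemma mat_fun_elliptope:
  "mat_fun n ` elliptope n = {y. (\<forall>i j. \<not> (i < n \<and> j < n) \<longrightarrow> y (i, j) = 0) \<and> (\<forall>i<n. y (i, i) = 1) \<and>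
     (\<forall>i<n. \<forall>j<n. y (i, j) = y (j, i)) \<and> (\<forall>x. 0 \<le> (\<Sum>i<n. \<Sum>j<n. y (i, j) * x i * x j))}"
  (is "_ = ?K")
proof (intro equalityI subsetI)
  fix y assume "y \<in> mat_fun n ` elliptope n"
  then obtain Y where Y: "y = mat_fun n Y" "psd_mat n Y" "\<forall>i<n. Y $$ (i, i) = 1"
    by (auto simp: elliptope_def)
  then show "y \<in> ?K"
    using psd_mat_sym[OF Y(2)] psd_mat_quadratic_form[OF Y(2)] by (auto simp: mat_fun_def)
next
  fix y assume y: "y \<in> ?K"
  define Y where "Y = mat n n y"
  have "0 \<le> scalar_prod x (mult_mat_vec Y x)" if "x \<in> carrier_vec n" for x
  proof -
    have "scalar_prod x (mult_mat_vec Y x) = (\<Sum>i<n. x $ i * (\<Sum>j<n. y (i, j) * x $ j))"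
      using that by (auto simp: scalar_prod_def Y_def atLeast0LessThan intro!: sum.cong)
    also have "\<dots> = (\<Sum>i<n. \<Sum>j<n. y (i, j) * x $ i * x $ j)"
      by (simp add: sum_distrib_left algebra_simps)
    finally show ?thesis using y by simp
  qed
  moreover have "transpose_mat Y = Y" using y by (intro eq_matI) (auto simp: Y_def)
  ultimately have "Y \<in> elliptope n" using y by (auto simp: elliptope_def psd_mat_def Y_def)
  moreover have "mat_fun n Y = y" using y by (auto simp: mat_fun_def Y_def fun_eq_iff)
  ultimately show "y \<in> mat_fun n ` elliptope n" by blast
qed

lemma compact_mat_fun_elliptope: "compact (mat_fun n ` elliptope n)"
proof -
  have sub: "mat_fun n ` elliptope n \<subseteq> {y. \<forall>p. y p \<in> {-1..1}}"
    using elliptope_entry_bound by (fastforce simp: mat_fun_def abs_le_iff)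
  have "closed (mat_fun n ` elliptope n)"
    unfolding mat_fun_elliptope
    by (intro closed_Collect_conj closed_Collect_all closed_Collect_imp closed_Collect_eq closed_Collect_le
        open_Collect_const continuous_intros)
  then have "compact ({y. \<forall>p. y p \<in> {-1..1}} \<inter> mat_fun n ` elliptope n)"
    by (intro compact_Int_closed compact_function_cube)
  then show ?thesis using sub by (simp add: Int_absorb1)
qed

lemma compact_mat_fun_balanced_elliptope: "compact (mat_fun n ` balanced_elliptope n)"
proof -
  have "mat_fun n ` balanced_elliptope n = mat_fun n ` elliptope n \<inter> {y. (\<Sum>i<n. \<Sum>j<n. y (i, j)) = 0}"
  proof -
    have "entry_sum Y = (\<Sum>i<n. \<Sum>j<n. mat_fun n Y (i, j))" if "Y \<in> elliptope n" for Y
      using that by (auto simp: elliptope_def psd_mat_def entry_sum_def mat_fun_def intro!: sum.cong)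
    then show ?thesis by (auto simp: balanced_elliptope_def)
  qed
  moreover have "closed {y :: nat \<times> nat \<Rightarrow> real. (\<Sum>i<n. \<Sum>j<n. y (i, j)) = 0}"
    by (intro closed_Collect_eq continuous_intros)
  ultimately show ?thesis using compact_mat_fun_elliptope by (simp add: compact_Int_closed)
qed

text \<open>By compactness, some \<open>Y \<in> C\<close> at distance at least \<open>1/k\<close> from \<open>Y0\<close> is as good as \<open>Y0\<close> iff for
  every \<open>m\<close> some such \<open>Y\<close> is worse by less than \<open>1/m\<close>, and this is an open condition on \<open>A\<close>.\<close>

lemma exact_recovery_event_measurable:
  assumes C: "C \<subseteq> carrier_mat n n" "Y0 \<in> C" "compact (mat_fun n ` C)"
    and A: "\<And>\<omega>. \<omega> \<in> space M \<Longrightarrow> A \<omega> \<in> carrier_mat n n"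
    and meas: "\<And>i j. i < n \<Longrightarrow> j < n \<Longrightarrow> (\<lambda>\<omega>. A \<omega> $$ (i, j)) \<in> borel_measurable M"
  shows "{\<omega> \<in> space M. exact_recovery C Y0 (A \<omega>)} \<in> sets M"
proof -
  define f where "f a y = (\<Sum>i<n. \<Sum>j<n. a (i, j) * (y (i, j) - mat_fun n Y0 (i, j)))"
    for a y :: "nat \<times> nat \<Rightarrow> real"
  define d where "d y = (\<Sum>i<n. \<Sum>j<n. \<bar>y (i, j) - mat_fun n Y0 (i, j)\<bar>)" for y :: "nat \<times> nat \<Rightarrow> real"
  define K where "K k = mat_fun n ` C \<inter> {y. 1 / real (Suc k) \<le> d y}" for k
  define U where "U k m = {a. \<exists>y\<in>K k. - 1 / real (Suc m) < f a y}" for k m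
  have d: "d (mat_fun n Y) = entry_norm1 (Y - Y0)" if "Y \<in> C" for Y
    using that C by (auto simp: d_def entry_norm1_def mat_fun_def intro!: sum.cong)
  have f: "f (mat_fun n B) (mat_fun n Y) = mat_inner B Y - mat_inner B Y0"
    if "Y \<in> C" "B \<in> carrier_mat n n" for B Y
    using that C
    by (auto simp: f_def mat_inner_def mat_fun_def sum_subtractf[symmetric] algebra_simps intro!: sum.cong)
  have compact: "compact (K k)" for k
    unfolding K_def d_def
    by (intro compact_Int_closed C closed_Collect_le continuous_intros)
  have "open (U k m)" for k m
  proof -
    have "U k m = (\<Union>y\<in>K k. {a. - 1 / real (Suc m) < f a y})" by (auto simp: U_def)
    moreover have "open {a. - 1 / real (Suc m) < f a y}" for y
      unfolding f_def by (intro open_Collect_less continuous_intros)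
    ultimately show ?thesis by auto
  qed
  then have U: "U k m \<in> sets borel" for k m by (rule borel_open)
  have "(\<lambda>\<omega>. mat_fun n (A \<omega>)) \<in> borel_measurable M"
  proof (rule measurable_coordinatewise_then_product)
    fix p show "(\<lambda>\<omega>. mat_fun n (A \<omega>) p) \<in> borel_measurable M"
      using meas by (cases p; cases "fst p < n \<and> snd p < n") (auto simp: mat_fun_def)
  qed
  then have "{\<omega> \<in> space M. mat_fun n (A \<omega>) \<in> U k m} \<in> sets M" for k m
    using measurable_sets[OF _ U[of k m]] by (auto simp: vimage_def Int_def conj_commute)
  then have meas': "{\<omega> \<in> space M. \<forall>k. \<not> (\<forall>m. mat_fun n (A \<omega>) \<in> U k m)} \<in> sets M"
    by measurable
  have attained: "(\<forall>m. a \<in> U k m) \<longleftrightarrow> (\<exists>y\<in>K k. 0 \<le> f a y)" for a k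
  proof
    assume a: "\<forall>m. a \<in> U k m"
    then have "K k \<noteq> {}" by (auto simp: U_def)
    moreover have "continuous_on (K k) (f a)"
      unfolding f_def by (intro continuous_intros)
    \<comment> \<open>Membership in each \<open>U k m\<close> yields a point depending on
      \<open>m\<close>; the maximiser on the compact set \<open>K k\<close> serves all
      \<open>m\<close> at once.\<close>
    ultimately obtain y where y: "y \<in> K k" "\<And>z. z \<in> K k \<Longrightarrow> f a z \<le> f a y"
      using continuous_attains_sup[OF compact] by blast
    have "- 1 / real (Suc m) \<le> f a y" for m
      using a y(2) by (force simp: U_def dest: spec[of _ m])
    moreover have "(\<lambda>m. - 1 / real (Suc m)) \<longlonglongrightarrow> 0"
      using tendsto_minus[OF LIMSEQ_inverse_real_of_nat] by (simp add: divide_inverse)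
    ultimately have "0 \<le> f a y" by (intro LIMSEQ_le_const2) auto
    then show "\<exists>y\<in>K k. 0 \<le> f a y" using y by blast
  next
    assume "\<exists>y\<in>K k. 0 \<le> f a y"
    then obtain y where y: "y \<in> K k" "0 \<le> f a y" by blast
    have "- 1 / real (Suc m) < f a y" for m using y(2) by (intro less_le_trans[OF _ y(2)]) simp
    then show "\<forall>m. a \<in> U k m" using y by (auto simp: U_def)
  qed
  have "exact_recovery C Y0 (A \<omega>) \<longleftrightarrow> (\<forall>k. \<not> (\<forall>m. mat_fun n (A \<omega>) \<in> U k m))"
    if \<omega>: "\<omega> \<in> space M" for \<omega>
  proof -
    have "(\<exists>k. \<exists>y\<in>K k. 0 \<le> f (mat_fun n (A \<omega>)) y) \<longleftrightarrow>
      (\<exists>Y\<in>C. 0 < entry_norm1 (Y - Y0) \<and> mat_inner (A \<omega>) Y0 \<le> mat_inner (A \<omega>) Y)"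
    proof safe
      fix k y assume "y \<in> K k" "0 \<le> f (mat_fun n (A \<omega>)) y"
      then obtain Y where Y: "Y \<in> C" "1 / real (Suc k) \<le> d (mat_fun n Y)"
        "0 \<le> f (mat_fun n (A \<omega>)) (mat_fun n Y)" by (auto simp: K_def)
      have "0 < 1 / real (Suc k)" by simp
      then show "\<exists>Y\<in>C. 0 < entry_norm1 (Y - Y0) \<and> mat_inner (A \<omega>) Y0 \<le> mat_inner (A \<omega>) Y"
        using Y d[OF Y(1)] f[OF Y(1) A[OF \<omega>]] by (intro bexI[OF _ Y(1)]) linarith
    next
      fix Y assume Y: "Y \<in> C" "0 < entry_norm1 (Y - Y0)" "mat_inner (A \<omega>) Y0 \<le> mat_inner (A \<omega>) Y"
      then obtain k where "inverse (real (Suc k)) < entry_norm1 (Y - Y0)"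
        using reals_Archimedean by blast
      then have "mat_fun n Y \<in> K k"
        using Y(1) d[OF Y(1)] by (auto simp: K_def divide_inverse)
      then show "\<exists>k. \<exists>y\<in>K k. 0 \<le> f (mat_fun n (A \<omega>)) y"
        using Y(3) f[OF Y(1) A[OF \<omega>]] by (intro exI[of _ k] bexI[of _ "mat_fun n Y"]) simp_all
    qed
    moreover have "0 < entry_norm1 (Y - Y0) \<longleftrightarrow> Y \<noteq> Y0" if "Y \<in> C" for Y
    proof -
      have "0 \<le> entry_norm1 (Y - Y0)" by (simp add: entry_norm1_def sum_nonneg)
      moreover have "entry_norm1 (Y - Y0) = 0 \<longleftrightarrow> Y = Y0"
        using that C entry_norm1_diff_eq_0_iff by blast
      ultimately show ?thesis by linarith
    qed
    ultimately show ?thesis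
      unfolding attained exact_recovery_iff[OF C(1,2)] by (metis not_le)
  qed
  then have "{\<omega> \<in> space M. exact_recovery C Y0 (A \<omega>)}
      = {\<omega> \<in> space M. \<forall>k. \<not> (\<forall>m. mat_fun n (A \<omega>) \<in> U k m)}" by blast
  then show ?thesis using meas' by simp
qed

section \<open>Traces of powers, walks and a grid\<close>

definition dot :: "nat \<Rightarrow> (nat \<Rightarrow> real) \<Rightarrow> (nat \<Rightarrow> real) \<Rightarrow> real" where
  "dot n u v = (\<Sum>i<n. u i * v i)"

definition symmetric_below :: "nat \<Rightarrow> (nat \<Rightarrow> nat \<Rightarrow> real) \<Rightarrow> bool" where
  "symmetric_below n W \<longleftrightarrow> (\<forall>i<n. \<forall>j<n. W i j = W j i)"

definition apply_mat :: "nat \<Rightarrow> (nat \<Rightarrow> nat \<Rightarrow> real) \<Rightarrow> (nat \<Rightarrow> real) \<Rightarrow> nat \<Rightarrow> real" where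
  "apply_mat n W u i = (\<Sum>j<n. W i j * u j)"

definition std_basis :: "nat \<Rightarrow> nat \<Rightarrow> real" where
  "std_basis j i = (if i = j then 1 else 0)"

definition trace_power :: "nat \<Rightarrow> nat \<Rightarrow> (nat \<Rightarrow> nat \<Rightarrow> real) \<Rightarrow> real" where
  "trace_power n m W = (\<Sum>i<n. (apply_mat n W ^^ m) (std_basis i) i)"

definition closed_walks :: "nat \<Rightarrow> nat \<Rightarrow> (nat \<Rightarrow> nat) set" where
  "closed_walks n m = {w \<in> {..m} \<rightarrow>\<^sub>E {..<n}. w 0 = w m}"

lemma dot_unit: "i < n \<Longrightarrow> dot n (std_basis i) u = u i"
proof -
  assume "i < n"
  have "dot n (std_basis i) u = (\<Sum>k<n. if k = i then u k else 0)"
    unfolding dot_def std_basis_def by (intro sum.cong refl) auto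
  then show ?thesis using \<open>i < n\<close> by simp
qed

lemma dot_self_nonneg: "0 \<le> dot n u u"
  by (simp add: dot_def sum_nonneg)

lemma dot_Cauchy_Schwarz: "(dot n u v)\<^sup>2 \<le> dot n u u * dot n v v"
  using Cauchy_Schwarz_ineq_sum[of u v "{..<n}"] by (simp add: dot_def power2_eq_square)

lemma dot_app_eq: "dot n u (apply_mat n W v) = (\<Sum>i<n. \<Sum>j<n. W i j * u i * v j)"
  by (simp add: dot_def apply_mat_def sum_distrib_left algebra_simps)

lemma dot_app_sym:
  assumes "symmetric_below n W"
  shows "dot n (apply_mat n W u) v = dot n u (apply_mat n W v)"
proof -
  have "dot n (apply_mat n W u) v = (\<Sum>i<n. \<Sum>j<n. W i j * u j * v i)"
    by (simp add: dot_def apply_mat_def sum_distrib_right)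
  also have "\<dots> = (\<Sum>j<n. \<Sum>i<n. W i j * u j * v i)" by (rule sum.swap)
  also have "\<dots> = dot n u (apply_mat n W v)"
    unfolding dot_app_eq using assms by (intro sum.cong refl) (simp add: symmetric_below_def)
  finally show ?thesis .
qed

lemma dot_funpow_sym:
  assumes "symmetric_below n W"
  shows "dot n ((apply_mat n W ^^ k) u) v = dot n u ((apply_mat n W ^^ k) v)"
proof (induction k arbitrary: v)
  case (Suc k)
  have "dot n ((apply_mat n W ^^ Suc k) u) v = dot n ((apply_mat n W ^^ k) u) (apply_mat n W v)"
    using dot_app_sym[OF assms] by simp
  also have "\<dots> = dot n u ((apply_mat n W ^^ Suc k) v)"
    unfolding Suc by (simp add: funpow_swap1)
  finally show ?case .
qed simp

text \<open>The trace of W^(2k) is the squared Frobenius norm of W^k. Hence it is nonnegative and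
  dominates the squared operator norm of W^k.\<close>

lemma trace_power_even:
  assumes "symmetric_below n W"
  shows "trace_power n (2 * k) W = (\<Sum>i<n. dot n ((apply_mat n W ^^ k) (std_basis i)) ((apply_mat n W ^^ k) (std_basis i)))"
  unfolding trace_power_def
proof (intro sum.cong refl)
  fix i assume "i \<in> {..<n}"
  then have "(apply_mat n W ^^ (2 * k)) (std_basis i) i = dot n (std_basis i) ((apply_mat n W ^^ k) ((apply_mat n W ^^ k) (std_basis i)))"
    by (simp add: dot_unit mult_2 funpow_add)
  then show "(apply_mat n W ^^ (2 * k)) (std_basis i) i = dot n ((apply_mat n W ^^ k) (std_basis i)) ((apply_mat n W ^^ k) (std_basis i))"
    using dot_funpow_sym[OF assms] by simp
qed

lemma trace_power_even_nonneg:
  assumes "symmetric_below n W"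
  shows "0 \<le> trace_power n (2 * k) W"
  unfolding trace_power_even[OF assms] by (simp add: sum_nonneg dot_self_nonneg)

lemma norm_funpow_le_trace_power:
  assumes "symmetric_below n W"
  shows "dot n ((apply_mat n W ^^ k) x) ((apply_mat n W ^^ k) x) \<le> trace_power n (2 * k) W * dot n x x"
proof -
  have "dot n ((apply_mat n W ^^ k) x) ((apply_mat n W ^^ k) x)
      = (\<Sum>i<n. (dot n ((apply_mat n W ^^ k) (std_basis i)) x)\<^sup>2)"
    unfolding dot_def[of n "(apply_mat n W ^^ k) x"]
    using dot_funpow_sym[OF assms] by (intro sum.cong refl) (simp add: dot_unit power2_eq_square)
  also have "\<dots> \<le> (\<Sum>i<n. dot n ((apply_mat n W ^^ k) (std_basis i)) ((apply_mat n W ^^ k) (std_basis i)) * dot n x x)"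
    by (intro sum_mono dot_Cauchy_Schwarz)
  also have "\<dots> = trace_power n (2 * k) W * dot n x x"
    unfolding trace_power_even[OF assms] by (simp add: sum_distrib_right)
  finally show ?thesis .
qed

lemma quadratic_form_le_of_unit:
  assumes main: "\<And>y. dot n y y = 1 \<Longrightarrow> dot n y (apply_mat n W y) \<le> s"
  shows "dot n x (apply_mat n W x) \<le> s * dot n x x"
proof (cases "dot n x x = 0")
  case True
  then have "(dot n x (apply_mat n W x))\<^sup>2 \<le> 0" using dot_Cauchy_Schwarz[of n x "apply_mat n W x"] by simp
  then show ?thesis using True by simp
next
  case False
  then have pos: "0 < dot n x x" using dot_self_nonneg[of n x] by simp
  define c where "c = 1 / sqrt (dot n x x)"
  have c: "c * c = 1 / dot n x x" using pos by (simp add: c_def)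
  have scale: "dot n (\<lambda>i. c * x i) (apply_mat n W (\<lambda>i. c * x i)) = c * c * dot n x (apply_mat n W x)"
    unfolding dot_app_eq by (simp add: sum_distrib_left algebra_simps)
  have "dot n (\<lambda>i. c * x i) (\<lambda>i. c * x i) = c * c * dot n x x"
    by (simp add: dot_def sum_distrib_left algebra_simps)
  then have "c * c * dot n x (apply_mat n W x) \<le> s"
    using main[of "\<lambda>i. c * x i"] c pos scale by simp
  then show ?thesis unfolding c using pos by (simp add: field_simps)
qed

text \<open>Replaces the spectral theorem by repeated Cauchy-Schwarz: with a_m the squared length of
  W^m y for a unit vector y, symmetry gives a_m^2 <= a_(2m). Iterating from a_1 reaches only powers
  of two, which is why the exponent has the form \<open>2 * 2 ^ h\<close>.\<close>

lemma quadratic_form_le_of_trace_power: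
  assumes sym: "symmetric_below n W"
    and trace: "trace_power n (2 * 2 ^ h) W \<le> s ^ (2 * 2 ^ h)" and "0 \<le> s"
  shows "dot n x (apply_mat n W x) \<le> s * dot n x x"
proof -
  define a where "a m y = dot n ((apply_mat n W ^^ m) y) ((apply_mat n W ^^ m) y)" for m y
  have main: "dot n y (apply_mat n W y) \<le> s" if y: "dot n y y = 1" for y
  proof -
    have dbl: "(a m y)\<^sup>2 \<le> a (2 * m) y" for m
    proof -
      have "a m y = dot n y ((apply_mat n W ^^ (2 * m)) y)"
        using dot_funpow_sym[OF sym] by (simp add: a_def mult_2 funpow_add)
      then show ?thesis
        using dot_Cauchy_Schwarz[of n y "(apply_mat n W ^^ (2 * m)) y"] y by (simp add: a_def)
    qed
    have pow: "(a 1 y) ^ (2 ^ j) \<le> a (2 ^ j) y" for j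
    proof (induction j)
      case (Suc j)
      have "(a 1 y) ^ (2 ^ Suc j) = ((a 1 y) ^ (2 ^ j))\<^sup>2" by (simp add: power_mult[symmetric] mult.commute)
      also have "\<dots> \<le> (a (2 ^ j) y)\<^sup>2"
        using Suc by (intro power_mono) (simp_all add: a_def dot_self_nonneg)
      also have "\<dots> \<le> a (2 ^ Suc j) y" using dbl by simp
      finally show ?case .
    qed simp
    have "(dot n y (apply_mat n W y))\<^sup>2 \<le> a 1 y"
      using dot_Cauchy_Schwarz[of n y "apply_mat n W y"] y by (simp add: a_def)
    then have "((dot n y (apply_mat n W y))\<^sup>2) ^ (2 ^ h) \<le> (a 1 y) ^ (2 ^ h)"
      by (intro power_mono) auto
    also have "\<dots> \<le> a (2 ^ h) y" by (rule pow)
    also have "\<dots> \<le> trace_power n (2 * 2 ^ h) W"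
      using norm_funpow_le_trace_power[OF sym, of "2 ^ h" y] y by (simp add: a_def)
    also have "\<dots> \<le> s ^ (2 * 2 ^ h)" by (rule trace)
    finally have "\<bar>dot n y (apply_mat n W y)\<bar> ^ (2 * 2 ^ h) \<le> s ^ (2 * 2 ^ h)"
      by (simp add: power_mult)
    then have "\<bar>dot n y (apply_mat n W y)\<bar> \<le> s"
      using \<open>0 \<le> s\<close> by (subst (asm) power_mono_iff) auto
    then show ?thesis by simp
  qed
  show ?thesis by (rule quadratic_form_le_of_unit) (rule main)
qed

text \<open>Taking \<open>u\<close> in the direction of W v shows that W stretches lengths by at
  most \<open>s\<close>; iterating this on the \<open>n\<close> basis vectors bounds the Frobenius
  norm of W^k.\<close>

lemma trace_power_le_of_bilinear_bound:
  assumes sym: "symmetric_below n W"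
    and bound: "\<And>u v. dot n u u \<le> 1 \<Longrightarrow> dot n v v \<le> 1 \<Longrightarrow> dot n u (apply_mat n W v) \<le> s" and "0 \<le> s"
  shows "trace_power n (2 * k) W \<le> real n * s ^ (2 * k)"
proof -
  have contract: "dot n (apply_mat n W v) (apply_mat n W v) \<le> s\<^sup>2 * dot n v v" for v
  proof (cases "dot n (apply_mat n W v) (apply_mat n W v) = 0 \<or> dot n v v = 0")
    case True
    then show ?thesis
    proof
      assume "dot n v v = 0"
      then have "\<And>i. i < n \<Longrightarrow> v i = 0"
        by (simp add: dot_def sum_nonneg_eq_0_iff)
      then have "apply_mat n W v i = 0" for i by (simp add: apply_mat_def)
      then show ?thesis by (simp add: dot_def sum_nonneg)
    qed (simp add: dot_self_nonneg)
  next
    case False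
    define A B where "A = dot n (apply_mat n W v) (apply_mat n W v)" and "B = dot n v v"
    have AB: "0 < A" "0 < B"
      using False dot_self_nonneg[of n v] dot_self_nonneg[of n "apply_mat n W v"] by (auto simp: A_def B_def)
    define a b where "a = 1 / sqrt A" and "b = 1 / sqrt B"
    have a: "a * a = 1 / A" and b: "b * b = 1 / B" and ab: "a \<ge> 0" "b \<ge> 0"
      using AB by (simp_all add: a_def b_def)
    have "dot n (\<lambda>i. a * apply_mat n W v i) (apply_mat n W (\<lambda>i. b * v i)) \<le> s"
    proof (rule bound)
      have "dot n (\<lambda>i. a * apply_mat n W v i) (\<lambda>i. a * apply_mat n W v i) = a * a * A"
        by (simp add: dot_def A_def sum_distrib_left algebra_simps)
      then show "dot n (\<lambda>i. a * apply_mat n W v i) (\<lambda>i. a * apply_mat n W v i) \<le> 1" using AB a by simp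
      have "dot n (\<lambda>i. b * v i) (\<lambda>i. b * v i) = b * b * B"
        by (simp add: dot_def B_def sum_distrib_left algebra_simps)
      then show "dot n (\<lambda>i. b * v i) (\<lambda>i. b * v i) \<le> 1" using AB b by simp
    qed
    also have "dot n (\<lambda>i. a * apply_mat n W v i) (apply_mat n W (\<lambda>i. b * v i)) = a * b * A"
    proof -
      have "apply_mat n W (\<lambda>i. b * v i) = (\<lambda>i. b * apply_mat n W v i)"
        by (simp add: apply_mat_def fun_eq_iff sum_distrib_left algebra_simps)
      then show ?thesis by (simp add: dot_def A_def sum_distrib_left algebra_simps)
    qed
    finally have "(a * b * A)\<^sup>2 \<le> s\<^sup>2" using ab AB by (intro power_mono) auto
    moreover have "(a * b * A)\<^sup>2 = (a * a) * (b * b) * (A * A)" by (simp add: power2_eq_square)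
    ultimately have "A / B \<le> s\<^sup>2" unfolding a b using AB by simp
    then show ?thesis using AB by (simp add: A_def B_def field_simps)
  qed
  have pow: "dot n ((apply_mat n W ^^ k) v) ((apply_mat n W ^^ k) v) \<le> s ^ (2 * k) * dot n v v" for k v
  proof (induction k)
    case (Suc k)
    have "dot n ((apply_mat n W ^^ Suc k) v) ((apply_mat n W ^^ Suc k) v)
        \<le> s\<^sup>2 * dot n ((apply_mat n W ^^ k) v) ((apply_mat n W ^^ k) v)"
      using contract by simp
    also have "\<dots> \<le> s\<^sup>2 * (s ^ (2 * k) * dot n v v)" using Suc by (intro mult_left_mono) auto
    finally show ?case by (simp add: power_add power2_eq_square mult.assoc)
  qed simp
  have "trace_power n (2 * k) W \<le> (\<Sum>i<n. s ^ (2 * k))"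
    unfolding trace_power_even[OF sym]
  proof (rule sum_mono)
    fix i assume "i \<in> {..<n}"
    then have "dot n (std_basis i) (std_basis i) = 1" by (simp add: dot_unit) (simp add: std_basis_def)
    then show "dot n ((apply_mat n W ^^ k) (std_basis i)) ((apply_mat n W ^^ k) (std_basis i)) \<le> s ^ (2 * k)"
      using pow[of k "std_basis i"] by simp
  qed
  then show ?thesis by simp
qed

section \<open>Expansion of traces over closed walks\<close>

lemma sum_PiE_atMost_Suc:
  fixes f :: "(nat \<Rightarrow> 'a) \<Rightarrow> real"
  assumes "finite B"
  shows "(\<Sum>w\<in>{..Suc m} \<rightarrow>\<^sub>E B. f w) = (\<Sum>w\<in>{..m} \<rightarrow>\<^sub>E B. \<Sum>b\<in>B. f (w(Suc m := b)))"
proof -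
  have "{..Suc m} \<rightarrow>\<^sub>E B = (\<lambda>(b, w). w(Suc m := b)) ` (B \<times> ({..m} \<rightarrow>\<^sub>E B))"
    by (simp add: atMost_Suc PiE_insert_eq)
  moreover have "inj_on (\<lambda>(b, w). w(Suc m := b)) (B \<times> ({..m} \<rightarrow>\<^sub>E B))"
    using inj_combinator[of "Suc m" "{..m}" "\<lambda>_. B"] by simp
  ultimately have "(\<Sum>w\<in>{..Suc m} \<rightarrow>\<^sub>E B. f w) = (\<Sum>(b, w)\<in>B \<times> ({..m} \<rightarrow>\<^sub>E B). f (w(Suc m := b)))"
    by (simp add: sum.reindex case_prod_unfold)
  also have "\<dots> = (\<Sum>w\<in>{..m} \<rightarrow>\<^sub>E B. \<Sum>b\<in>B. f (w(Suc m := b)))"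
    using assms by (simp add: sum.cartesian_product[symmetric]) (rule sum.swap)
  finally show ?thesis .
qed

text \<open>A general vector \<open>u\<close> at the endpoint of the walk makes the induction work:
  one application of W is moved onto \<open>u\<close> and becomes the last step.\<close>

lemma app_funpow_walks:
  assumes "i < n"
  shows "(apply_mat n W ^^ m) u i = (\<Sum>w\<in>{..m} \<rightarrow>\<^sub>E {..<n}.
    if w 0 = i then (\<Prod>t<m. W (w t) (w (Suc t))) * u (w m) else 0)"
  using assms
proof (induction m arbitrary: u)
  case 0
  have "(\<Sum>w\<in>{..0::nat} \<rightarrow>\<^sub>E {..<n}. if w 0 = i then u (w 0) else 0)
    = (\<Sum>w\<in>{\<lambda>t::nat. if t = 0 then i else undefined}. u (w 0))"
  proof (rule sum.mono_neutral_cong_right)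
    show "finite ({..0 :: nat} \<rightarrow>\<^sub>E {..<n})" by (intro finite_PiE) auto
  qed (use 0 in \<open>auto simp: PiE_def extensional_def fun_eq_iff\<close>)
  then show ?case by (simp add: atMost_0 cong: if_cong)
next
  case (Suc m)
  have "(apply_mat n W ^^ Suc m) u i = (apply_mat n W ^^ m) (apply_mat n W u) i" by (simp add: funpow_swap1)
  also have "\<dots> = (\<Sum>w\<in>{..m} \<rightarrow>\<^sub>E {..<n}. \<Sum>b<n.
      if w 0 = i then (\<Prod>t<m. W (w t) (w (Suc t))) * (W (w m) b * u b) else 0)"
    unfolding Suc.IH[OF Suc.prems]
    by (intro sum.cong refl) (simp add: apply_mat_def sum_distrib_left)
  also have "\<dots> = (\<Sum>w\<in>{..Suc m} \<rightarrow>\<^sub>E {..<n}.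
      if w 0 = i then (\<Prod>t<Suc m. W (w t) (w (Suc t))) * u (w (Suc m)) else 0)"
    unfolding sum_PiE_atMost_Suc[OF finite_lessThan]
    by (intro sum.cong refl) (simp add: mult.assoc)
  finally show ?case .
qed

lemma trace_power_walks:
  "trace_power n m W = (\<Sum>w\<in>closed_walks n m. \<Prod>t<m. W (w t) (w (Suc t)))"
proof -
  have "trace_power n m W = (\<Sum>i<n. \<Sum>w\<in>{..m} \<rightarrow>\<^sub>E {..<n}.
      if w 0 = i then (\<Prod>t<m. W (w t) (w (Suc t))) * std_basis i (w m) else 0)"
    unfolding trace_power_def by (intro sum.cong refl app_funpow_walks) simp
  also have "\<dots> = (\<Sum>w\<in>{..m} \<rightarrow>\<^sub>E {..<n}. \<Sum>i<n.
      if w 0 = i then (\<Prod>t<m. W (w t) (w (Suc t))) * std_basis i (w m) else 0)"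
    by (rule sum.swap)
  also have "\<dots> = (\<Sum>w\<in>{..m} \<rightarrow>\<^sub>E {..<n}. (\<Prod>t<m. W (w t) (w (Suc t))) * std_basis (w 0) (w m))"
    by (intro sum.cong refl) (auto simp: PiE_def Pi_def)
  also have "\<dots> = (\<Sum>w\<in>closed_walks n m. \<Prod>t<m. W (w t) (w (Suc t)))"
    by (rule sum.mono_neutral_cong_right)
      (auto simp: closed_walks_def std_basis_def finite_PiE)
  finally show ?thesis .
qed

section \<open>An integer grid that controls bilinear forms\<close>

text \<open>Integer points standing for the unit ball scaled by \<open>sqrt n\<close>; the bound
  \<open>4 * n\<close> leaves room for rounding every coordinate by up to 1. The box embeds the grid
  into a finite product, over which sums factorise.\<close>

definition grid :: "nat \<Rightarrow> (nat \<Rightarrow> int) set" where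
  "grid n = {z \<in> {..<n} \<rightarrow>\<^sub>E {- 4 * int n..4 * int n}. (\<Sum>i<n. (z i)\<^sup>2) \<le> 4 * int n}"

lemma abs_le_square_int: "\<bar>k\<bar> \<le> k\<^sup>2" for k :: int
proof (cases "k = 0")
  case False
  then have "\<bar>k\<bar> * 1 \<le> \<bar>k\<bar> * \<bar>k\<bar>" by (intro mult_left_mono) auto
  then show ?thesis by (simp add: power2_eq_square)
qed simp

lemma finite_grid: "finite (grid n)"
  unfolding grid_def by (rule finite_subset[of _ "{..<n} \<rightarrow>\<^sub>E {- 4 * int n..4 * int n}"])
    (auto simp: finite_PiE)

lemma sum_half_power_abs_le: "(\<Sum>z\<in>{- int N..int N}. (1/2) ^ nat \<bar>z\<bar>) \<le> (4 :: real)"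
proof -
  let ?f = "\<lambda>z :: int. (1/2) ^ nat \<bar>z\<bar> :: real"
  have geo: "(\<Sum>k\<le>N. (1/2) ^ k) \<le> (2 :: real)"
    using sum_gp0[of "1/2 :: real" N] by simp
  have "{- int N..int N} \<subseteq> int ` {..N} \<union> (\<lambda>k. - int k) ` {..N}"
  proof
    fix z assume "z \<in> {- int N..int N}"
    then have "nat \<bar>z\<bar> \<le> N" "z = int (nat \<bar>z\<bar>) \<or> z = - int (nat \<bar>z\<bar>)" by auto
    then show "z \<in> int ` {..N} \<union> (\<lambda>k. - int k) ` {..N}" by blast
  qed
  then have "sum ?f {- int N..int N} \<le> sum ?f (int ` {..N} \<union> (\<lambda>k. - int k) ` {..N})"
    by (intro sum_mono2) auto
  also have "\<dots> \<le> sum ?f (int ` {..N}) + sum ?f ((\<lambda>k. - int k) ` {..N})"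
    by (subst sum.union_inter[symmetric]) (auto intro: sum_nonneg)
  also have "\<dots> = (\<Sum>k\<le>N. (1/2) ^ k) + (\<Sum>k\<le>N. (1/2) ^ k)"
    by (subst (1 2) sum.reindex) (auto simp: inj_on_def)
  finally show ?thesis using geo by linarith
qed

text \<open>On the grid the sum of \<open>\<bar>z i\<bar>\<close> is at most the sum of squares,
  hence at most \<open>4 * n\<close>. The weight with factors 16 * 2^(-|z_i|) is therefore at least
  1 there, as 16 = 2^4, and its sum over the whole box factorises into \<open>n\<close> sums of at
  most 16 * 4 = 64.\<close>

lemma card_grid_le: "real (card (grid n)) \<le> 64 ^ n"
proof -
  let ?P = "{..<n} \<rightarrow>\<^sub>E {- 4 * int n..4 * int n}"
  have one: "1 \<le> (\<Prod>i<n. 16 * (1/2) ^ nat \<bar>z i\<bar> :: real)" if "z \<in> grid n" for z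
  proof -
    have "(\<Sum>i<n. nat \<bar>z i\<bar>) \<le> 4 * n"
    proof -
      have "int (\<Sum>i<n. nat \<bar>z i\<bar>) = (\<Sum>i<n. \<bar>z i\<bar>)" by simp
      also have "\<dots> \<le> (\<Sum>i<n. (z i)\<^sup>2)"
        by (intro sum_mono abs_le_square_int)
      also have "\<dots> \<le> 4 * int n" using that by (simp add: grid_def)
      finally show ?thesis by linarith
    qed
    then have half: "(1/2) ^ (4 * n) \<le> ((1/2) ^ (\<Sum>i<n. nat \<bar>z i\<bar>) :: real)"
      by (intro power_decreasing) auto
    have "1 = ((16 :: real) * (1/2) ^ 4) ^ n" by (simp add: power_one_over)
    also have "\<dots> = 16 ^ n * (1/2) ^ (4 * n)" by (simp only: power_mult power_mult_distrib)
    also have "\<dots> \<le> 16 ^ n * (1/2) ^ (\<Sum>i<n. nat \<bar>z i\<bar>)"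
      by (rule mult_left_mono[OF half]) simp
    also have "\<dots> = (\<Prod>i<n. 16 * (1/2) ^ nat \<bar>z i\<bar> :: real)"
      by (simp only: prod.distrib power_sum prod_constant card_lessThan)
    finally show ?thesis .
  qed
  have "real (card (grid n)) = (\<Sum>z\<in>grid n. 1)" by simp
  also have "\<dots> \<le> (\<Sum>z\<in>grid n. \<Prod>i<n. 16 * (1/2) ^ nat \<bar>z i\<bar>)"
    by (intro sum_mono one)
  also have "\<dots> \<le> (\<Sum>z\<in>?P. \<Prod>i<n. 16 * (1/2) ^ nat \<bar>z i\<bar>)"
  proof (rule sum_mono2)
    show "finite ?P" by (intro finite_PiE) auto
    show "grid n \<subseteq> ?P" by (auto simp: grid_def)
    show "0 \<le> (\<Prod>i<n. 16 * (1/2) ^ nat \<bar>z i\<bar> :: real)" for z by (rule prod_nonneg) simp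
  qed
  also have "\<dots> = (\<Prod>i<n. \<Sum>z\<in>{- 4 * int n..4 * int n}. 16 * (1/2) ^ nat \<bar>z\<bar>)"
    by (subst prod_sum_PiE) auto
  also have "\<dots> \<le> (\<Prod>i<n. 64 :: real)"
  proof (intro prod_mono conjI)
    fix i
    show "(\<Sum>z\<in>{- 4 * int n..4 * int n}. 16 * (1/2) ^ nat \<bar>z\<bar>) \<le> (64 :: real)"
      using sum_half_power_abs_le[of "4 * n"] by (simp add: sum_distrib_left[symmetric])
  qed (simp add: sum_nonneg)
  finally show ?thesis by simp
qed

text \<open>Each coordinate of \<open>sqrt n * u\<close> is rounded in the direction of the sign of
  \<open>c i\<close>, so the linear functional can only grow. No approximation error arises, unlike
  for an ordinary net.\<close>

lemma grid_rounding:
  assumes "dot n u u \<le> 1"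
  shows "\<exists>z\<in>grid n. sqrt n * (\<Sum>i<n. u i * c i) \<le> (\<Sum>i<n. real_of_int (z i) * c i)"
proof -
  define z where "z = (\<lambda>i\<in>{..<n}. if c i \<ge> 0 then \<lceil>sqrt n * u i\<rceil> else \<lfloor>sqrt n * u i\<rfloor>)"
  have close: "\<bar>real_of_int (z i) - sqrt n * u i\<bar> \<le> 1" if "i < n" for i
    using that by (simp add: z_def) linarith
  have "real_of_int (\<Sum>i<n. (z i)\<^sup>2) \<le> (\<Sum>i<n. 2 * n * (u i * u i) + 2)"
    unfolding of_int_sum
  proof (intro sum_mono)
    fix i assume "i \<in> {..<n}"
    then have "(real_of_int (z i) - sqrt n * u i)\<^sup>2 \<le> 1"
      using close[of i] by (simp add: abs_square_le_1)
    \<comment> \<open>With w the scaled coordinate, this is z^2 <= 2 w^2 + 2 (z - w)^2; the sum is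
      at most 2 n + 2 n, which explains the radius of the grid.\<close>
    moreover have "(real_of_int (z i))\<^sup>2
        \<le> 2 * (sqrt n * u i)\<^sup>2 + 2 * (real_of_int (z i) - sqrt n * u i)\<^sup>2"
      using zero_le_power2[of "real_of_int (z i) - 2 * (sqrt n * u i)"]
      unfolding power2_eq_square by (simp only: algebra_simps)
    moreover have "(sqrt n * u i)\<^sup>2 = n * (u i * u i)" by (simp add: power_mult_distrib power2_eq_square)
    ultimately show "real_of_int ((z i)\<^sup>2) \<le> 2 * n * (u i * u i) + 2" by simp
  qed
  also have "\<dots> = 2 * n * dot n u u + 2 * n"
    by (simp add: sum.distrib dot_def sum_distrib_left)
  also have "\<dots> \<le> 2 * real n * 1 + 2 * real n"
    using mult_left_mono[OF assms, of "2 * real n"] by simp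
  finally have sq: "(\<Sum>i<n. (z i)\<^sup>2) \<le> 4 * int n" by linarith
  have "z i \<in> {- 4 * int n..4 * int n}" if "i < n" for i
  proof -
    have "(z i)\<^sup>2 \<le> (\<Sum>i<n. (z i)\<^sup>2)" using that by (intro member_le_sum) auto
    moreover have "\<bar>z i\<bar> \<le> (z i)\<^sup>2" by (rule abs_le_square_int)
    ultimately show ?thesis using sq by auto
  qed
  then have "z \<in> grid n" using sq by (auto simp: grid_def z_def)
  moreover have "sqrt n * (\<Sum>i<n. u i * c i) \<le> (\<Sum>i<n. real_of_int (z i) * c i)"
    unfolding sum_distrib_left
  proof (intro sum_mono)
    fix i assume i: "i \<in> {..<n}"
    show "sqrt n * (u i * c i) \<le> real_of_int (z i) * c i"
    proof (cases "c i \<ge> 0")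
      case True
      then have "sqrt n * u i * c i \<le> real_of_int (z i) * c i"
        using i by (intro mult_right_mono) (auto simp: z_def)
      then show ?thesis by (simp add: mult.assoc)
    next
      case False
      then have "sqrt n * u i * c i \<le> real_of_int (z i) * c i"
        using i by (intro mult_right_mono_neg) (auto simp: z_def)
      then show ?thesis by (simp add: mult.assoc)
    qed
  qed
  ultimately show ?thesis by blast
qed

text \<open>The arguments are rounded one at a time, the second against the coefficients left by the
  first. Each rounding gains a factor \<open>sqrt n\<close>, which together produce the
  \<open>n\<close> in the hypothesis.\<close>

lemma bilinear_bound_of_grid:
  fixes s :: real
  assumes grid: "\<And>y z. y \<in> grid n \<Longrightarrow> z \<in> grid n \<Longrightarrow>
      (\<Sum>i<n. \<Sum>j<n. W i j * real_of_int (y i) * real_of_int (z j)) \<le> s * n"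
    and "dot n u u \<le> 1" "dot n v v \<le> 1" "0 < n"
  shows "dot n u (apply_mat n W v) \<le> s"
proof -
  obtain y where y: "y \<in> grid n"
    "sqrt n * (\<Sum>i<n. u i * apply_mat n W v i) \<le> (\<Sum>i<n. real_of_int (y i) * apply_mat n W v i)"
    using grid_rounding[OF assms(2)] by blast
  define c where "c j = (\<Sum>i<n. W i j * real_of_int (y i))" for j
  have c: "(\<Sum>i<n. real_of_int (y i) * apply_mat n W x i) = (\<Sum>j<n. x j * c j)" for x
    unfolding apply_mat_def c_def sum_distrib_left
    by (subst sum.swap) (simp add: algebra_simps)
  obtain z where z: "z \<in> grid n" "sqrt n * (\<Sum>j<n. v j * c j) \<le> (\<Sum>j<n. real_of_int (z j) * c j)"
    using grid_rounding[OF assms(3)] by blast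
  have "n * dot n u (apply_mat n W v) = sqrt n * (sqrt n * (\<Sum>i<n. u i * apply_mat n W v i))"
    by (simp add: dot_def)
  also have "\<dots> \<le> sqrt n * (\<Sum>j<n. v j * c j)"
    using y(2) unfolding c by (intro mult_left_mono) auto
  also have "\<dots> \<le> (\<Sum>j<n. real_of_int (z j) * c j)" by (rule z)
  also have "\<dots> = (\<Sum>i<n. real_of_int (y i) * apply_mat n W (\<lambda>j. real_of_int (z j)) i)" by (simp only: c)
  also have "\<dots> = (\<Sum>i<n. \<Sum>j<n. W i j * real_of_int (y i) * real_of_int (z j))"
    by (simp add: apply_mat_def sum_distrib_left algebra_simps)
  also have "\<dots> \<le> s * n" by (intro grid y z)
  finally show ?thesis using \<open>0 < n\<close> by (simp add: mult.commute)
qed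

section \<open>Comparison of walk counts\<close>

text \<open>The unordered edge as a sorted pair, loops included: it is the index in
  \<open>upper_pairs\<close> of the independent entry that the step reads through
  \<open>sym_extend\<close>.\<close>

definition walk_edge :: "(nat \<Rightarrow> nat) \<Rightarrow> nat \<Rightarrow> nat \<times> nat" where
  "walk_edge w t = (min (w t) (w (Suc t)), max (w t) (w (Suc t)))"

definition edge_doubled :: "nat \<Rightarrow> (nat \<Rightarrow> nat) \<Rightarrow> bool" where
  "edge_doubled m w \<longleftrightarrow> (\<forall>t<m. \<exists>s<m. s \<noteq> t \<and> walk_edge w s = walk_edge w t)"

definition doubled_walks :: "nat \<Rightarrow> nat \<Rightarrow> (nat \<Rightarrow> nat) set" where
  "doubled_walks n m = {w \<in> closed_walks n m. edge_doubled m w}"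

definition upper_pairs :: "nat \<Rightarrow> (nat \<times> nat) set" where
  "upper_pairs n = {(i, j). i \<le> j \<and> j < n}"

definition sym_extend :: "(nat \<times> nat \<Rightarrow> real) \<Rightarrow> nat \<Rightarrow> nat \<Rightarrow> real" where
  "sym_extend x i j = x (min i j, max i j)"

lemma finite_upper_pairs [simp]: "finite (upper_pairs n)"
  by (rule finite_subset[of _ "{..<n} \<times> {..<n}"]) (auto simp: upper_pairs_def)

lemma symmetric_below_sym_extend: "symmetric_below n (sym_extend x)"
  by (simp add: symmetric_below_def sym_extend_def min.commute max.commute)

lemma finite_closed_walks [simp]: "finite (closed_walks n m)"
proof -
  have "finite ({..m} \<rightarrow>\<^sub>E {..<n})" by (intro finite_PiE) auto
  then show ?thesis by (simp add: closed_walks_def)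
qed

lemma finite_doubled_walks [simp]: "finite (doubled_walks n m)"
  by (simp add: doubled_walks_def)

lemma walk_edge_eq_iff: "walk_edge v s = walk_edge w t \<longleftrightarrow> {v s, v (Suc s)} = {w t, w (Suc t)}"
  by (auto simp: walk_edge_def min_def max_def doubleton_eq_iff)

text \<open>Only the pattern of coincidences among edges matters, and an injective relabelling of
  the vertices preserves it.\<close>

lemma edge_doubled_inj:
  assumes "inj_on f (w ` {..m})" and v: "\<And>t. t \<le> m \<Longrightarrow> v t = f (w t)"
  shows "edge_doubled m v \<longleftrightarrow> edge_doubled m w"
proof -
  have "walk_edge v s = walk_edge v t \<longleftrightarrow> walk_edge w s = walk_edge w t" if "s < m" "t < m" for s t
  proof -
    have "{v s, v (Suc s)} = f ` {w s, w (Suc s)}" "{v t, v (Suc t)} = f ` {w t, w (Suc t)}"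
      using v that by auto
    then show ?thesis
      unfolding walk_edge_eq_iff using that
      by (simp only:) (rule inj_on_image_eq_iff[OF assms(1)], auto)
  qed
  then show ?thesis unfolding edge_doubled_def by blast
qed

text \<open>A step to a new vertex crosses a new edge; this is the tree bound for a connected
  graph.\<close>

lemma card_walk_vertices_le: "card (w ` {..m}) \<le> card (walk_edge w ` {..<m}) + 1"
proof (induction m)
  case 0
  then show ?case by (simp add: atMost_0)
next
  case (Suc m)
  have V: "w ` {..Suc m} = insert (w (Suc m)) (w ` {..m})" by (simp add: atMost_Suc)
  have E: "walk_edge w ` {..<Suc m} = insert (walk_edge w m) (walk_edge w ` {..<m})"
    by (simp add: lessThan_Suc)
  show ?case
  proof (cases "w (Suc m) \<in> w ` {..m}")
    case True
    then have "card (w ` {..Suc m}) = card (w ` {..m})" unfolding V by (simp add: insert_absorb)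
    also have "\<dots> \<le> card (walk_edge w ` {..<m}) + 1" by (rule Suc.IH)
    also have "\<dots> \<le> card (walk_edge w ` {..<Suc m}) + 1"
      unfolding E by (simp add: card_insert_le)
    finally show ?thesis .
  next
    case False
    have "walk_edge w m \<notin> walk_edge w ` {..<m}"
    proof
      assume "walk_edge w m \<in> walk_edge w ` {..<m}"
      then obtain t where "t < m" "{w m, w (Suc m)} = {w t, w (Suc t)}"
        unfolding image_iff walk_edge_eq_iff by auto
      then have "w (Suc m) \<in> {w t, w (Suc t)}" by blast
      then show False using False \<open>t < m\<close> by auto
    qed
    then have "card (walk_edge w ` {..<Suc m}) = card (walk_edge w ` {..<m}) + 1"
      unfolding E by simp
    moreover have "card (w ` {..Suc m}) = card (w ` {..m}) + 1" unfolding V using False by simp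
    ultimately show ?thesis using Suc.IH by simp
  qed
qed

text \<open>The count is a falling factorial with factors \<open>r - i\<close> for
  \<open>i < card S\<close>. Since \<open>card S\<close> is at most \<open>m + 1\<close>, the
  largest such \<open>i\<close> is at most \<open>m\<close>, so every factor is at least
  \<open>a\<close>.\<close>

lemma power_le_card_injections:
  assumes "finite S" "card S \<le> m + 1" "0 \<le> a" "a \<le> real r - real m"
  shows "a ^ card S \<le> real (card {f \<in> S \<rightarrow>\<^sub>E {..<r}. inj_on f S})"
proof -
  have "card {f \<in> S \<rightarrow>\<^sub>E {..<r}. inj_on f S} = (\<Prod>i<card S. r - i)"
    using card_inj_on_subset_funcset[of S "{..<r}" S] assms(1) by (simp add: atLeast0LessThan)
  moreover have "a ^ card S \<le> (\<Prod>i<card S. real (r - i))"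
  proof -
    have "(\<Prod>i<card S. a) \<le> (\<Prod>i<card S. real (r - i))"
      using assms by (intro prod_mono) auto
    then show ?thesis by simp
  qed
  ultimately show ?thesis by simp
qed

text \<open>Double counting of the pairs of a walk in \<open>n\<close> vertices and a relabelling of its vertices by
  \<open>r\<close> labels; such a pair is determined by the relabelled walk and the inverse relabelling. It trades
  the sparsity \<open>q\<close> against the dimension.\<close>

lemma doubled_walks_compare:
  assumes "0 \<le> q" "q * real n \<le> real r - real m" "0 < n"
  shows "(\<Sum>w\<in>doubled_walks n m. q ^ card (w ` {..m})) \<le> real (card (doubled_walks r m))"
proof -
  define c where "c w = card (w ` {..m})" for w :: "nat \<Rightarrow> nat"
  define J where "J w = {f \<in> w ` {..m} \<rightarrow>\<^sub>E {..<r}. inj_on f (w ` {..m})}" for w :: "nat \<Rightarrow> nat"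
  \<comment> \<open>The second component is the inverse relabelling, which recovers \<open>w\<close>
    from the relabelled walk. Restricting it to the image makes it an element of a finite function
    space.\<close>
  define \<Phi> :: "(nat \<Rightarrow> nat) \<times> (nat \<Rightarrow> nat) \<Rightarrow> (nat \<Rightarrow> nat) \<times> (nat \<Rightarrow> nat)"
    where "\<Phi> = (\<lambda>(w, f). (restrict (f \<circ> w) {..m}, restrict (inv_into (w ` {..m}) f) (f ` w ` {..m})))"
  define P where "P = Sigma (doubled_walks n m) J"
  define R where "R = Sigma (doubled_walks r m) (\<lambda>v. v ` {..m} \<rightarrow>\<^sub>E {..<n})"
  have fin: "finite (S \<rightarrow>\<^sub>E {..<k})" if "finite S" for S and k :: nat
    using that by (intro finite_PiE) auto
  have finJ: "finite (J w)" for w unfolding J_def using fin[of "w ` {..m}"] by simp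
  have finR: "finite R" unfolding R_def by (intro finite_SigmaI fin) auto
  have \<Phi>_image: "fst (\<Phi> (w, f)) ` {..m} = f ` w ` {..m}" for w f
    by (auto simp: \<Phi>_def)
  have card_eq: "c (fst (\<Phi> (w, f))) = c w" if "(w, f) \<in> P" for w f
    using that unfolding c_def \<Phi>_image by (auto simp: P_def J_def card_image)
  have "\<Phi> (w, f) \<in> R" if wf: "(w, f) \<in> P" for w f
  proof -
    have w: "w \<in> {..m} \<rightarrow>\<^sub>E {..<n}" "w 0 = w m" "edge_doubled m w"
      and f: "f \<in> w ` {..m} \<rightarrow>\<^sub>E {..<r}" "inj_on f (w ` {..m})"
      using wf by (auto simp: P_def J_def doubled_walks_def closed_walks_def)
    let ?v = "restrict (f \<circ> w) {..m}"
    have "edge_doubled m ?v" using edge_doubled_inj[OF f(2), of ?v] w(3) by simp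
    moreover have "?v \<in> {..m} \<rightarrow>\<^sub>E {..<r}" using f(1) by auto
    ultimately have "?v \<in> doubled_walks r m" using w(2) by (simp add: doubled_walks_def closed_walks_def)
    moreover have "?v ` {..m} = f ` w ` {..m}" by auto
    moreover have "restrict (inv_into (w ` {..m}) f) (f ` w ` {..m}) \<in> f ` w ` {..m} \<rightarrow>\<^sub>E {..<n}"
      using w(1) f(2) by auto
    ultimately show ?thesis by (simp add: R_def \<Phi>_def)
  qed
  then have maps: "\<Phi> ` P \<subseteq> R" by auto
  have inj: "inj_on \<Phi> P"
  proof (rule inj_onI)
    fix x x' assume x: "x \<in> P" "x' \<in> P" "\<Phi> x = \<Phi> x'"
    obtain w f w' f' where xx: "x = (w, f)" "x' = (w', f')" by (metis surj_pair)
    then have P: "(w, f) \<in> P" "(w', f') \<in> P" and eq: "\<Phi> (w, f) = \<Phi> (w', f')" using x by auto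
    have w: "w \<in> {..m} \<rightarrow>\<^sub>E {..<n}" "f \<in> w ` {..m} \<rightarrow>\<^sub>E {..<r}" "inj_on f (w ` {..m})"
      and w': "w' \<in> {..m} \<rightarrow>\<^sub>E {..<n}" "f' \<in> w' ` {..m} \<rightarrow>\<^sub>E {..<r}" "inj_on f' (w' ` {..m})"
      using P by (auto simp: P_def J_def doubled_walks_def closed_walks_def)
    have v: "f (w t) = f' (w' t)" if "t \<le> m" for t
      using eq that by (auto simp: \<Phi>_def dest!: fun_cong[of _ _ t])
    have ww: "w t = w' t" if "t \<le> m" for t
    proof -
      have "snd (\<Phi> (w, f)) (f (w t)) = w t" using that w(3) by (simp add: \<Phi>_def)
      moreover have "snd (\<Phi> (w', f')) (f' (w' t)) = w' t" using that w'(3) by (simp add: \<Phi>_def)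
      ultimately show ?thesis using eq v[OF that] by simp
    qed
    have "w = w'" using w(1) w'(1) ww by (intro PiE_ext) auto
    moreover have "f = f'"
    proof (rule PiE_ext[OF w(2)])
      show "f' \<in> w ` {..m} \<rightarrow>\<^sub>E {..<r}" using w'(2) \<open>w = w'\<close> by simp
      show "f x = f' x" if "x \<in> w ` {..m}" for x using that v ww by auto
    qed
    ultimately show "x = x'" by (simp add: xx)
  qed
  \<comment> \<open>A walk with \<open>c w\<close> vertices has at least
    \<open>(q * n) ^ c w\<close> injective relabellings.\<close>
  have "(\<Sum>w\<in>doubled_walks n m. q ^ c w) \<le> (\<Sum>w\<in>doubled_walks n m. real (card (J w)) / real n ^ c w)"
  proof (rule sum_mono)
    fix w
    have "c w \<le> m + 1" using card_image_le[of "{..m}" w] by (simp add: c_def)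
    then have "(q * real n) ^ c w \<le> real (card (J w))"
      unfolding c_def J_def using assms by (intro power_le_card_injections) auto
    then show "q ^ c w \<le> real (card (J w)) / real n ^ c w"
      using assms(3) by (simp add: field_simps power_mult_distrib)
  qed
  also have "\<dots> = (\<Sum>(w, f)\<in>P. 1 / real n ^ c w)"
    unfolding P_def using finJ by (subst sum.Sigma[symmetric]) auto
  also have "\<dots> = (\<Sum>x\<in>P. 1 / real n ^ c (fst (\<Phi> x)))"
    by (intro sum.cong refl) (auto simp: card_eq)
  also have "\<dots> = (\<Sum>x\<in>\<Phi> ` P. 1 / real n ^ c (fst x))"
    by (subst sum.reindex[OF inj]) simp
  also have "\<dots> \<le> (\<Sum>x\<in>R. 1 / real n ^ c (fst x))"
    by (rule sum_mono2[OF finR maps]) simp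
  also have "\<dots> = (\<Sum>v\<in>doubled_walks r m. \<Sum>g\<in>v ` {..m} \<rightarrow>\<^sub>E {..<n}. 1 / real n ^ c v)"
    unfolding R_def by (subst sum.Sigma) (auto simp: fin case_prod_unfold)
  \<comment> \<open>There are \<open>n ^ c v\<close> maps \<open>g\<close> from the vertices of
    \<open>v\<close>, which cancels the weight exactly.\<close>
  also have "\<dots> = (\<Sum>v\<in>doubled_walks r m. 1)"
    using assms(3) by (intro sum.cong refl) (simp add: card_PiE c_def)
  finally show ?thesis by (simp add: c_def)
qed

lemma prod_walk_eq_prod_pairs:
  fixes x :: "nat \<times> nat \<Rightarrow> 'a :: comm_monoid_mult"
  assumes "w \<in> closed_walks n m"
  shows "(\<Prod>t<m. x (walk_edge w t)) = (\<Prod>e\<in>upper_pairs n. x e ^ card {t. t < m \<and> walk_edge w t = e})"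
proof -
  have "walk_edge w ` {..<m} \<subseteq> upper_pairs n"
  proof (rule image_subsetI)
    fix t assume "t \<in> {..<m}"
    then have "w t < n" "w (Suc t) < n" using assms by (auto simp: closed_walks_def PiE_def Pi_def)
    then have "(min (w t) (w (Suc t)), max (w t) (w (Suc t))) \<in> upper_pairs n"
      by (auto simp: upper_pairs_def)
    then show "walk_edge w t \<in> upper_pairs n" by (simp only: walk_edge_def)
  qed
  then have "(\<Prod>t<m. x (walk_edge w t)) = (\<Prod>e\<in>upper_pairs n. \<Prod>t\<in>{t\<in>{..<m}. walk_edge w t = e}. x (walk_edge w t))"
    by (subst prod.group) auto
  also have "\<dots> = (\<Prod>e\<in>upper_pairs n. x e ^ card {t. t < m \<and> walk_edge w t = e})"
    by (intro prod.cong refl) simp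
  finally show ?thesis .
qed

lemma card_edge_visits_ne_1:
  assumes "edge_doubled m w"
  shows "card {t. t < m \<and> walk_edge w t = e} \<noteq> 1"
proof
  assume "card {t. t < m \<and> walk_edge w t = e} = 1"
  then obtain t where t: "{t. t < m \<and> walk_edge w t = e} = {t}" by (auto simp: card_1_singleton_iff)
  then have "t < m" "walk_edge w t = e" by auto
  then obtain s where "s < m" "s \<noteq> t" "walk_edge w s = e" using assms by (auto simp: edge_doubled_def)
  then show False using t by auto
qed

lemma card_edge_visits_eq_1:
  assumes "\<not> edge_doubled m w" "w \<in> closed_walks n m"
  shows "\<exists>e\<in>upper_pairs n. card {t. t < m \<and> walk_edge w t = e} = 1"
proof -
  obtain t where t: "t < m" "\<And>s. s < m \<Longrightarrow> s \<noteq> t \<Longrightarrow> walk_edge w s \<noteq> walk_edge w t"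
    using assms(1) by (auto simp: edge_doubled_def)
  then have "{s. s < m \<and> walk_edge w s = walk_edge w t} = {t}" by auto
  then have "card {s. s < m \<and> walk_edge w s = walk_edge w t} = 1" by simp
  moreover have "w t < n" "w (Suc t) < n"
    using t(1) assms(2) by (auto simp: closed_walks_def PiE_def Pi_def)
  then have "walk_edge w t \<in> upper_pairs n" by (auto simp: walk_edge_def upper_pairs_def)
  ultimately show ?thesis by blast
qed

section \<open>A dense matrix dominating the walk count\<close>

lemma sum_sym_extend_bilinear:
  "(\<Sum>i<n. \<Sum>j<n. sym_extend x i j * y i * z j)
     = (\<Sum>e\<in>upper_pairs n. x e * (if fst e = snd e then y (fst e) * z (fst e)
         else y (fst e) * z (snd e) + y (snd e) * z (fst e)))"
proof -
  define g where "g i j = sym_extend x i j * y i * z j" for i j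
  define L where "L = {(i, j). i < j \<and> j < n}"
  define D where "D = (\<lambda>i. (i, i)) ` {..<n}"
  have fin: "finite L" by (rule finite_subset[of _ "{..<n} \<times> {..<n}"]) (auto simp: L_def)
  have split: "{..<n} \<times> {..<n} = L \<union> prod.swap ` L \<union> D"
    by (auto simp: L_def D_def image_iff)
  have up: "upper_pairs n = L \<union> D" by (auto simp: upper_pairs_def L_def D_def)
  have disj: "L \<inter> prod.swap ` L = {}" "(L \<union> prod.swap ` L) \<inter> D = {}" "L \<inter> D = {}"
    by (auto simp: L_def D_def)
  have "(\<Sum>i<n. \<Sum>j<n. g i j) = (\<Sum>e\<in>{..<n} \<times> {..<n}. g (fst e) (snd e))"
    by (simp add: sum.cartesian_product case_prod_unfold)
  also have "\<dots> = (\<Sum>e\<in>L. g (fst e) (snd e)) + (\<Sum>e\<in>prod.swap ` L. g (fst e) (snd e)) + (\<Sum>e\<in>D. g (fst e) (snd e))"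
    unfolding split using fin disj by (simp add: sum.union_disjoint D_def)
  also have "(\<Sum>e\<in>prod.swap ` L. g (fst e) (snd e)) = (\<Sum>e\<in>L. g (snd e) (fst e))"
    by (subst sum.reindex) auto
  also have "(\<Sum>e\<in>L. g (fst e) (snd e)) + (\<Sum>e\<in>L. g (snd e) (fst e))
    = (\<Sum>e\<in>L. x e * (if fst e = snd e then y (fst e) * z (fst e)
         else y (fst e) * z (snd e) + y (snd e) * z (fst e)))"
    unfolding sum.distrib[symmetric]
    by (intro sum.cong refl) (auto simp: L_def g_def sym_extend_def min_def max_def algebra_simps)
  also have "(\<Sum>e\<in>D. g (fst e) (snd e)) = (\<Sum>e\<in>D. x e * (if fst e = snd e then y (fst e) * z (fst e)
         else y (fst e) * z (snd e) + y (snd e) * z (fst e)))"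
    by (intro sum.cong refl) (auto simp: D_def g_def sym_extend_def)
  finally show ?thesis
    unfolding up g_def using fin disj by (simp add: sum.union_disjoint D_def)
qed

text \<open>An off-diagonal entry carries two products, whence the factor 2 from
  \<open>(a + b)\<^sup>2 \<le> 2 * (a\<^sup>2 + b\<^sup>2)\<close>. What remains is the bilinear
  identity for the all-ones matrix, applied to the squared vectors.\<close>

lemma sum_bilinear_coeff_square_le:
  fixes y z :: "nat \<Rightarrow> real"
  shows "(\<Sum>e\<in>upper_pairs n. (if fst e = snd e then y (fst e) * z (fst e)
         else y (fst e) * z (snd e) + y (snd e) * z (fst e))\<^sup>2)
    \<le> 2 * (\<Sum>i<n. (y i)\<^sup>2) * (\<Sum>j<n. (z j)\<^sup>2)"
proof -
  let ?x = "\<lambda>_. 1 :: real"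
  have le: "(if fst e = snd e then y (fst e) * z (fst e) else y (fst e) * z (snd e) + y (snd e) * z (fst e))\<^sup>2
    \<le> 2 * (1 * (if fst e = snd e then (y (fst e))\<^sup>2 * (z (fst e))\<^sup>2
         else (y (fst e))\<^sup>2 * (z (snd e))\<^sup>2 + (y (snd e))\<^sup>2 * (z (fst e))\<^sup>2))" for e
  proof -
    have "(a + b)\<^sup>2 \<le> 2 * (a\<^sup>2 + b\<^sup>2)" for a b :: real
      using zero_le_power2[of "a - b"] by (simp add: power2_eq_square algebra_simps)
    from this[of "y (fst e) * z (snd e)" "y (snd e) * z (fst e)"] show ?thesis
      by (simp add: power_mult_distrib)
  qed
  have "(\<Sum>e\<in>upper_pairs n. (if fst e = snd e then y (fst e) * z (fst e)
         else y (fst e) * z (snd e) + y (snd e) * z (fst e))\<^sup>2)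
    \<le> (\<Sum>e\<in>upper_pairs n. 2 * (1 * (if fst e = snd e then (y (fst e))\<^sup>2 * (z (fst e))\<^sup>2
         else (y (fst e))\<^sup>2 * (z (snd e))\<^sup>2 + (y (snd e))\<^sup>2 * (z (fst e))\<^sup>2)))"
    by (intro sum_mono le)
  also have "\<dots> = 2 * (\<Sum>i<n. \<Sum>j<n. sym_extend ?x i j * (y i)\<^sup>2 * (z j)\<^sup>2)"
    unfolding sum_sym_extend_bilinear by (simp only: sum_distrib_left)
  also have "\<dots> = 2 * (\<Sum>i<n. (y i)\<^sup>2) * (\<Sum>j<n. (z j)\<^sup>2)"
    by (simp add: sym_extend_def sum_product mult.assoc)
  finally show ?thesis .
qed

text \<open>The linear term has mean zero for a centred variable, so this turns boundedness into a
  sub-Gaussian moment generating function without second-order expansions at the point of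
  use.\<close>

lemma exp_le_add_exp_square: "exp x \<le> x + exp (x\<^sup>2)" for x :: real
proof -
  consider "1 \<le> x" | "0 \<le> x" "x \<le> 1" | "-1 \<le> x" "x \<le> 0" | "x \<le> -1" by linarith
  then show ?thesis
  proof cases
    case 1
    then have "x * 1 \<le> x * x" by (intro mult_left_mono) auto
    then have "exp x \<le> exp (x\<^sup>2)" by (simp add: power2_eq_square)
    then show ?thesis using 1 by linarith
  next
    case 2
    then have "exp x \<le> 1 + x + x\<^sup>2" by (rule exp_bound)
    then show ?thesis using exp_ge_add_one_self[of "x\<^sup>2"] by linarith
  next
    case 3
    define y where "y = - x"
    have y: "0 \<le> y" "y \<le> 1" using 3 by (auto simp: y_def)
    have "1 \<le> (1 - y + y\<^sup>2) * (1 + y + y\<^sup>2 / 2)"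
    proof -
      have "(1 - y + y\<^sup>2) * (1 + y + y\<^sup>2 / 2) = 1 + y\<^sup>2 / 2 + y ^ 3 / 2 + y ^ 4 / 2"
        by (simp add: field_simps power2_eq_square power3_eq_cube power4_eq_xxxx)
      then show ?thesis using y by simp
    qed
    also have "\<dots> \<le> (1 - y + y\<^sup>2) * exp y"
    proof (rule mult_left_mono)
      show "1 + y + y\<^sup>2 / 2 \<le> exp y" using exp_lower_Taylor_quadratic[OF y(1)] .
      show "0 \<le> 1 - y + y\<^sup>2" using y by (simp add: add_nonneg_nonneg)
    qed
    finally have "1 / exp y \<le> 1 - y + y\<^sup>2" by (simp add: field_simps)
    then have "exp x \<le> 1 + x + x\<^sup>2" by (simp add: y_def exp_minus inverse_eq_divide)
    then show ?thesis using exp_ge_add_one_self[of "x\<^sup>2"] by linarith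
  next
    case 4
    have "exp x \<le> 1" using 4 by simp
    also have "1 \<le> x + (1 + x\<^sup>2)"
    proof -
      have "0 \<le> (- x) * (- x - 1)" using 4 by (intro mult_nonneg_nonneg) auto
      then show ?thesis by (simp add: power2_eq_square algebra_simps)
    qed
    also have "\<dots> \<le> x + exp (x\<^sup>2)" using exp_ge_add_one_self[of "x\<^sup>2"] by linarith
    finally show ?thesis .
  qed
qed

text \<open>The uniform distribution on the three points \<open>0, 1, 2\<close> turns \<open>spike\<close> into a centred variable all of
  whose higher moments are at least \<open>1\<close>. Hence the expected trace of a symmetric matrix with such
  entries dominates the number of walks that use every edge at least twice.\<close>

definition spike :: "nat \<Rightarrow> real" where
  "spike b = (if b = 0 then 2 else -1)"

text \<open>A finite sample space for independent spikes. Averages are plain sums over it, which is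
  the source of the factors \<open>3 ^ card (upper_pairs r)\<close> below.\<close>

definition spike_configs :: "nat \<Rightarrow> (nat \<times> nat \<Rightarrow> nat) set" where
  "spike_configs n = upper_pairs n \<rightarrow>\<^sub>E {..<3}"

lemma sum_lessThan_3: "(\<Sum>b<3. f b) = f 0 + f 1 + f (2 :: nat)"
  by (simp add: numeral_3_eq_3 numeral_2_eq_2)

lemma finite_spike_configs [simp]: "finite (spike_configs n)"
  unfolding spike_configs_def by (intro finite_PiE) auto

lemma sum_spike_configs_prod:
  "(\<Sum>b\<in>spike_configs n. \<Prod>e\<in>upper_pairs n. f e (spike (b e)))
     = (\<Prod>e\<in>upper_pairs n. f e 2 + 2 * f e (-1) :: real)"
proof -
  have "(\<Sum>b\<in>spike_configs n. \<Prod>e\<in>upper_pairs n. f e (spike (b e)))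
      = (\<Prod>e\<in>upper_pairs n. \<Sum>b<3. f e (spike b))"
    unfolding spike_configs_def by (rule prod_sum_PiE[symmetric]) auto
  then show ?thesis by (simp add: sum_lessThan_3 spike_def add.commute)
qed

text \<open>These are three times the moments. A symmetric sign would not serve: a doubled walk may
  cross an edge three times, and the third moment of a sign vanishes.\<close>

lemma spike_moment:
  fixes k :: nat
  shows "0 \<le> (2 ^ k + 2 * (-1) ^ k :: real)" "k \<noteq> 1 \<Longrightarrow> 3 \<le> (2 ^ k + 2 * (-1) ^ k :: real)"
proof -
  have big: "3 \<le> (2 ^ k + 2 * (-1) ^ k :: real)" if "k \<noteq> 1" for k :: nat
  proof (cases "k \<le> 2")
    case True
    then have "k = 0 \<or> k = 2" using that by auto
    then show ?thesis by auto
  next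
    case False
    then have "(2 :: real) ^ 3 \<le> 2 ^ k" by (intro power_increasing) auto
    moreover have "-1 \<le> (-1 :: real) ^ k" by (cases "even k") auto
    ultimately show ?thesis by simp
  qed
  show "k \<noteq> 1 \<Longrightarrow> 3 \<le> (2 ^ k + 2 * (-1) ^ k :: real)" by (rule big)
  show "0 \<le> (2 ^ k + 2 * (-1) ^ k :: real)" using big[of k] by (cases "k = 1") auto
qed

text \<open>The summed trace is a sum over closed walks of products of unnormalised spike moments,
  none of them negative. A doubled walk has all factors at least 3, and the other walks are dropped
  from below.\<close>

lemma card_doubled_walks_le_spike_trace:
  "3 ^ card (upper_pairs r) * real (card (doubled_walks r m))
     \<le> (\<Sum>b\<in>spike_configs r. trace_power r m (sym_extend (spike \<circ> b)))"
proof -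
  define mult where "mult w e = card {t. t < m \<and> walk_edge w t = e}" for w e
  define S where "S w = (\<Sum>b\<in>spike_configs r. \<Prod>t<m. sym_extend (spike \<circ> b) (w t) (w (Suc t)))" for w
  have S: "S w = (\<Prod>e\<in>upper_pairs r. 2 ^ mult w e + 2 * (-1) ^ mult w e)" if "w \<in> closed_walks r m" for w
  proof -
    have "S w = (\<Sum>b\<in>spike_configs r. \<Prod>t<m. (spike \<circ> b) (walk_edge w t))"
      by (simp add: S_def sym_extend_def walk_edge_def)
    also have "\<dots> = (\<Sum>b\<in>spike_configs r. \<Prod>e\<in>upper_pairs r. spike (b e) ^ mult w e)"
      unfolding prod_walk_eq_prod_pairs[OF that] mult_def by simp
    also have "\<dots> = (\<Prod>e\<in>upper_pairs r. 2 ^ mult w e + 2 * (-1) ^ mult w e)"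
      by (rule sum_spike_configs_prod)
    finally show ?thesis .
  qed
  have "3 ^ card (upper_pairs r) * real (card (doubled_walks r m))
      = (\<Sum>w\<in>doubled_walks r m. \<Prod>e\<in>upper_pairs r. 3)" by simp
  also have "\<dots> \<le> (\<Sum>w\<in>doubled_walks r m. S w)"
  proof (rule sum_mono)
    fix w assume "w \<in> doubled_walks r m"
    then have w: "w \<in> closed_walks r m" "edge_doubled m w" by (auto simp: doubled_walks_def)
    show "(\<Prod>e\<in>upper_pairs r. 3) \<le> S w"
      unfolding S[OF w(1)] mult_def
      by (intro prod_mono conjI spike_moment(2) card_edge_visits_ne_1 w) auto
  qed
  also have "\<dots> \<le> (\<Sum>w\<in>closed_walks r m. S w)"
  proof (rule sum_mono2)
    show "0 \<le> S w" if "w \<in> closed_walks r m - doubled_walks r m" for w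
    proof -
      have "w \<in> closed_walks r m" using that by simp
      then show ?thesis by (simp only: S) (intro prod_nonneg spike_moment(1))
    qed
  qed (auto simp: doubled_walks_def)
  also have "\<dots> = (\<Sum>b\<in>spike_configs r. trace_power r m (sym_extend (spike \<circ> b)))"
    unfolding S_def trace_power_walks by (rule sum.swap)
  finally show ?thesis .
qed

text \<open>The linear terms cancel between the value 2 and the two values -1; the 4 is the square
  of the largest value.\<close>

lemma sum_spike_configs_exp:
  "(\<Sum>b\<in>spike_configs r. exp (\<Sum>e\<in>upper_pairs r. spike (b e) * c e))
     \<le> 3 ^ card (upper_pairs r) * exp (4 * (\<Sum>e\<in>upper_pairs r. (c e)\<^sup>2))"
proof -
  have "(\<Sum>b\<in>spike_configs r. exp (\<Sum>e\<in>upper_pairs r. spike (b e) * c e))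
      = (\<Prod>e\<in>upper_pairs r. exp (2 * c e) + 2 * exp (- 1 * c e))"
    unfolding exp_sum[OF finite_upper_pairs] by (rule sum_spike_configs_prod)
  also have "\<dots> \<le> (\<Prod>e\<in>upper_pairs r. 3 * exp (4 * (c e)\<^sup>2))"
  proof (intro prod_mono conjI)
    fix e
    have "exp (2 * c e) \<le> 2 * c e + exp (4 * (c e)\<^sup>2)"
      using exp_le_add_exp_square[of "2 * c e"] by (simp add: power_mult_distrib)
    moreover have "exp (- 1 * c e) \<le> - c e + exp (4 * (c e)\<^sup>2)"
    proof -
      have "exp (- 1 * c e) \<le> - c e + exp ((c e)\<^sup>2)"
        using exp_le_add_exp_square[of "- c e"] by simp
      moreover have "exp ((c e)\<^sup>2) \<le> exp (4 * (c e)\<^sup>2)" by simp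
      ultimately show ?thesis by linarith
    qed
    ultimately show "exp (2 * c e) + 2 * exp (- 1 * c e) \<le> 3 * exp (4 * (c e)\<^sup>2)" by linarith
  qed (simp add: add_nonneg_nonneg)
  also have "\<dots> = 3 ^ card (upper_pairs r) * exp (4 * (\<Sum>e\<in>upper_pairs r. (c e)\<^sup>2))"
    by (simp add: prod.distrib exp_sum sum_distrib_left)
  finally show ?thesis .
qed

section \<open>The bound on the number of doubled walks\<close>

lemma even_power_le_exp: "x ^ (2 * k) \<le> fact (2 * k) * (exp x + exp (- x))" for x :: real
proof -
  have *: "y ^ n \<le> fact n * exp y" if "0 \<le> y" for y :: real and n
  proof -
    have "(\<Sum>i\<in>{n}. y ^ i /\<^sub>R fact i) \<le> exp y"
      unfolding exp_def using that by (intro sum_le_suminf summable_exp_generic) auto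
    then show ?thesis by (simp add: field_simps)
  qed
  have "x ^ (2 * k) = \<bar>x\<bar> ^ (2 * k)" by (simp add: power_even_abs)
  also have "\<dots> \<le> fact (2 * k) * exp \<bar>x\<bar>" by (rule *) simp
  also have "\<dots> \<le> fact (2 * k) * (exp x + exp (- x))"
    by (intro mult_left_mono) (auto simp: abs_if)
  finally show ?thesis .
qed

text \<open>The norm is at most the largest form over the grid, and the even power of the maximum is
  one term of the sum. Unlike a maximum, the sum can be averaged over spike configurations term by
  term.\<close>

lemma trace_power_le_grid_sum:
  assumes "symmetric_below n W" "0 < n"
  shows "trace_power n (2 * k) W \<le> real n * (\<Sum>y\<in>grid n. \<Sum>z\<in>grid n.
    ((\<Sum>i<n. \<Sum>j<n. W i j * real_of_int (y i) * real_of_int (z j)) / real n) ^ (2 * k))"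
proof -
  define Q where "Q y z = (\<Sum>i<n. \<Sum>j<n. W i j * real_of_int (y i) * real_of_int (z j))" for y z
  define V where "V = (\<lambda>p. \<bar>Q (fst p) (snd p)\<bar> / n) ` (grid n \<times> grid n)"
  have "(\<lambda>i\<in>{..<n}. 0) \<in> grid n" by (auto simp: grid_def)
  then have V: "finite V" "V \<noteq> {}" by (auto simp: V_def finite_grid)
  define s where "s = Max V"
  have "s \<in> V" unfolding s_def using V by (rule Max_in)
  then obtain y z where yz: "y \<in> grid n" "z \<in> grid n" "s = \<bar>Q y z\<bar> / n" by (auto simp: V_def)
  have bound: "Q u v \<le> s * n" if "u \<in> grid n" "v \<in> grid n" for u v
  proof -
    have "\<bar>Q u v\<bar> / n \<le> s" unfolding s_def
    proof (rule Max_ge[OF V(1)])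
      show "\<bar>Q u v\<bar> / n \<in> V" using that by (auto simp: V_def intro!: image_eqI[of _ _ "(u, v)"])
    qed
    then have "\<bar>Q u v\<bar> \<le> s * n" using assms(2) by (simp add: divide_le_eq)
    then show ?thesis by linarith
  qed
  have "trace_power n (2 * k) W \<le> real n * s ^ (2 * k)"
  proof (rule trace_power_le_of_bilinear_bound[OF assms(1)])
    show "dot n u (apply_mat n W v) \<le> s" if "dot n u u \<le> 1" "dot n v v \<le> 1" for u v
      by (rule bilinear_bound_of_grid) (use bound that assms(2) in \<open>auto simp: Q_def\<close>)
  qed (simp add: yz)
  also have "s ^ (2 * k) = (Q y z / n) ^ (2 * k)"
    by (simp add: yz power_divide power_even_abs)
  also have "\<dots> \<le> (\<Sum>p\<in>grid n \<times> grid n. (Q (fst p) (snd p) / n) ^ (2 * k))"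
    using yz by (intro member_le_sum[of "(y, z)" _ "\<lambda>p. (Q (fst p) (snd p) / n) ^ (2 * k)", simplified])
      (auto simp: finite_grid power_mult)
  also have "\<dots> = (\<Sum>y\<in>grid n. \<Sum>z\<in>grid n. (Q y z / n) ^ (2 * k))"
    by (simp add: sum.cartesian_product case_prod_unfold)
  finally show ?thesis using assms(2) by (simp add: Q_def mult_left_mono)
qed

lemma grid_square_sum_le:
  assumes "y \<in> grid n"
  shows "(\<Sum>i<n. (real_of_int (y i))\<^sup>2) \<le> 4 * real n"
proof -
  have "(\<Sum>i<n. (y i)\<^sup>2) \<le> 4 * int n" using assms by (simp add: grid_def)
  then have "real_of_int (\<Sum>i<n. (y i)\<^sup>2) \<le> real_of_int (4 * int n)" by (simp only: of_int_le_iff)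
  then show ?thesis by simp
qed

text \<open>The 32 is the factor 2 from symmetrisation times 4 for the squared length of each grid
  vector.\<close>

lemma grid_coeff_square_sum_le:
  assumes "y \<in> grid n" "z \<in> grid n"
  shows "(\<Sum>e\<in>upper_pairs n. (if fst e = snd e then real_of_int (y (fst e)) * real_of_int (z (fst e))
    else real_of_int (y (fst e)) * real_of_int (z (snd e)) + real_of_int (y (snd e)) * real_of_int (z (fst e)))\<^sup>2)
    \<le> 32 * (real n)\<^sup>2"
proof -
  have "2 * (\<Sum>i<n. (real_of_int (y i))\<^sup>2) * (\<Sum>i<n. (real_of_int (z i))\<^sup>2) \<le> 2 * (4 * real n) * (4 * real n)"
    by (intro mult_mono mult_left_mono grid_square_sum_le assms) (auto intro: sum_nonneg)
  then show ?thesis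
    using sum_bilinear_coeff_square_le[where n = n and y = "\<lambda>i. real_of_int (y i)" and z = "\<lambda>i. real_of_int (z i)"]
    by (simp add: power2_eq_square[of "real n"])
qed

lemma sum_spike_bilinear_power_le:
  assumes "y \<in> grid r" "z \<in> grid r" "0 < r"
  shows "(\<Sum>b\<in>spike_configs r.
      (\<Sum>i<r. \<Sum>j<r. sym_extend (spike \<circ> b) i j * real_of_int (y i) * real_of_int (z j)) ^ (2 * k))
    \<le> real r ^ k * fact (2 * k) * (2 * (3 ^ card (upper_pairs r) * exp (128 * real r)))"
proof -
  define c where "c e = (if fst e = snd e then real_of_int (y (fst e)) * real_of_int (z (fst e))
    else real_of_int (y (fst e)) * real_of_int (z (snd e)) + real_of_int (y (snd e)) * real_of_int (z (fst e)))" for e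
  define Q where "Q b = (\<Sum>i<r. \<Sum>j<r. sym_extend (spike \<circ> b) i j * real_of_int (y i) * real_of_int (z j))" for b
  \<comment> \<open>At this scale the exponent becomes 4 * 32 r^2 / r = 128 r, linear in
    \<open>r\<close> like the logarithm of the bound on the grid size.\<close>
  define \<theta> where "\<theta> = 1 / sqrt (real r)"
  have \<theta>: "\<theta> * \<theta> = 1 / r" using assms(3) by (simp add: \<theta>_def)
  have Q: "Q b = (\<Sum>e\<in>upper_pairs r. spike (b e) * c e)" for b
    unfolding Q_def sum_sym_extend_bilinear c_def by simp
  have exps: "(\<Sum>b\<in>spike_configs r. exp (s * (\<theta> * Q b))) \<le> 3 ^ card (upper_pairs r) * exp (128 * real r)"
    if "s\<^sup>2 = 1" for s
  proof -
    have "(\<Sum>b\<in>spike_configs r. exp (s * (\<theta> * Q b)))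
        = (\<Sum>b\<in>spike_configs r. exp (\<Sum>e\<in>upper_pairs r. spike (b e) * (s * \<theta> * c e)))"
      by (simp add: Q sum_distrib_left algebra_simps)
    also have "\<dots> \<le> 3 ^ card (upper_pairs r) * exp (4 * (\<Sum>e\<in>upper_pairs r. (s * \<theta> * c e)\<^sup>2))"
      by (rule sum_spike_configs_exp)
    also have "(\<Sum>e\<in>upper_pairs r. (s * \<theta> * c e)\<^sup>2) = (\<Sum>e\<in>upper_pairs r. (c e)\<^sup>2) / r"
    proof -
      have "(s * \<theta> * c e)\<^sup>2 = (c e)\<^sup>2 / r" for e
      proof -
        have "(s * \<theta> * c e)\<^sup>2 = s\<^sup>2 * (\<theta> * \<theta>) * (c e)\<^sup>2" by (simp add: power2_eq_square)
        then show ?thesis by (simp add: that \<theta>)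
      qed
      then show ?thesis by (simp add: sum_divide_distrib)
    qed
    also have "3 ^ card (upper_pairs r) * exp (4 * ((\<Sum>e\<in>upper_pairs r. (c e)\<^sup>2) / r))
        \<le> 3 ^ card (upper_pairs r) * exp (128 * real r)"
    proof -
      have "(\<Sum>e\<in>upper_pairs r. (c e)\<^sup>2) / r \<le> 32 * (real r)\<^sup>2 / r"
        using grid_coeff_square_sum_le[OF assms(1,2)] by (intro divide_right_mono) (auto simp: c_def)
      also have "\<dots> = 32 * real r" using assms(3) by (simp add: power2_eq_square)
      finally show ?thesis by simp
    qed
    finally show ?thesis .
  qed
  have "(\<Sum>b\<in>spike_configs r. Q b ^ (2 * k)) = (\<Sum>b\<in>spike_configs r. real r ^ k * (\<theta> * Q b) ^ (2 * k))"
  proof (intro sum.cong refl)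
    fix b
    have "(\<theta> * Q b) ^ (2 * k) = (\<theta> * \<theta>) ^ k * Q b ^ (2 * k)"
      by (simp add: power_mult_distrib power_mult power2_eq_square)
    then show "Q b ^ (2 * k) = real r ^ k * (\<theta> * Q b) ^ (2 * k)"
      unfolding \<theta> using assms(3) by (simp add: power_divide)
  qed
  also have "\<dots> \<le> (\<Sum>b\<in>spike_configs r. real r ^ k * (fact (2 * k) * (exp (\<theta> * Q b) + exp (- (\<theta> * Q b)))))"
    by (intro sum_mono mult_left_mono even_power_le_exp) simp
  also have "\<dots> = real r ^ k * fact (2 * k) * ((\<Sum>b\<in>spike_configs r. exp (1 * (\<theta> * Q b)))
      + (\<Sum>b\<in>spike_configs r. exp (- 1 * (\<theta> * Q b))))"
    by (simp add: sum.distrib sum_distrib_left distrib_left mult.assoc)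
  also have "\<dots> \<le> real r ^ k * fact (2 * k) * (3 ^ card (upper_pairs r) * exp (128 * real r)
      + 3 ^ card (upper_pairs r) * exp (128 * real r))"
    by (intro mult_left_mono add_mono exps) auto
  finally show ?thesis by (simp add: Q_def)
qed

text \<open>Up to factors exponential in \<open>r\<close>, the averaged bound is (2k)! / r^k.
  Splitting (2k)! <= (2k)^k (2k)^k and using \<open>2 * k \<le> r\<close> in one factor cancels r^k
  and leaves (2k)^k.\<close>

lemma card_doubled_walks_le:
  assumes "0 < k" "2 * k \<le> r"
  shows "real (card (doubled_walks r (2 * k))) \<le> 2 * real r * (4096 * exp 128) ^ r * (2 * real k) ^ k"
proof -
  define E where "E = (3 :: real) ^ card (upper_pairs r)"
  define Q where "Q b y z = (\<Sum>i<r. \<Sum>j<r. sym_extend (spike \<circ> b) i j * real_of_int (y i) * real_of_int (z j))" for b y z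
  define B where "B = real r ^ k * fact (2 * k) * (2 * (E * exp (128 * real r)))"
  have r: "0 < r" using assms by simp
  have E: "E > 0" by (simp add: E_def)
  have B0: "0 \<le> B" using E by (simp add: B_def)
  have "E * real (card (doubled_walks r (2 * k)))
      \<le> (\<Sum>b\<in>spike_configs r. trace_power r (2 * k) (sym_extend (spike \<circ> b)))"
    unfolding E_def by (rule card_doubled_walks_le_spike_trace)
  also have "\<dots> \<le> (\<Sum>b\<in>spike_configs r. real r * (\<Sum>y\<in>grid r. \<Sum>z\<in>grid r. (Q b y z / real r) ^ (2 * k)))"
    unfolding Q_def by (intro sum_mono trace_power_le_grid_sum symmetric_below_sym_extend r)
  also have "\<dots> = real r / real r ^ (2 * k) * (\<Sum>b\<in>spike_configs r. \<Sum>y\<in>grid r. \<Sum>z\<in>grid r. Q b y z ^ (2 * k))"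
    by (simp add: power_divide sum_distrib_left)
  also have "(\<Sum>b\<in>spike_configs r. \<Sum>y\<in>grid r. \<Sum>z\<in>grid r. Q b y z ^ (2 * k))
      = (\<Sum>y\<in>grid r. \<Sum>z\<in>grid r. \<Sum>b\<in>spike_configs r. Q b y z ^ (2 * k))"
    by (subst sum.swap, rule sum.cong[OF refl], rule sum.swap)
  also have "real r / real r ^ (2 * k) * \<dots> \<le> real r / real r ^ (2 * k) * (\<Sum>y\<in>grid r. \<Sum>z\<in>grid r. B)"
    unfolding Q_def B_def E_def
    by (intro mult_left_mono sum_mono sum_spike_bilinear_power_le r) auto
  also have "\<dots> = real r / real r ^ (2 * k) * (real (card (grid r)) * real (card (grid r)) * B)" by simp
  also have "\<dots> \<le> real r / real r ^ (2 * k) * (64 ^ r * 64 ^ r * B)"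
    using B0 by (intro mult_left_mono mult_right_mono mult_mono card_grid_le) auto
  also have "\<dots> \<le> real r / real r ^ (2 * k) * (64 ^ r * 64 ^ r *
      (real r ^ k * ((2 * real k) ^ k * real r ^ k) * (2 * (E * exp (128 * real r)))))"
  proof (intro mult_left_mono)
    have "(fact (2 * k) :: real) \<le> real ((2 * k) ^ (2 * k))"
      by (rule fact_le_power)
    also have "\<dots> = (2 * real k) ^ k * (2 * real k) ^ k" by (metis mult_2 of_nat_mult of_nat_numeral of_nat_power power_add)
    also have "\<dots> \<le> (2 * real k) ^ k * real r ^ k"
    proof -
      have "2 * real k \<le> real r" using assms(2) by linarith
      then show ?thesis by (intro mult_left_mono power_mono) simp_all
    qed
    finally show "B \<le> real r ^ k * ((2 * real k) ^ k * real r ^ k) * (2 * (E * exp (128 * real r)))"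
      unfolding B_def using E by (intro mult_right_mono mult_left_mono) simp_all
  qed simp_all
  also have "real r / real r ^ (2 * k) * (64 ^ r * 64 ^ r * (real r ^ k * ((2 * real k) ^ k * real r ^ k) * (2 * (E * exp (128 * real r)))))
      = E * (2 * real r * (4096 * exp 128) ^ r * (2 * real k) ^ k)"
  proof -
    have "real r ^ (2 * k) = real r ^ k * real r ^ k" by (simp add: mult_2 power_add)
    moreover have "(64 :: real) ^ r * 64 ^ r = 4096 ^ r" by (simp add: power_mult_distrib[symmetric])
    moreover have "exp (128 * real r) = exp 128 ^ r" by (simp add: exp_of_nat_mult[symmetric] mult.commute)
    ultimately show ?thesis using r by (simp add: power_mult_distrib field_simps)
  qed
  finally show ?thesis using E by (simp only: mult_le_cancel_left_pos)
qed

text \<open>Collects the bound at \<open>r = 3 * k\<close> per power of \<open>k\<close>: 6 from 2 r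
  = 6 k <= 6^k, 2 from (2k)^k, and the cube from the base raised to \<open>3 * k\<close>.\<close>

definition walk_const :: real where
  "walk_const = 12 * (4096 * exp 128) ^ 3"

lemma walk_const_pos: "0 < walk_const"
  by (simp add: walk_const_def)

text \<open>With \<open>r = 3 * k\<close> labels and \<open>2 * k\<close> steps the slack
  \<open>r - m\<close> is \<open>k\<close>, as the walk comparison asks when p n <= k, while
  \<open>r\<close> stays proportional to \<open>k\<close>, so that factors exponential in
  \<open>r\<close> only change the base.\<close>

lemma card_doubled_walks_le_walk_const:
  assumes "0 < k"
  shows "real (card (doubled_walks (3 * k) (2 * k))) \<le> (walk_const * real k) ^ k"
proof -
  have "2 * real (3 * k) \<le> 6 ^ k"
  proof -
    have "6 * k \<le> 6 ^ k"
      using assms by (induction k rule: nat_induct_non_zero) auto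
    then have "real (6 * k) \<le> real (6 ^ k)" by (simp only: of_nat_le_iff)
    then show ?thesis by simp
  qed
  then have "2 * real (3 * k) * (4096 * exp 128) ^ (3 * k) * (2 * real k) ^ k
      \<le> 6 ^ k * (4096 * exp 128) ^ (3 * k) * (2 * real k) ^ k"
    by (intro mult_right_mono) auto
  also have "\<dots> = (6 * (4096 * exp 128) ^ 3 * (2 * real k)) ^ k"
    by (simp only: power_mult_distrib power_mult)
  also have "6 * (4096 * exp 128) ^ 3 * (2 * real k) = walk_const * real k"
    by (simp add: walk_const_def)
  finally show ?thesis using card_doubled_walks_le[of k "3 * k"] assms by linarith
qed

section \<open>Spectral bounds for random matrices\<close>

lemma (in prob_space)
  fixes X :: "nat \<times> nat \<Rightarrow> 'a \<Rightarrow> real"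
  assumes indep: "indep_vars (\<lambda>_. borel) X (upper_pairs n)"
    and int: "\<And>e k. e \<in> upper_pairs n \<Longrightarrow> integrable M (\<lambda>\<omega>. X e \<omega> ^ k)"
    and w: "w \<in> closed_walks n m"
  shows expectation_walk_product:
      "expectation (\<lambda>\<omega>. \<Prod>t<m. sym_extend (\<lambda>e. X e \<omega>) (w t) (w (Suc t)))
        = (\<Prod>e\<in>upper_pairs n. expectation (\<lambda>\<omega>. X e \<omega> ^ card {t. t < m \<and> walk_edge w t = e}))"
    and integrable_walk_product:
      "integrable M (\<lambda>\<omega>. \<Prod>t<m. sym_extend (\<lambda>e. X e \<omega>) (w t) (w (Suc t)))"
proof -
  let ?k = "\<lambda>e. card {t. t < m \<and> walk_edge w t = e}"
  have eq: "(\<Prod>t<m. sym_extend (\<lambda>e. X e \<omega>) (w t) (w (Suc t))) = (\<Prod>e\<in>upper_pairs n. X e \<omega> ^ ?k e)" for \<omega>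
    using prod_walk_eq_prod_pairs[OF w, of "\<lambda>e. X e \<omega>"] by (simp add: sym_extend_def walk_edge_def)
  have ind: "indep_vars (\<lambda>_. borel) (\<lambda>e \<omega>. X e \<omega> ^ ?k e) (upper_pairs n)"
    by (rule indep_vars_compose2[OF indep]) auto
  show "expectation (\<lambda>\<omega>. \<Prod>t<m. sym_extend (\<lambda>e. X e \<omega>) (w t) (w (Suc t)))
      = (\<Prod>e\<in>upper_pairs n. expectation (\<lambda>\<omega>. X e \<omega> ^ ?k e))"
    unfolding eq using int by (intro indep_vars_lebesgue_integral ind finite_upper_pairs) auto
  show "integrable M (\<lambda>\<omega>. \<Prod>t<m. sym_extend (\<lambda>e. X e \<omega>) (w t) (w (Suc t)))"
    unfolding eq using int by (intro indep_vars_integrable ind finite_upper_pairs) auto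
qed

text \<open>Centring kills every walk with an edge used once; a doubled walk contributes at most
  \<open>p\<close> per distinct edge. Passing from edges to vertices costs a single factor
  \<open>1 / p\<close>, after which the walk comparison applies with sparsity
  \<open>p\<close>.\<close>

lemma (in prob_space)
  fixes X :: "nat \<times> nat \<Rightarrow> 'a \<Rightarrow> real"
  assumes indep: "indep_vars (\<lambda>_. borel) X (upper_pairs n)"
    and int: "\<And>e k. e \<in> upper_pairs n \<Longrightarrow> integrable M (\<lambda>\<omega>. X e \<omega> ^ k)"
    and mean: "\<And>e. e \<in> upper_pairs n \<Longrightarrow> expectation (X e) = 0"
    and moment: "\<And>e k. e \<in> upper_pairs n \<Longrightarrow> 2 \<le> k \<Longrightarrow> \<bar>expectation (\<lambda>\<omega>. X e \<omega> ^ k)\<bar> \<le> p"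
    and p: "0 < p" "p \<le> 1" and k: "p * real n \<le> real k" "0 < k" and n: "0 < n"
  shows expectation_trace_power_le:
      "expectation (\<lambda>\<omega>. trace_power n (2 * k) (sym_extend (\<lambda>e. X e \<omega>))) \<le> (walk_const * real k) ^ k / p"
    and integrable_trace_power: "integrable M (\<lambda>\<omega>. trace_power n (2 * k) (sym_extend (\<lambda>e. X e \<omega>)))"
proof -
  define E where "E w = expectation (\<lambda>\<omega>. \<Prod>t<2 * k. sym_extend (\<lambda>e. X e \<omega>) (w t) (w (Suc t)))" for w
  define v where "v w e = card {t. t < 2 * k \<and> walk_edge w t = e}" for w e
  have E: "E w = (\<Prod>e\<in>upper_pairs n. expectation (\<lambda>\<omega>. X e \<omega> ^ v w e))" if "w \<in> closed_walks n (2 * k)" for w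
    unfolding E_def v_def by (rule expectation_walk_product[OF indep int that])
  have zero: "E w = 0" if w: "w \<in> closed_walks n (2 * k) - doubled_walks n (2 * k)" for w
  proof -
    have "w \<in> closed_walks n (2 * k)" "\<not> edge_doubled (2 * k) w" using w by (auto simp: doubled_walks_def)
    then obtain e where e: "e \<in> upper_pairs n" "v w e = 1"
      using card_edge_visits_eq_1 unfolding v_def by blast
    then have "expectation (\<lambda>\<omega>. X e \<omega> ^ v w e) = 0" using mean by simp
    then have "\<exists>e\<in>upper_pairs n. expectation (\<lambda>\<omega>. X e \<omega> ^ v w e) = 0" using e(1) by blast
    then show ?thesis using w by (simp add: E prod_zero[OF finite_upper_pairs])
  qed
  have le: "E w \<le> p ^ card (w ` {..2 * k}) / p" if w: "w \<in> doubled_walks n (2 * k)" for w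
  proof -
    let ?S = "walk_edge w ` {..<2 * k}"
    have w': "w \<in> closed_walks n (2 * k)" "edge_doubled (2 * k) w" using w by (auto simp: doubled_walks_def)
    have S: "?S \<subseteq> upper_pairs n"
    proof (rule image_subsetI)
      fix t assume "t \<in> {..<2 * k}"
      then have "w t < n" "w (Suc t) < n" using w' by (auto simp: closed_walks_def PiE_def Pi_def)
      then show "walk_edge w t \<in> upper_pairs n" by (auto simp: walk_edge_def upper_pairs_def)
    qed
    have "E w \<le> \<bar>E w\<bar>" by simp
    also have "\<dots> = (\<Prod>e\<in>upper_pairs n. \<bar>expectation (\<lambda>\<omega>. X e \<omega> ^ v w e)\<bar>)"
      using w' by (simp add: E abs_prod)
    also have "\<dots> \<le> (\<Prod>e\<in>upper_pairs n. if e \<in> ?S then p else 1)"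
    proof (intro prod_mono conjI)
      fix e assume e: "e \<in> upper_pairs n"
      show "\<bar>expectation (\<lambda>\<omega>. X e \<omega> ^ v w e)\<bar> \<le> (if e \<in> ?S then p else 1)"
      proof (cases "e \<in> ?S")
        case True
        then obtain t where "t < 2 * k" "walk_edge w t = e" by auto
        then have "{t. t < 2 * k \<and> walk_edge w t = e} \<noteq> {}" by blast
        then have "v w e \<noteq> 0" unfolding v_def by (simp add: card_eq_0_iff)
        moreover have "v w e \<noteq> 1" unfolding v_def by (rule card_edge_visits_ne_1) (rule w')
        ultimately have "2 \<le> v w e" by linarith
        then show ?thesis using moment[OF e] True by simp
      next
        case False
        then have "{t. t < 2 * k \<and> walk_edge w t = e} = {}" by auto
        then have "v w e = 0" by (simp only: v_def card.empty)
        then show ?thesis using False by (simp add: prob_space)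
      qed
    qed simp
    also have "\<dots> = p ^ card ?S"
      using S by (simp add: prod.If_cases Int_absorb1)
    \<comment> \<open>The tree bound: as \<open>p \<le> 1\<close>, fewer factors only increase the
      power.\<close>
    also have "\<dots> \<le> p ^ (card (w ` {..2 * k}) - 1)"
      using card_walk_vertices_le[of w "2 * k"] p by (intro power_decreasing) auto
    also have "\<dots> = p ^ card (w ` {..2 * k}) / p"
    proof -
      have "card (w ` {..2 * k}) \<noteq> 0" by (simp add: card_eq_0_iff)
      then show ?thesis using p by (cases "card (w ` {..2 * k})") auto
    qed
    finally show ?thesis .
  qed
  have "expectation (\<lambda>\<omega>. trace_power n (2 * k) (sym_extend (\<lambda>e. X e \<omega>)))
      = (\<Sum>w\<in>closed_walks n (2 * k). E w)"
    unfolding trace_power_walks E_def by (rule Bochner_Integration.integral_sum) (rule integrable_walk_product[OF indep int])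
  also have "\<dots> = (\<Sum>w\<in>doubled_walks n (2 * k). E w)"
    by (rule sum.mono_neutral_right) (use zero in \<open>auto simp: doubled_walks_def\<close>)
  also have "\<dots> \<le> (\<Sum>w\<in>doubled_walks n (2 * k). p ^ card (w ` {..2 * k}) / p)"
    by (intro sum_mono le)
  also have "\<dots> = (\<Sum>w\<in>doubled_walks n (2 * k). p ^ card (w ` {..2 * k})) / p"
    by (simp add: sum_divide_distrib)
  also have "\<dots> \<le> real (card (doubled_walks (3 * k) (2 * k))) / p"
    using p k n by (intro divide_right_mono doubled_walks_compare) auto
  also have "\<dots> \<le> (walk_const * real k) ^ k / p"
    using p by (intro divide_right_mono card_doubled_walks_le_walk_const k) auto
  finally show "expectation (\<lambda>\<omega>. trace_power n (2 * k) (sym_extend (\<lambda>e. X e \<omega>))) \<le> (walk_const * real k) ^ k / p" .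
  show "integrable M (\<lambda>\<omega>. trace_power n (2 * k) (sym_extend (\<lambda>e. X e \<omega>)))"
    unfolding trace_power_walks
    by (rule Bochner_Integration.integrable_sum) (rule integrable_walk_product[OF indep int])
qed

text \<open>Supplies a trace exponent of the right order that is compatible with the doubling
  argument.\<close>

lemma power_of_2_between:
  assumes "1 \<le> (a :: real)"
  shows "\<exists>h. a \<le> 2 ^ h \<and> 2 ^ h \<le> 2 * a"
proof -
  obtain n where "a < 2 ^ n" using real_arch_pow[of 2 a] by auto
  then have ex: "\<exists>n. a \<le> 2 ^ n" by (intro exI[of _ n]) simp
  define h where "h = (LEAST n. a \<le> 2 ^ n)"
  have h: "a \<le> 2 ^ h" unfolding h_def using ex by (rule LeastI_ex)
  have "2 ^ h \<le> 2 * a"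
  proof (cases h)
    case (Suc j)
    then have "\<not> a \<le> 2 ^ j" using not_less_Least[of j "\<lambda>n. a \<le> 2 ^ n"] by (simp add: h_def)
    then show ?thesis using Suc by simp
  qed (use assms in simp)
  then show ?thesis using h by blast
qed

text \<open>Markov's inequality for the trace of the power \<open>2 * k\<close>, with
  \<open>k\<close> a power of two between \<open>p * n\<close> and \<open>2 * p * n\<close>. The
  factor \<open>exp (2 / c)\<close> under the root gains exp(-2k/c) <= n^(-2), because
  \<open>k\<close> is at least \<open>c * ln n\<close>; this pays for \<open>1 / p \<le> n\<close>
  and leaves \<open>1 / n\<close>.\<close>

lemma (in prob_space) sparse_quadratic_form_bound:
  fixes X :: "nat \<times> nat \<Rightarrow> 'a \<Rightarrow> real"
  assumes indep: "indep_vars (\<lambda>_. borel) X (upper_pairs n)"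
    and int: "\<And>e k. e \<in> upper_pairs n \<Longrightarrow> integrable M (\<lambda>\<omega>. X e \<omega> ^ k)"
    and mean: "\<And>e. e \<in> upper_pairs n \<Longrightarrow> expectation (X e) = 0"
    and moment: "\<And>e k. e \<in> upper_pairs n \<Longrightarrow> 2 \<le> k \<Longrightarrow> \<bar>expectation (\<lambda>\<omega>. X e \<omega> ^ k)\<bar> \<le> p"
    and p: "0 < p" "p \<le> 1" "1 \<le> p * real n" "c * ln (real n) \<le> p * real n" "0 < c" and n: "0 < n"
  shows "\<exists>F\<in>events. prob F \<le> 1 / real n \<and> (\<forall>\<omega>\<in>space M - F. \<forall>x.
    dot n x (apply_mat n (sym_extend (\<lambda>e. X e \<omega>)) x) \<le> sqrt (2 * walk_const * exp (2 / c) * (p * real n)) * dot n x x)"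
proof -
  obtain h where h: "p * real n \<le> 2 ^ h" "2 ^ h \<le> 2 * (p * real n)"
    using power_of_2_between[OF p(3)] by blast
  define k :: nat where "k = 2 ^ h"
  have k: "real k = 2 ^ h" "0 < k" by (simp_all add: k_def)
  define L where "L = walk_const * exp (2 / c)"
  have L: "0 < L" by (simp add: L_def walk_const_pos)
  define s where "s = sqrt (L * real k)"
  have s: "0 < s" "s * s = L * real k" using L k by (simp_all add: s_def)
  have s_pow: "s ^ (2 * k) = (L * real k) ^ k" using s by (simp add: power_mult power2_eq_square)
  define T where "T \<omega> = trace_power n (2 * k) (sym_extend (\<lambda>e. X e \<omega>))" for \<omega>
  have kp: "p * real n \<le> real k" using h k by simp
  have intT: "integrable M T"
    unfolding T_def by (rule integrable_trace_power[OF indep int mean moment p(1,2) kp k(2) n])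
  have T_le: "expectation T \<le> (walk_const * real k) ^ k / p"
    unfolding T_def by (rule expectation_trace_power_le[OF indep int mean moment p(1,2) kp k(2) n])
  define F where "F = {\<omega> \<in> space M. s ^ (2 * k) \<le> T \<omega>}"
  have F: "F \<in> events" unfolding F_def using intT by measurable
  have "prob F \<le> expectation T / s ^ (2 * k)"
    unfolding F_def
  proof (rule integral_Markov_inequality_measure[OF intT])
    show "AE \<omega> in M. 0 \<le> T \<omega>"
      unfolding T_def by (intro AE_I2 trace_power_even_nonneg symmetric_below_sym_extend)
  qed (use s in auto)
  also have "\<dots> \<le> (walk_const * real k) ^ k / p / s ^ (2 * k)"
    using s by (intro divide_right_mono T_le) auto
  also have "\<dots> = (1 / p) * (walk_const * real k / (L * real k)) ^ k"
  proof -
    have "a / p / b = 1 / p * (a / b)" for a b by simp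
    then show ?thesis unfolding s_pow power_divide by blast
  qed
  also have "walk_const * real k / (L * real k) = exp (- (2 / c))"
    using k walk_const_pos by (simp add: L_def exp_minus field_simps)
  also have "(1 / p) * exp (- (2 / c)) ^ k = (1 / p) * exp (- (2 * real k / c))"
    by (simp add: exp_of_nat_mult[symmetric] mult.commute)
  also have "\<dots> \<le> real n * exp (- (2 * ln (real n)))"
  proof (intro mult_mono)
    show "1 / p \<le> real n" using p by (simp add: field_simps)
    have "c * ln (real n) \<le> real k" using p(4) kp by linarith
    then have "2 * ln (real n) \<le> 2 * real k / c" using p(5) by (simp add: field_simps)
    then show "exp (- (2 * real k / c)) \<le> exp (- (2 * ln (real n)))" by simp
  qed auto
  also have "\<dots> = 1 / real n"
  proof -
    have "exp (- (2 * ln (real n))) = inverse (exp (ln (real n)) * exp (ln (real n)))"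
      by (simp add: exp_minus exp_add[symmetric])
    then show ?thesis using n by (simp add: field_simps)
  qed
  finally have prob: "prob F \<le> 1 / real n" .
  have "dot n x (apply_mat n (sym_extend (\<lambda>e. X e \<omega>)) x)
      \<le> sqrt (2 * walk_const * exp (2 / c) * (p * real n)) * dot n x x"
    if "\<omega> \<in> space M - F" for \<omega> x
  proof -
    have "trace_power n (2 * 2 ^ h) (sym_extend (\<lambda>e. X e \<omega>)) \<le> s ^ (2 * 2 ^ h)"
      using that by (auto simp: F_def T_def k_def)
    then have "dot n x (apply_mat n (sym_extend (\<lambda>e. X e \<omega>)) x) \<le> s * dot n x x"
      using s by (intro quadratic_form_le_of_trace_power symmetric_below_sym_extend) auto
    also have "s \<le> sqrt (2 * walk_const * exp (2 / c) * (p * real n))"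
    proof -
      have "L * real k \<le> L * (2 * (p * real n))" using h k L by (intro mult_left_mono) auto
      then show ?thesis unfolding s_def L_def by (simp add: mult_ac)
    qed
    finally show ?thesis by (simp add: mult_right_mono dot_self_nonneg)
  qed
  then show ?thesis using F prob by blast
qed

section \<open>Chernoff bounds and the norm of sub-Gaussian matrices\<close>

lemma (in prob_space) expectation_exp_pairs:
  fixes X :: "nat \<times> nat \<Rightarrow> 'a \<Rightarrow> real"
  assumes indep: "indep_vars (\<lambda>_. borel) X (upper_pairs n)"
    and J: "J \<subseteq> upper_pairs n"
    and int: "\<And>e. e \<in> J \<Longrightarrow> integrable M (\<lambda>\<omega>. exp (c e * X e \<omega>))"
  shows "integrable M (\<lambda>\<omega>. exp (\<Sum>e\<in>J. c e * X e \<omega>))"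
    and "expectation (\<lambda>\<omega>. exp (\<Sum>e\<in>J. c e * X e \<omega>)) = (\<Prod>e\<in>J. expectation (\<lambda>\<omega>. exp (c e * X e \<omega>)))"
proof -
  have fin: "finite J" using J finite_upper_pairs by (rule finite_subset)
  have ind: "indep_vars (\<lambda>_. borel) (\<lambda>e \<omega>. exp (c e * X e \<omega>)) J"
    by (rule indep_vars_compose2[OF indep_vars_subset[OF indep J]]) auto
  show "integrable M (\<lambda>\<omega>. exp (\<Sum>e\<in>J. c e * X e \<omega>))"
    unfolding exp_sum[OF fin] by (rule indep_vars_integrable[OF fin ind int])
  show "expectation (\<lambda>\<omega>. exp (\<Sum>e\<in>J. c e * X e \<omega>)) = (\<Prod>e\<in>J. expectation (\<lambda>\<omega>. exp (c e * X e \<omega>)))"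
    unfolding exp_sum[OF fin] by (rule indep_vars_lebesgue_integral[OF fin ind int])
qed

lemma (in prob_space) Chernoff_bound:
  assumes "integrable M (\<lambda>\<omega>. exp (Y \<omega>))" "expectation (\<lambda>\<omega>. exp (Y \<omega>)) \<le> b"
  shows "{\<omega> \<in> space M. a \<le> Y \<omega>} \<in> events" "prob {\<omega> \<in> space M. a \<le> Y \<omega>} \<le> exp (- a) * b"
proof -
  have "{\<omega> \<in> space M. a \<le> Y \<omega>} = {\<omega> \<in> space M. exp a \<le> exp (Y \<omega>)}" by simp
  moreover have "{\<omega> \<in> space M. exp a \<le> exp (Y \<omega>)} \<in> events" using assms(1) by measurable
  moreover have "prob {\<omega> \<in> space M. exp a \<le> exp (Y \<omega>)} \<le> expectation (\<lambda>\<omega>. exp (Y \<omega>)) / exp a"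
    by (rule integral_Markov_inequality_measure[OF assms(1)]) auto
  moreover have "\<dots> \<le> exp (- a) * b" using assms(2) by (simp add: exp_minus field_simps)
  ultimately show "{\<omega> \<in> space M. a \<le> Y \<omega>} \<in> events" "prob {\<omega> \<in> space M. a \<le> Y \<omega>} \<le> exp (- a) * b"
    by auto
qed

text \<open>At the chosen \<open>\<theta>\<close> the form has moment generating function at most
  exp(32 n / 2), so the level 32 n is exceeded with probability at most exp(-16 n) for each pair of
  grid points. There are at most 64^(2n) = 4096^n pairs, and 4096 exp(-16) <= exp(-1).\<close>

lemma (in prob_space) subgaussian_quadratic_form_bound:
  fixes X :: "nat \<times> nat \<Rightarrow> 'a \<Rightarrow> real"
  assumes indep: "indep_vars (\<lambda>_. borel) X (upper_pairs n)"
    and int: "\<And>e \<theta>. e \<in> upper_pairs n \<Longrightarrow> integrable M (\<lambda>\<omega>. exp (\<theta> * X e \<omega>))"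
    and mgf: "\<And>e \<theta>. e \<in> upper_pairs n \<Longrightarrow> expectation (\<lambda>\<omega>. exp (\<theta> * X e \<omega>)) \<le> exp (\<theta>\<^sup>2 * \<tau>\<^sup>2 / 2)"
    and "0 < \<tau>" and n: "0 < n"
  shows "\<exists>F\<in>events. prob F \<le> exp (- real n) \<and> (\<forall>\<omega>\<in>space M - F. \<forall>x.
    dot n x (apply_mat n (sym_extend (\<lambda>e. X e \<omega>)) x) \<le> 32 * \<tau> * sqrt (real n) * dot n x x)"
proof -
  define Q where "Q \<omega> y z = (\<Sum>i<n. \<Sum>j<n. sym_extend (\<lambda>e. X e \<omega>) i j * real_of_int (y i) * real_of_int (z j))"
    for \<omega> and y z :: "nat \<Rightarrow> int"
  define s where "s = 32 * \<tau> * sqrt (real n)"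
  define \<theta> where "\<theta> = 1 / (\<tau> * sqrt (real n))"
  define G where "G y z = {\<omega> \<in> space M. 32 * real n \<le> \<theta> * Q \<omega> y z}" for y z
  have G: "G y z \<in> events \<and> prob (G y z) \<le> exp (- 16 * real n)" if yz: "y \<in> grid n" "z \<in> grid n" for y z
  proof -
    define c where "c e = (if fst e = snd e then real_of_int (y (fst e)) * real_of_int (z (fst e))
      else real_of_int (y (fst e)) * real_of_int (z (snd e)) + real_of_int (y (snd e)) * real_of_int (z (fst e)))" for e
    have Q: "\<theta> * Q \<omega> y z = (\<Sum>e\<in>upper_pairs n. (\<theta> * c e) * X e \<omega>)" for \<omega>
      unfolding Q_def sum_sym_extend_bilinear c_def by (simp add: sum_distrib_left mult_ac)
    have int': "integrable M (\<lambda>\<omega>. exp (\<theta> * Q \<omega> y z))"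
      unfolding Q using int by (intro expectation_exp_pairs[OF indep]) auto
    have "expectation (\<lambda>\<omega>. exp (\<theta> * Q \<omega> y z)) = (\<Prod>e\<in>upper_pairs n. expectation (\<lambda>\<omega>. exp (\<theta> * c e * X e \<omega>)))"
      unfolding Q using int by (intro expectation_exp_pairs[OF indep]) auto
    also have "\<dots> \<le> (\<Prod>e\<in>upper_pairs n. exp ((\<theta> * c e)\<^sup>2 * \<tau>\<^sup>2 / 2))"
      by (intro prod_mono conjI mgf) auto
    also have "\<dots> = exp (\<Sum>e\<in>upper_pairs n. (\<theta> * c e)\<^sup>2 * \<tau>\<^sup>2 / 2)" by (simp add: exp_sum)
    also have "(\<Sum>e\<in>upper_pairs n. (\<theta> * c e)\<^sup>2 * \<tau>\<^sup>2 / 2) = (\<theta> * \<tau>)\<^sup>2 / 2 * (\<Sum>e\<in>upper_pairs n. (c e)\<^sup>2)"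
      by (simp add: sum_distrib_left power_mult_distrib mult_ac)
    also have "(\<theta> * \<tau>)\<^sup>2 = 1 / real n"
      using \<open>0 < \<tau>\<close> n by (simp add: \<theta>_def power_divide)
    also have "exp (1 / real n / 2 * (\<Sum>e\<in>upper_pairs n. (c e)\<^sup>2)) \<le> exp (16 * real n)"
    proof -
      have "1 / real n / 2 * (\<Sum>e\<in>upper_pairs n. (c e)\<^sup>2) \<le> 1 / real n / 2 * (32 * (real n)\<^sup>2)"
        using grid_coeff_square_sum_le[OF yz] by (intro mult_left_mono) (auto simp: c_def)
      also have "\<dots> = 16 * real n" using n by (simp add: power2_eq_square)
      finally show ?thesis by simp
    qed
    finally have "expectation (\<lambda>\<omega>. exp (\<theta> * Q \<omega> y z)) \<le> exp (16 * real n)" .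
    from Chernoff_bound[OF int' this, of "32 * real n"] show ?thesis
      by (simp add: G_def exp_add[symmetric])
  qed
  define F where "F = (\<Union>p\<in>grid n \<times> grid n. G (fst p) (snd p))"
  have fin: "finite (grid n \<times> grid n)" using finite_grid by blast
  have F: "F \<in> events" unfolding F_def using G fin by (intro sets.finite_UN) auto
  have "prob F \<le> (\<Sum>p\<in>grid n \<times> grid n. prob (G (fst p) (snd p)))"
    unfolding F_def using G fin by (intro finite_measure_subadditive_finite) auto
  also have "\<dots> \<le> (\<Sum>p\<in>grid n \<times> grid n. exp (- 16 * real n))"
    using G by (intro sum_mono) auto
  also have "\<dots> = real (card (grid n)) * real (card (grid n)) * exp (- 16 * real n)"
    by (simp add: card_cartesian_product)
  also have "\<dots> \<le> 64 ^ n * 64 ^ n * exp (- 16 * real n)"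
    by (intro mult_right_mono mult_mono card_grid_le) auto
  also have "\<dots> = (4096 * exp (- 16)) ^ n"
  proof -
    have "exp (- 16 * real n) = exp (- 16) ^ n" by (simp add: exp_of_nat_mult[symmetric] mult.commute)
    moreover have "(64 :: real) ^ n * 64 ^ n = 4096 ^ n" by (simp add: power_mult_distrib[symmetric])
    ultimately show ?thesis by (simp only: power_mult_distrib)
  qed
  also have "\<dots> \<le> exp (- 1) ^ n"
  proof (intro power_mono)
    have "(2 :: real) ^ 15 \<le> exp 1 ^ 15"
      using exp_ge_add_one_self[of "1 :: real"] by (intro power_mono) auto
    also have "exp 1 ^ 15 = exp (15 :: real)" by (simp add: exp_of_nat_mult[symmetric])
    finally have "4096 * exp (- 16) \<le> exp 15 * exp (- 16 :: real)" by (intro mult_right_mono) auto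
    then show "4096 * exp (- 16) \<le> exp (- 1 :: real)" by (simp add: exp_add[symmetric])
  qed simp
  also have "\<dots> = exp (- real n)" by (simp add: exp_of_nat_mult[symmetric])
  finally have prob: "prob F \<le> exp (- real n)" .
  have "dot n x (apply_mat n (sym_extend (\<lambda>e. X e \<omega>)) x) \<le> s * dot n x x" if \<omega>: "\<omega> \<in> space M - F" for \<omega> x
  proof (rule quadratic_form_le_of_unit)
    fix y assume y: "dot n y y = 1"
    show "dot n y (apply_mat n (sym_extend (\<lambda>e. X e \<omega>)) y) \<le> s"
    proof (rule bilinear_bound_of_grid)
      fix u z assume uz: "u \<in> grid n" "z \<in> grid n"
      have "\<omega> \<notin> G u z" using uz \<omega> by (force simp: F_def)
      then have "\<theta> * Q \<omega> u z \<le> 32 * real n" using \<omega> by (auto simp: G_def)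
      then have "Q \<omega> u z \<le> 32 * real n * (\<tau> * sqrt (real n))"
        using \<open>0 < \<tau>\<close> n by (simp add: \<theta>_def divide_le_eq)
      then show "(\<Sum>i<n. \<Sum>j<n. sym_extend (\<lambda>e. X e \<omega>) i j * real_of_int (u i) * real_of_int (z j)) \<le> s * real n"
        by (simp add: Q_def s_def mult_ac)
    qed (use y n in auto)
  qed
  then show ?thesis using F prob unfolding s_def by blast
qed

section \<open>Recovery probability and its limit\<close>

text \<open>The sign makes every entry favour the planted labels on average. The shift
  \<open>\<rho>\<close> is 0 for synchronization and the censored model and equalises the means in
  the block model.\<close>

definition aligned :: "(nat \<Rightarrow> real) \<Rightarrow> real \<Rightarrow> real mat \<Rightarrow> nat \<times> nat \<Rightarrow> real" where
  "aligned \<sigma> \<rho> A e = \<sigma> (fst e) * \<sigma> (snd e) * (A $$ e - \<rho>)"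

lemma sym_extend_aligned:
  assumes "A \<in> carrier_mat n n" "transpose_mat A = A" "i < n" "j < n"
  shows "sym_extend (aligned \<sigma> \<rho> A) i j = \<sigma> i * \<sigma> j * (A $$ (i, j) - \<rho>)"
proof -
  have "A $$ (j, i) = A $$ (i, j)"
    using assms by (metis carrier_matD index_transpose_mat(1))
  then show ?thesis by (auto simp: sym_extend_def aligned_def min_def max_def)
qed

lemma exact_recovery_if_aligned_degrees_dominate:
  assumes label: "label_vector n \<sigma>" and A: "A \<in> carrier_mat n n" "transpose_mat A = A"
    and C: "C \<subseteq> elliptope n" "truth_mat n \<sigma> \<in> C"
    and shift: "\<And>Y. Y \<in> C \<Longrightarrow> \<rho> * entry_sum Y = \<rho> * entry_sum (truth_mat n \<sigma>)"
    and W: "\<And>x. dot n x (apply_mat n (sym_extend (\<lambda>e. aligned \<sigma> \<rho> A e - \<mu>)) x) \<le> s * dot n x x"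
    and D: "\<And>i. i < n \<Longrightarrow> s < (\<Sum>j<n. sym_extend (aligned \<sigma> \<rho> A) i j)"
  shows "exact_recovery C (truth_mat n \<sigma>) A"
proof (rule exact_recovery_if_laplacian_positive[OF label A(1) C shift])
  fix x :: "nat \<Rightarrow> real" assume x: "\<exists>i<n. \<exists>j<n. x i \<noteq> x j"
  have "0 < (\<Sum>i<n. \<Sum>j<n. sym_extend (aligned \<sigma> \<rho> A) i j * (x i - x j)\<^sup>2)"
  proof (rule laplacian_positive_if_degrees_dominate[OF _ _ _ D x])
    show "sym_extend (aligned \<sigma> \<rho> A) i j = \<mu> + sym_extend (\<lambda>e. aligned \<sigma> \<rho> A e - \<mu>) i j" for i j
      by (simp add: sym_extend_def)
    show "sym_extend (aligned \<sigma> \<rho> A) i j = sym_extend (aligned \<sigma> \<rho> A) j i" for i j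
      by (simp add: sym_extend_def min.commute max.commute)
    show "(\<Sum>i<n. \<Sum>j<n. sym_extend (\<lambda>e. aligned \<sigma> \<rho> A e - \<mu>) i j * y i * y j) \<le> s * (\<Sum>i<n. (y i)\<^sup>2)" for y
      using W[of y] by (simp add: dot_app_eq) (simp add: dot_def power2_eq_square)
  qed
  then show "0 < (\<Sum>i<n. \<Sum>j<n. \<sigma> i * \<sigma> j * (A $$ (i, j) - \<rho>) * (x i - x j)\<^sup>2)"
    using A by (simp add: sym_extend_aligned cong: sum.cong_simp)
qed

text \<open>The \<open>n\<close> entries of a row, the diagonal one included, sit at distinct sorted
  pairs and are therefore independent. The claim is the lower-tail Chernoff bound at a fixed tilt
  \<open>\<theta>\<close>.\<close>

lemma (in prob_space) degree_tail:
  fixes X :: "nat \<times> nat \<Rightarrow> 'a \<Rightarrow> real"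
  assumes indep: "indep_vars (\<lambda>_. borel) X (upper_pairs n)" and i: "i < n" and "0 < \<theta>"
    and int: "\<And>e. e \<in> upper_pairs n \<Longrightarrow> integrable M (\<lambda>\<omega>. exp (- \<theta> * X e \<omega>))"
    and mgf: "(\<Prod>j<n. expectation (\<lambda>\<omega>. exp (- \<theta> * X (min i j, max i j) \<omega>))) \<le> b"
  shows "{\<omega> \<in> space M. (\<Sum>j<n. sym_extend (\<lambda>e. X e \<omega>) i j) \<le> t} \<in> events"
    and "prob {\<omega> \<in> space M. (\<Sum>j<n. sym_extend (\<lambda>e. X e \<omega>) i j) \<le> t} \<le> exp (\<theta> * t) * b"
proof -
  let ?e = "\<lambda>j. (min i j, max i j)"
  define J where "J = ?e ` {..<n}"
  have inj: "inj_on ?e {..<n}" by (auto simp: inj_on_def min_def max_def split: if_splits)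
  have J: "J \<subseteq> upper_pairs n" using i by (auto simp: J_def upper_pairs_def)
  have sum: "(\<Sum>e\<in>J. - \<theta> * X e \<omega>) = - \<theta> * (\<Sum>j<n. sym_extend (\<lambda>e. X e \<omega>) i j)" for \<omega>
    unfolding J_def by (subst sum.reindex[OF inj]) (simp add: sym_extend_def sum_distrib_left)
  have int': "integrable M (\<lambda>\<omega>. exp (\<Sum>e\<in>J. - \<theta> * X e \<omega>))"
    using int J by (intro expectation_exp_pairs(1)[OF indep J, of "\<lambda>_. - \<theta>"]) auto
  have "expectation (\<lambda>\<omega>. exp (\<Sum>e\<in>J. - \<theta> * X e \<omega>)) = (\<Prod>e\<in>J. expectation (\<lambda>\<omega>. exp (- \<theta> * X e \<omega>)))"
    using int J by (intro expectation_exp_pairs(2)[OF indep J, of "\<lambda>_. - \<theta>"]) auto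
  also have "\<dots> = (\<Prod>j<n. expectation (\<lambda>\<omega>. exp (- \<theta> * X (?e j) \<omega>)))"
    unfolding J_def by (subst prod.reindex[OF inj]) simp
  finally have "expectation (\<lambda>\<omega>. exp (\<Sum>e\<in>J. - \<theta> * X e \<omega>)) \<le> b" using mgf by simp
  note bound = Chernoff_bound[OF int' this, of "- \<theta> * t"]
  have eq: "{\<omega> \<in> space M. - \<theta> * t \<le> (\<Sum>e\<in>J. - \<theta> * X e \<omega>)}
      = {\<omega> \<in> space M. (\<Sum>j<n. sym_extend (\<lambda>e. X e \<omega>) i j) \<le> t}"
    unfolding sum using \<open>0 < \<theta>\<close> by simp
  show "{\<omega> \<in> space M. (\<Sum>j<n. sym_extend (\<lambda>e. X e \<omega>) i j) \<le> t} \<in> events"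
    "prob {\<omega> \<in> space M. (\<Sum>j<n. sym_extend (\<lambda>e. X e \<omega>) i j) \<le> t} \<le> exp (\<theta> * t) * b"
    using bound unfolding eq by simp_all
qed

lemma indep_vars_aligned:
  assumes "indep_symmetric_mat M n A" and f: "f \<in> borel_measurable borel"
  shows "prob_space.indep_vars M (\<lambda>_. borel) (\<lambda>e \<omega>. f (aligned \<sigma> \<rho> (A \<omega>) e)) (upper_pairs n)"
proof -
  interpret prob_space M using assms by (simp add: indep_symmetric_mat_def)
  have "indep_vars (\<lambda>_. borel) (\<lambda>e \<omega>. A \<omega> $$ e) (upper_pairs n)"
    using assms by (simp add: indep_symmetric_mat_def upper_pairs_def case_prod_unfold)
  then show ?thesis
    unfolding aligned_def
    by (rule indep_vars_compose2[where Y = "\<lambda>e a. f (\<sigma> (fst e) * \<sigma> (snd e) * (a - \<rho>))"])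
      (use f in measurable)
qed

text \<open>Failure is charged to the spectral event or to one of \<open>n\<close> row events, each
  of probability at most exp(\<theta> s - y). The model enters only through the feasible set,
  \<open>\<rho>\<close>, \<open>\<mu>\<close>, \<open>\<theta>\<close>, \<open>s\<close> and the
  constant \<open>K\<close> that compares \<theta> s with \<open>sqrt y\<close>.\<close>

lemma exact_recovery_probability:
  assumes A: "indep_symmetric_mat M n A" and label: "label_vector n \<sigma>"
    and C: "C \<subseteq> elliptope n" "truth_mat n \<sigma> \<in> C" "compact (mat_fun n ` C)"
    and shift: "\<And>Y. Y \<in> C \<Longrightarrow> \<rho> * entry_sum Y = \<rho> * entry_sum (truth_mat n \<sigma>)"
    and W: "\<exists>F\<in>sets M. measure M F \<le> \<eta> \<and> (\<forall>\<omega>\<in>space M - F. \<forall>x.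
      dot n x (apply_mat n (sym_extend (\<lambda>e. aligned \<sigma> \<rho> (A \<omega>) e - \<mu>)) x) \<le> s * dot n x x)"
    and \<theta>: "0 < \<theta>"
    and int: "\<And>e. e \<in> upper_pairs n \<Longrightarrow> integrable M (\<lambda>\<omega>. exp (- \<theta> * aligned \<sigma> \<rho> (A \<omega>) e))"
    and mgf: "\<And>i. i < n \<Longrightarrow>
      (\<Prod>j<n. \<integral>\<omega>. exp (- \<theta> * aligned \<sigma> \<rho> (A \<omega>) (min i j, max i j)) \<partial>M) \<le> exp (- y)"
    and \<theta>s: "\<theta> * s \<le> K * sqrt y"
  shows "1 - \<eta> - real n * exp (K * sqrt y - y)
    \<le> measure M {\<omega> \<in> space M. exact_recovery C (truth_mat n \<sigma>) (A \<omega>)}"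
proof -
  interpret prob_space M using A by (simp add: indep_symmetric_mat_def)
  have Am: "A \<omega> \<in> carrier_mat n n" "transpose_mat (A \<omega>) = A \<omega>" if "\<omega> \<in> space M" for \<omega>
    using A that by (auto simp: indep_symmetric_mat_def)
  have rv: "(\<lambda>\<omega>. A \<omega> $$ e) \<in> borel_measurable M" if "e \<in> upper_pairs n" for e
    using A that by (cases e) (auto simp: indep_symmetric_mat_def indep_vars_def upper_pairs_def)
  have meas: "(\<lambda>\<omega>. A \<omega> $$ (i, j)) \<in> borel_measurable M" if ij: "i < n" "j < n" for i j
  proof (cases "i \<le> j")
    case False
    have "A \<omega> $$ (i, j) = A \<omega> $$ (j, i)" if "\<omega> \<in> space M" for \<omega>
      using Am[OF that] ij by (metis carrier_matD index_transpose_mat(1))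
    moreover have "(\<lambda>\<omega>. A \<omega> $$ (j, i)) \<in> borel_measurable M"
      using False ij by (intro rv) (auto simp: upper_pairs_def)
    ultimately show ?thesis using measurable_cong by (metis (no_types, lifting))
  qed (use ij in \<open>auto intro: rv simp: upper_pairs_def\<close>)
  let ?R = "{\<omega> \<in> space M. exact_recovery C (truth_mat n \<sigma>) (A \<omega>)}"
  \<comment> \<open>Monotonicity of \<open>measure\<close> needs this, since \<open>measure\<close>
    is 0 on sets outside the sigma-algebra.\<close>
  have R: "?R \<in> events"
  proof (rule exact_recovery_event_measurable[OF _ C(2,3)])
    show "C \<subseteq> carrier_mat n n" using C(1) by (auto simp: elliptope_def psd_mat_def)
  qed (use Am meas in auto)
  obtain F where F: "F \<in> events" "prob F \<le> \<eta>"
    "\<And>\<omega> x. \<omega> \<in> space M - F \<Longrightarrow>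
      dot n x (apply_mat n (sym_extend (\<lambda>e. aligned \<sigma> \<rho> (A \<omega>) e - \<mu>)) x) \<le> s * dot n x x"
    using W by blast
  define G where "G i = {\<omega> \<in> space M. (\<Sum>j<n. sym_extend (aligned \<sigma> \<rho> (A \<omega>)) i j) \<le> s}" for i
  have G: "G i \<in> events \<and> prob (G i) \<le> exp (K * sqrt y - y)" if "i < n" for i
  proof -
    have ind: "indep_vars (\<lambda>_. borel) (\<lambda>e \<omega>. aligned \<sigma> \<rho> (A \<omega>) e) (upper_pairs n)"
      using indep_vars_aligned[OF A, of "\<lambda>a. a"] by simp
    note tail = degree_tail[OF ind that \<theta> int mgf[OF that], of s]
    have "exp (\<theta> * s) * exp (- y) \<le> exp (K * sqrt y - y)"
      using \<theta>s by (simp add: exp_add[symmetric])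
    then show ?thesis using tail unfolding G_def by (auto intro: order_trans)
  qed
  define U where "U = (\<Union>i<n. G i)"
  have U: "U \<in> events" unfolding U_def using G by auto
  have "prob U \<le> (\<Sum>i<n. prob (G i))"
    unfolding U_def using G by (intro finite_measure_subadditive_finite) auto
  also have "\<dots> \<le> (\<Sum>i<n. exp (K * sqrt y - y))" using G by (intro sum_mono) auto
  finally have PU: "prob U \<le> real n * exp (K * sqrt y - y)" by simp
  have "space M - (F \<union> U) \<subseteq> ?R"
  proof
    fix \<omega> assume \<omega>: "\<omega> \<in> space M - (F \<union> U)"
    have "exact_recovery C (truth_mat n \<sigma>) (A \<omega>)"
    proof (rule exact_recovery_if_aligned_degrees_dominate[OF label _ _ C(1,2) shift])
      show "s < (\<Sum>j<n. sym_extend (aligned \<sigma> \<rho> (A \<omega>)) i j)" if "i < n" for i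
        using \<omega> that by (auto simp: U_def G_def not_le)
    qed (use \<omega> Am F(3) in auto)
    then show "\<omega> \<in> ?R" using \<omega> by simp
  qed
  then have "prob (space M - (F \<union> U)) \<le> prob ?R" using R by (intro finite_measure_mono)
  moreover have "prob (space M - (F \<union> U)) = 1 - prob (F \<union> U)" using F U by (intro prob_compl) auto
  moreover have "prob (F \<union> U) \<le> prob F + prob U" using F U by (intro measure_Un_le) auto
  ultimately show ?thesis using F(2) PU by linarith
qed

text \<open>The slack \<delta> absorbs the loss \<open>K * sqrt y\<close>, because
  \<open>sqrt y\<close> is negligible against \<open>y\<close> once log n is large. A filter below
  \<open>sequentially\<close> is allowed in order to cover limits along even
  \<open>n\<close>.\<close>

lemma tendsto_1_if_rate:
  fixes P y :: "nat \<Rightarrow> real"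
  assumes F: "F \<le> sequentially" and "0 < \<delta>"
    and y: "\<forall>\<^sub>F n in F. (1 + \<delta>) * ln (real n) \<le> y n"
    and P: "\<forall>\<^sub>F n in F. 1 - 1 / real n - real n * exp (K * sqrt (y n) - y n) \<le> P n"
    and P1: "\<forall>\<^sub>F n in F. P n \<le> 1"
  shows "(P \<longlongrightarrow> 1) F"
proof (rule tendsto_sandwich[OF _ P1])
  \<comment> \<open>Giving up the fraction \<kappa> of the exponent keeps (1 - \<kappa>)(1 +
    \<delta>) = 1 + \<delta>/2, so the union over \<open>n\<close> rows still leaves
    n^(-\<delta>/2).\<close>
  define \<kappa> where "\<kappa> = \<delta> / (2 * (1 + \<delta>))"
  have \<kappa>: "0 < \<kappa>" "\<kappa> < 1" "(1 - \<kappa>) * (1 + \<delta>) = 1 + \<delta> / 2"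
    using \<open>0 < \<delta>\<close> by (simp_all add: \<kappa>_def field_simps)
  have "filterlim (\<lambda>n. ln (real n)) at_top sequentially" by real_asymp
  then have "\<forall>\<^sub>F n in sequentially. (K / \<kappa>)\<^sup>2 \<le> ln (real n)" by (simp add: filterlim_at_top)
  then have large: "\<forall>\<^sub>F n in F. (K / \<kappa>)\<^sup>2 \<le> ln (real n)" using F by (rule filter_leD[rotated])
  have pos: "\<forall>\<^sub>F n in F. 0 < n" using eventually_gt_at_top[of 0] F by (rule filter_leD[rotated])
  show "\<forall>\<^sub>F n in F. 1 - 1 / real n - real n powr (- (\<delta> / 2)) \<le> P n"
    using y P large pos
  proof eventually_elim
    case (elim n)
    have ln0: "0 \<le> ln (real n)" using elim(4) by simp
    have "(K / \<kappa>)\<^sup>2 \<le> ln (real n)" by (rule elim(3))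
    also have "\<dots> \<le> (1 + \<delta>) * ln (real n)" using ln0 \<open>0 < \<delta>\<close> by (simp add: algebra_simps)
    also have "\<dots> \<le> y n" by (rule elim(1))
    finally have Ky: "(K / \<kappa>)\<^sup>2 \<le> y n" .
    then have y0: "0 \<le> y n" using zero_le_power2[of "K / \<kappa>"] by linarith
    have "K / \<kappa> \<le> sqrt (y n)" using Ky by (rule real_le_rsqrt)
    then have "K \<le> \<kappa> * sqrt (y n)" using \<kappa>(1) by (simp add: field_simps)
    then have "K * sqrt (y n) \<le> \<kappa> * sqrt (y n) * sqrt (y n)" using y0 by (intro mult_right_mono) auto
    also have "\<dots> = \<kappa> * y n" using y0 by (simp add: mult.assoc)
    finally have "K * sqrt (y n) - y n \<le> - ((1 - \<kappa>) * y n)" by (simp add: algebra_simps)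
    also have "\<dots> \<le> - ((1 - \<kappa>) * ((1 + \<delta>) * ln (real n)))"
      using elim(1) \<kappa>(2) by (simp add: mult_left_mono)
    also have "\<dots> = - (1 + \<delta> / 2) * ln (real n)" using \<kappa>(3) by (metis mult.assoc mult_minus_left)
    finally have "real n * exp (K * sqrt (y n) - y n) \<le> real n * exp (- (1 + \<delta> / 2) * ln (real n))"
      by (intro mult_left_mono) auto
    also have "\<dots> = real n powr 1 * real n powr (- (1 + \<delta> / 2))"
      using elim(4) by (simp add: powr_def)
    also have "\<dots> = real n powr (1 + - (1 + \<delta> / 2))" by (rule powr_add[symmetric])
    also have "\<dots> = real n powr (- (\<delta> / 2))" by simp
    finally show ?case using elim(2) by linarith
  qed
  have "((\<lambda>n. 1 - 1 / real n - real n powr (- (\<delta> / 2))) \<longlongrightarrow> 1) sequentially"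
    using \<open>0 < \<delta>\<close> by real_asymp
  then show "((\<lambda>n. 1 - 1 / real n - real n powr (- (\<delta> / 2))) \<longlongrightarrow> 1) F" by (rule tendsto_mono[OF F])
qed (rule tendsto_const)

section \<open>Synchronization and the censored block model\<close>

lemma (in prob_space)
  assumes Y: "distributed M lborel Y (normal_density m \<tau>)" and "0 < \<tau>"
  shows integrable_exp_normal: "integrable M (\<lambda>\<omega>. exp (a * Y \<omega>))"
    and expectation_exp_normal: "expectation (\<lambda>\<omega>. exp (a * Y \<omega>)) = exp (a * m + a\<^sup>2 * \<tau>\<^sup>2 / 2)"
proof -
  \<comment> \<open>Completing the square: the exponential tilt moves the mean by
    \<open>a * \<tau>\<^sup>2\<close> and keeps the variance.\<close>
  have shift: "normal_density m \<tau> x * exp (a * x)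
      = exp (a * m + a\<^sup>2 * \<tau>\<^sup>2 / 2) * normal_density (m + a * \<tau>\<^sup>2) \<tau> x" for x
  proof -
    have "- (x - m)\<^sup>2 / (2 * \<tau>\<^sup>2) + a * x
        = (a * m + a\<^sup>2 * \<tau>\<^sup>2 / 2) + - (x - (m + a * \<tau>\<^sup>2))\<^sup>2 / (2 * \<tau>\<^sup>2)"
      using \<open>0 < \<tau>\<close> by (simp add: field_simps power2_eq_square)
    then have "exp (- (x - m)\<^sup>2 / (2 * \<tau>\<^sup>2)) * exp (a * x)
        = exp (a * m + a\<^sup>2 * \<tau>\<^sup>2 / 2) * exp (- (x - (m + a * \<tau>\<^sup>2))\<^sup>2 / (2 * \<tau>\<^sup>2))"
      by (simp only: exp_add[symmetric])
    then show ?thesis by (simp add: normal_density_def mult.left_commute)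
  qed
  have "integrable lborel (\<lambda>x. normal_density m \<tau> x * exp (a * x))"
    unfolding shift using \<open>0 < \<tau>\<close> by simp
  then show "integrable M (\<lambda>\<omega>. exp (a * Y \<omega>))"
    using distributed_integrable[OF Y, of "\<lambda>x. exp (a * x)"] by simp
  have "expectation (\<lambda>\<omega>. exp (a * Y \<omega>)) = (\<integral>x. normal_density m \<tau> x * exp (a * x) \<partial>lborel)"
    using distributed_integral[OF Y, of "\<lambda>x. exp (a * x)"] by simp
  also have "\<dots> = exp (a * m + a\<^sup>2 * \<tau>\<^sup>2 / 2)"
    unfolding shift using \<open>0 < \<tau>\<close> by simp
  finally show "expectation (\<lambda>\<omega>. exp (a * Y \<omega>)) = exp (a * m + a\<^sup>2 * \<tau>\<^sup>2 / 2)" .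
qed

lemma label_product:
  assumes "label_vector n \<sigma>" "e \<in> upper_pairs n"
  shows "\<sigma> (fst e) * \<sigma> (snd e) = 1 \<or> \<sigma> (fst e) * \<sigma> (snd e) = -1"
proof -
  have "fst e < n" "snd e < n" using assms(2) by (auto simp: upper_pairs_def)
  then have "\<sigma> (fst e) \<in> {-1, 1}" "\<sigma> (snd e) \<in> {-1, 1}" using assms(1) by (auto simp: label_vector_def)
  then show ?thesis by auto
qed

lemma pair_in_upper_pairs: "i < n \<Longrightarrow> j < n \<Longrightarrow> (min i j, max i j) \<in> upper_pairs n"
  by (auto simp: upper_pairs_def)

lemma z2_exact_recovery_probability:
  assumes model: "z2_synchronization M n \<sigma> \<tau> A" and n: "0 < n"
  shows "1 - 1 / real n - real n * exp (32 * sqrt 2 * sqrt (real n * z2_rate \<tau>) - real n * z2_rate \<tau>)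
    \<le> measure M {\<omega> \<in> space M. exact_recovery (elliptope n) (truth_mat n \<sigma>) (A \<omega>)}"
proof -
  have label: "label_vector n \<sigma>" and \<tau>: "0 < \<tau>" and A: "indep_symmetric_mat M n A"
    and dist: "\<And>i j. i \<le> j \<Longrightarrow> j < n \<Longrightarrow>
      distributed M lborel (\<lambda>\<omega>. A \<omega> $$ (i, j)) (normal_density (\<sigma> i * \<sigma> j) \<tau>)"
    using model by (auto simp: z2_synchronization_def)
  interpret prob_space M using A by (simp add: indep_symmetric_mat_def)
  have mgf: "integrable M (\<lambda>\<omega>. exp (a * aligned \<sigma> 0 (A \<omega>) e)) \<and>
      expectation (\<lambda>\<omega>. exp (a * aligned \<sigma> 0 (A \<omega>) e)) = exp (a + a\<^sup>2 * \<tau>\<^sup>2 / 2)"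
    if e: "e \<in> upper_pairs n" for a e
  proof -
    define m where "m = \<sigma> (fst e) * \<sigma> (snd e)"
    have m: "m * m = 1" using label_product[OF label e] by (auto simp: m_def)
    have d: "distributed M lborel (\<lambda>\<omega>. A \<omega> $$ e) (normal_density m \<tau>)"
      using dist[of "fst e" "snd e"] e by (auto simp: m_def upper_pairs_def)
    have eq: "a * aligned \<sigma> 0 (A \<omega>) e = (a * m) * A \<omega> $$ e" for \<omega>
      by (simp add: aligned_def m_def)
    have am: "a * m * m = a" using m by (simp add: mult.assoc)
    have "(a * m)\<^sup>2 = a * m * m * a" by (simp add: power2_eq_square)
    then have am2: "(a * m)\<^sup>2 = a\<^sup>2" unfolding am by (simp add: power2_eq_square)
    show ?thesis
      using integrable_exp_normal[OF d \<tau>, of "a * m"] expectation_exp_normal[OF d \<tau>, of "a * m"]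
      unfolding eq am am2 by blast
  qed
  have centred: "integrable M (\<lambda>\<omega>. exp (a * (aligned \<sigma> 0 (A \<omega>) e - 1))) \<and>
      expectation (\<lambda>\<omega>. exp (a * (aligned \<sigma> 0 (A \<omega>) e - 1))) = exp (a\<^sup>2 * \<tau>\<^sup>2 / 2)"
    if e: "e \<in> upper_pairs n" for a e
  proof -
    have eq: "exp (a * (aligned \<sigma> 0 (A \<omega>) e - 1)) = exp (- a) * exp (a * aligned \<sigma> 0 (A \<omega>) e)" for \<omega>
      by (simp add: exp_add[symmetric] algebra_simps)
    have law: "integrable M (\<lambda>\<omega>. exp (a * aligned \<sigma> 0 (A \<omega>) e))"
      "expectation (\<lambda>\<omega>. exp (a * aligned \<sigma> 0 (A \<omega>) e)) = exp (a + a\<^sup>2 * \<tau>\<^sup>2 / 2)"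
      using mgf[OF e, of a] by simp_all
    show ?thesis
      unfolding eq
    proof
      show "integrable M (\<lambda>\<omega>. exp (- a) * exp (a * aligned \<sigma> 0 (A \<omega>) e))"
        by (intro integrable_mult_right law)
      have "exp (- a) * exp (a + a\<^sup>2 * \<tau>\<^sup>2 / 2) = exp (a\<^sup>2 * \<tau>\<^sup>2 / 2)" by (simp add: exp_add[symmetric])
      then show "expectation (\<lambda>\<omega>. exp (- a) * exp (a * aligned \<sigma> 0 (A \<omega>) e)) = exp (a\<^sup>2 * \<tau>\<^sup>2 / 2)"
        by (simp only: integral_mult_right_zero law)
    qed
  qed
  have ind: "indep_vars (\<lambda>_. borel) (\<lambda>e \<omega>. aligned \<sigma> 0 (A \<omega>) e - 1) (upper_pairs n)"
    by (rule indep_vars_aligned[OF A, of "\<lambda>a. a - 1"]) simp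
  have "real n \<le> exp (real n)" using exp_ge_add_one_self[of "real n"] by linarith
  then have small: "exp (- real n) \<le> 1 / real n" using n by (simp add: exp_minus field_simps)
  have "\<exists>F\<in>events. prob F \<le> exp (- real n) \<and> (\<forall>\<omega>\<in>space M - F. \<forall>x.
      dot n x (apply_mat n (sym_extend (\<lambda>e. aligned \<sigma> 0 (A \<omega>) e - 1)) x) \<le> 32 * \<tau> * sqrt (real n) * dot n x x)"
    by (rule subgaussian_quadratic_form_bound[OF ind _ _ \<tau> n]) (use centred in auto)
  then have W: "\<exists>F\<in>events. prob F \<le> 1 / real n \<and> (\<forall>\<omega>\<in>space M - F. \<forall>x.
      dot n x (apply_mat n (sym_extend (\<lambda>e. aligned \<sigma> 0 (A \<omega>) e - 1)) x) \<le> 32 * \<tau> * sqrt (real n) * dot n x x)"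
    using small by (meson order_trans)
  show ?thesis
  proof (rule exact_recovery_probability[OF A label order_refl truth_mat_in_elliptope[OF label]
        compact_mat_fun_elliptope _ W, of "1 / \<tau>\<^sup>2"])
    show "0 < 1 / \<tau>\<^sup>2" using \<tau> by simp
    show "integrable M (\<lambda>\<omega>. exp (- (1 / \<tau>\<^sup>2) * aligned \<sigma> 0 (A \<omega>) e))" if "e \<in> upper_pairs n" for e
      using mgf[OF that] by blast
    show "(\<Prod>j<n. expectation (\<lambda>\<omega>. exp (- (1 / \<tau>\<^sup>2) * aligned \<sigma> 0 (A \<omega>) (min i j, max i j))))
        \<le> exp (- (real n * z2_rate \<tau>))" if "i < n" for i
    proof -
      have "(\<Prod>j<n. expectation (\<lambda>\<omega>. exp (- (1 / \<tau>\<^sup>2) * aligned \<sigma> 0 (A \<omega>) (min i j, max i j))))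
          = (\<Prod>j<n. exp (- (1 / \<tau>\<^sup>2) + (- (1 / \<tau>\<^sup>2))\<^sup>2 * \<tau>\<^sup>2 / 2))"
        using mgf pair_in_upper_pairs[OF that] by (intro prod.cong refl) blast
      also have "- (1 / \<tau>\<^sup>2) + (- (1 / \<tau>\<^sup>2))\<^sup>2 * \<tau>\<^sup>2 / 2 = - z2_rate \<tau>"
        using \<tau> by (simp add: z2_rate_def field_simps power2_eq_square)
      finally show ?thesis by (simp add: exp_of_nat_mult[symmetric])
    qed
    show "1 / \<tau>\<^sup>2 * (32 * \<tau> * sqrt (real n)) \<le> 32 * sqrt 2 * sqrt (real n * z2_rate \<tau>)"
    proof -
      have "sqrt 2 * sqrt (real n * z2_rate \<tau>) = sqrt (real n) / \<tau>"
      proof -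
        have "2 * (real n * z2_rate \<tau>) = real n / \<tau>\<^sup>2" using \<tau> by (simp add: z2_rate_def field_simps)
        then show ?thesis using \<tau> by (simp only: real_sqrt_mult[symmetric]) (simp add: real_sqrt_divide)
      qed
      then show ?thesis using \<tau> by (simp add: power2_eq_square field_simps)
    qed
  qed simp
qed

section \<open>Three-valued entries: the censored block model\<close>

text \<open>Point masses that add up to 1 confine \<open>X\<close> to \<open>V\<close> almost
  surely, where \<open>f X\<close> is a simple function. This turns the point probabilities of the
  censored model into expectations.\<close>

lemma (in prob_space)
  fixes X :: "'a \<Rightarrow> real"
  assumes X: "X \<in> borel_measurable M" and V: "finite V" "(\<Sum>v\<in>V. prob {\<omega> \<in> space M. X \<omega> = v}) = 1"
    and f: "f \<in> borel_measurable borel"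
  shows integrable_finitely_supported: "integrable M (\<lambda>\<omega>. f (X \<omega>) :: real)"
    and expectation_finitely_supported:
      "expectation (\<lambda>\<omega>. f (X \<omega>)) = (\<Sum>v\<in>V. f v * prob {\<omega> \<in> space M. X \<omega> = v})"
proof -
  let ?E = "\<lambda>v. {\<omega> \<in> space M. X \<omega> = v}"
  have E: "?E v \<in> events" for v using X by measurable
  have "prob (\<Union>v\<in>V. ?E v) = (\<Sum>v\<in>V. prob (?E v))"
    using V(1) E by (intro finite_measure_finite_Union) (auto simp: disjoint_family_on_def)
  then have "prob (\<Union>v\<in>V. ?E v) = 1" using V(2) by simp
  then have "AE \<omega> in M. \<omega> \<in> (\<Union>v\<in>V. ?E v)" using E V(1) by (subst (asm) prob_eq_1) auto
  then have ae: "AE \<omega> in M. f (X \<omega>) = (\<Sum>v\<in>V. f v * indicator (?E v) \<omega>)"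
  proof eventually_elim
    case (elim \<omega>)
    then have "X \<omega> \<in> V" "\<omega> \<in> space M" by auto
    then have "(\<Sum>v\<in>V. f v * indicator (?E v) \<omega>) = (\<Sum>v\<in>V. if v = X \<omega> then f v else 0)"
      by (intro sum.cong refl) (auto simp: indicator_def)
    then show ?case using V(1) \<open>X \<omega> \<in> V\<close> by simp
  qed
  have simple: "integrable M (\<lambda>\<omega>. \<Sum>v\<in>V. f v * indicator (?E v) \<omega>)"
    using E by (intro Bochner_Integration.integrable_sum integrable_mult_right integrable_real_indicator)
      (auto simp: emeasure_eq_measure)
  have fX: "(\<lambda>\<omega>. f (X \<omega>)) \<in> borel_measurable M" using f X by measurable
  show "integrable M (\<lambda>\<omega>. f (X \<omega>))"
    using simple ae fX by (subst integrable_cong_AE[OF _ _ ae]) auto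
  have "expectation (\<lambda>\<omega>. f (X \<omega>)) = expectation (\<lambda>\<omega>. \<Sum>v\<in>V. f v * indicator (?E v) \<omega>)"
    using simple ae fX by (intro integral_cong_AE) auto
  also have "\<dots> = (\<Sum>v\<in>V. expectation (\<lambda>\<omega>. f v * indicator (?E v) \<omega>))"
    using E by (intro Bochner_Integration.integral_sum integrable_mult_right integrable_real_indicator)
      (auto simp: emeasure_eq_measure)
  also have "\<dots> = (\<Sum>v\<in>V. f v * prob (?E v))"
    using E by (intro sum.cong refl) simp
  finally show "expectation (\<lambda>\<omega>. f (X \<omega>)) = (\<Sum>v\<in>V. f v * prob (?E v))" .
qed

lemma abs_power_le_square:
  fixes u :: real
  assumes "\<bar>u\<bar> \<le> 1" "2 \<le> k"
  shows "\<bar>u ^ k\<bar> \<le> u\<^sup>2"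
proof -
  have "\<bar>u\<bar> ^ k \<le> \<bar>u\<bar> ^ 2" using assms by (intro power_decreasing) auto
  then show ?thesis by (simp add: power_abs)
qed

lemma dot_app_scale: "dot n x (apply_mat n (sym_extend (\<lambda>e. c * f e)) x) = c * dot n x (apply_mat n (sym_extend f) x)"
  by (simp add: dot_app_eq sym_extend_def sum_distrib_left mult.assoc)

text \<open>The ratio of \<theta> s to the square root of n I*: the tilt, a factor 2 undoing the
  halving of the entries, the spectral constant for log n <= \<alpha> n, and the divisor from I* =
  \<alpha> (sqrt(1 - \<epsilon>) - sqrt(\<epsilon>))^2. It does not involve \<alpha>, so it is
  uniform in n.\<close>

definition cbm_const :: "real \<Rightarrow> real" where
  "cbm_const \<epsilon> = ln (sqrt (1 - \<epsilon>) / sqrt \<epsilon>) * 2 * sqrt (2 * walk_const * exp 2) / (sqrt (1 - \<epsilon>) - sqrt \<epsilon>)"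

lemma cbm_exact_recovery_probability:
  assumes model: "censored_block_model M n \<sigma> \<alpha> \<epsilon> A"
    and rate: "ln (real n) \<le> real n * cbm_rate \<alpha> \<epsilon>" "1 \<le> ln (real n)"
  shows "1 - 1 / real n - real n * exp (cbm_const \<epsilon> * sqrt (real n * cbm_rate \<alpha> \<epsilon>) - real n * cbm_rate \<alpha> \<epsilon>)
    \<le> measure M {\<omega> \<in> space M. exact_recovery (elliptope n) (truth_mat n \<sigma>) (A \<omega>)}"
proof -
  have label: "label_vector n \<sigma>" and A: "indep_symmetric_mat M n A"
    and \<alpha>: "0 < \<alpha>" "\<alpha> \<le> 1" and \<epsilon>: "0 < \<epsilon>" "\<epsilon> < 1/2"
    and dist: "\<And>i j. i \<le> j \<Longrightarrow> j < n \<Longrightarrow>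
        measure M {\<omega> \<in> space M. A \<omega> $$ (i, j) = \<sigma> i * \<sigma> j} = \<alpha> * (1 - \<epsilon>) \<and>
        measure M {\<omega> \<in> space M. A \<omega> $$ (i, j) = - (\<sigma> i * \<sigma> j)} = \<alpha> * \<epsilon> \<and>
        measure M {\<omega> \<in> space M. A \<omega> $$ (i, j) = 0} = 1 - \<alpha>"
    using model by (auto simp: censored_block_model_def)
  interpret prob_space M using A by (simp add: indep_symmetric_mat_def)
  have n: "0 < n" using rate(2) by (cases "n = 0") auto
  define a b where "a = sqrt (1 - \<epsilon>)" and "b = sqrt \<epsilon>"
  have ab: "0 < b" "b < a" "a * a = 1 - \<epsilon>" "b * b = \<epsilon>"
    using \<epsilon> by (simp_all add: a_def b_def)
  have I: "cbm_rate \<alpha> \<epsilon> = \<alpha> * (a - b)\<^sup>2"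
    using \<alpha> by (simp add: cbm_rate_def a_def b_def real_sqrt_mult right_diff_distrib[symmetric] power_mult_distrib)
  have "(a - b)\<^sup>2 \<le> a * a + b * b"
    using ab by (simp add: power2_eq_square algebra_simps)
  then have ab1: "(a - b)\<^sup>2 \<le> 1" using ab by simp
  \<comment> \<open>This converts the rate hypothesis into the density \<alpha> n >= log n that the
    spectral bound requires.\<close>
  have I_le: "cbm_rate \<alpha> \<epsilon> \<le> \<alpha>" unfolding I using ab1 \<alpha> by (simp add: mult_left_le)
  have "real n * cbm_rate \<alpha> \<epsilon> \<le> real n * \<alpha>" using I_le by (intro mult_left_mono) auto
  then have \<alpha>n: "1 * ln (real n) \<le> \<alpha> * real n" "1 \<le> \<alpha> * real n" using rate by (simp_all add: mult.commute)
  have entry_law: "integrable M (\<lambda>\<omega>. h (aligned \<sigma> 0 (A \<omega>) e)) \<and>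
      expectation (\<lambda>\<omega>. h (aligned \<sigma> 0 (A \<omega>) e)) = \<alpha> * (1 - \<epsilon>) * h 1 + \<alpha> * \<epsilon> * h (-1) + (1 - \<alpha>) * h 0"
    if e: "e \<in> upper_pairs n" and h: "h \<in> borel_measurable borel" for h :: "real \<Rightarrow> real" and e
  proof -
    define m where "m = \<sigma> (fst e) * \<sigma> (snd e)"
    have m: "m = 1 \<or> m = -1" using label_product[OF label e] by (auto simp: m_def)
    have d: "prob {\<omega> \<in> space M. A \<omega> $$ e = m} = \<alpha> * (1 - \<epsilon>)" "prob {\<omega> \<in> space M. A \<omega> $$ e = - m} = \<alpha> * \<epsilon>"
      "prob {\<omega> \<in> space M. A \<omega> $$ e = 0} = 1 - \<alpha>"
      using dist[of "fst e" "snd e"] e by (auto simp: m_def upper_pairs_def)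
    have rv: "(\<lambda>\<omega>. A \<omega> $$ e) \<in> borel_measurable M"
      using A e by (cases e) (auto simp: indep_symmetric_mat_def indep_vars_def upper_pairs_def)
    have hm: "(\<lambda>x. h (m * x)) \<in> borel_measurable borel" using h by measurable
    have distinct: "m \<noteq> - m" "m \<noteq> 0" "- m \<noteq> 0" using m by auto
    have one: "(\<Sum>v\<in>{m, - m, 0}. prob {\<omega> \<in> space M. A \<omega> $$ e = v}) = 1"
      using distinct by (simp add: d algebra_simps)
    have "aligned \<sigma> 0 (A \<omega>) e = m * A \<omega> $$ e" for \<omega> by (simp add: aligned_def m_def)
    moreover have "(\<Sum>v\<in>{m, - m, 0}. h (m * v) * prob {\<omega> \<in> space M. A \<omega> $$ e = v})
        = \<alpha> * (1 - \<epsilon>) * h 1 + \<alpha> * \<epsilon> * h (-1) + (1 - \<alpha>) * h 0"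
      using distinct m by (auto simp: d)
    ultimately show ?thesis
      using integrable_finitely_supported[OF rv _ one hm] expectation_finitely_supported[OF rv _ one hm] by simp
  qed
  define \<mu> where "\<mu> = \<alpha> * (1 - 2 * \<epsilon>)"
  have \<mu>: "0 \<le> \<mu>" "\<mu> \<le> 1"
    using \<alpha> \<epsilon> mult_mono[of \<alpha> 1 "1 - 2 * \<epsilon>" 1] by (auto simp: \<mu>_def)
  \<comment> \<open>Centred entries can be as large as 2 in absolute value; halving makes them at
    most 1, so that higher moments are controlled by the variance.\<close>
  define X where "X e \<omega> = 1/2 * (aligned \<sigma> 0 (A \<omega>) e - \<mu>)" for e \<omega>
  have ind: "indep_vars (\<lambda>_. borel) X (upper_pairs n)"
    using indep_vars_aligned[OF A, of "\<lambda>a. 1/2 * (a - \<mu>)" \<sigma> 0] by (simp add: X_def[abs_def])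
  have moments: "integrable M (\<lambda>\<omega>. X e \<omega> ^ k) \<and> expectation (\<lambda>\<omega>. X e \<omega> ^ k) =
      \<alpha> * (1 - \<epsilon>) * (1/2 * (1 - \<mu>)) ^ k + \<alpha> * \<epsilon> * (1/2 * (- 1 - \<mu>)) ^ k + (1 - \<alpha>) * (1/2 * (0 - \<mu>)) ^ k"
    if "e \<in> upper_pairs n" for e k
    unfolding X_def using entry_law[OF that, of "\<lambda>a. (1/2 * (a - \<mu>)) ^ k"] by simp
  have mean: "expectation (X e) = 0" if "e \<in> upper_pairs n" for e
  proof -
    have "\<alpha> * (1 - \<epsilon>) * (1/2 * (1 - \<mu>)) + \<alpha> * \<epsilon> * (1/2 * (- 1 - \<mu>)) + (1 - \<alpha>) * (1/2 * (0 - \<mu>)) = 0"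
      by (simp add: \<mu>_def field_simps)
    then show ?thesis using moments[OF that, of 1] by (simp only: power_one_right)
  qed
  have moment: "\<bar>expectation (\<lambda>\<omega>. X e \<omega> ^ k)\<bar> \<le> \<alpha>" if "e \<in> upper_pairs n" "2 \<le> k" for e k
  proof -
    have "\<bar>expectation (\<lambda>\<omega>. X e \<omega> ^ k)\<bar> \<le> \<alpha> * (1 - \<epsilon>) * \<bar>(1/2 * (1 - \<mu>)) ^ k\<bar>
        + \<alpha> * \<epsilon> * \<bar>(1/2 * (- 1 - \<mu>)) ^ k\<bar> + (1 - \<alpha>) * \<bar>(1/2 * (0 - \<mu>)) ^ k\<bar>"
    proof -
      have tri: "\<bar>c1 * u + c2 * v + c3 * w\<bar> \<le> c1 * \<bar>u\<bar> + c2 * \<bar>v\<bar> + c3 * \<bar>w\<bar>"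
        if "0 \<le> c1" "0 \<le> c2" "0 \<le> c3" for c1 c2 c3 u v w :: real
      proof -
        have "\<bar>c1 * u\<bar> = c1 * \<bar>u\<bar>" "\<bar>c2 * v\<bar> = c2 * \<bar>v\<bar>" "\<bar>c3 * w\<bar> = c3 * \<bar>w\<bar>"
          using that by (simp_all add: abs_mult)
        then show ?thesis by linarith
      qed
      show ?thesis
        unfolding conjunct2[OF moments[OF that(1)]] by (rule tri) (use \<alpha> \<epsilon> in auto)
    qed
    also have "\<dots> \<le> \<alpha> * (1 - \<epsilon>) * (1/2 * (1 - \<mu>))\<^sup>2 + \<alpha> * \<epsilon> * (1/2 * (- 1 - \<mu>))\<^sup>2 + (1 - \<alpha>) * (1/2 * (0 - \<mu>))\<^sup>2"
      using \<mu> \<alpha> \<epsilon> that(2) by (intro add_mono mult_left_mono abs_power_le_square) auto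
    also have "\<dots> = (\<alpha> - \<mu>\<^sup>2) / 4"
      by (simp add: \<mu>_def power2_eq_square field_simps)
    also have "\<dots> \<le> \<alpha>" using \<alpha> zero_le_power2[of \<mu>] by (simp add: field_simps)
    finally show ?thesis .
  qed
  define s where "s = 2 * sqrt (2 * walk_const * exp (2 / 1) * (\<alpha> * real n))"
  obtain F where F: "F \<in> events" "prob F \<le> 1 / real n" "\<And>\<omega> x. \<omega> \<in> space M - F \<Longrightarrow>
      dot n x (apply_mat n (sym_extend (\<lambda>e. X e \<omega>)) x) \<le> sqrt (2 * walk_const * exp (2 / 1) * (\<alpha> * real n)) * dot n x x"
    using sparse_quadratic_form_bound[OF ind _ mean moment \<alpha> \<alpha>n(2,1) _ n] moments by auto
  have "dot n x (apply_mat n (sym_extend (\<lambda>e. aligned \<sigma> 0 (A \<omega>) e - \<mu>)) x) \<le> s * dot n x x"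
    if "\<omega> \<in> space M - F" for \<omega> x
    using F(3)[OF that, of x] unfolding X_def dot_app_scale by (simp add: s_def)
  then have W: "\<exists>F\<in>events. prob F \<le> 1 / real n \<and> (\<forall>\<omega>\<in>space M - F. \<forall>x.
      dot n x (apply_mat n (sym_extend (\<lambda>e. aligned \<sigma> 0 (A \<omega>) e - \<mu>)) x) \<le> s * dot n x x)"
    using F by blast
  \<comment> \<open>The optimal tilt: it balances \<alpha> a^2 exp(-\<theta>) against \<alpha> b^2
    exp(\<theta>), so both equal \<alpha> a b and the moment generating function is 1 - I*.\<close>
  define \<theta> where "\<theta> = ln (a / b)"
  have \<theta>: "0 < \<theta>" "exp \<theta> = a / b" "exp (- \<theta>) = b / a"
    using ab by (simp_all add: \<theta>_def exp_minus ln_gt_zero)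
  show ?thesis
  proof (rule exact_recovery_probability[OF A label order_refl truth_mat_in_elliptope[OF label]
        compact_mat_fun_elliptope _ W \<theta>(1)])
    show "integrable M (\<lambda>\<omega>. exp (- \<theta> * aligned \<sigma> 0 (A \<omega>) e))" if "e \<in> upper_pairs n" for e
      using entry_law[OF that, of "\<lambda>x. exp (- \<theta> * x)"] by simp
    show "(\<Prod>j<n. expectation (\<lambda>\<omega>. exp (- \<theta> * aligned \<sigma> 0 (A \<omega>) (min i j, max i j))))
        \<le> exp (- (real n * cbm_rate \<alpha> \<epsilon>))" if "i < n" for i
    proof -
      have "(\<Prod>j<n. expectation (\<lambda>\<omega>. exp (- \<theta> * aligned \<sigma> 0 (A \<omega>) (min i j, max i j))))
          = (\<Prod>j<n. 1 - cbm_rate \<alpha> \<epsilon>)"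
      proof (intro prod.cong refl)
        fix j assume "j \<in> {..<n}"
        then have "expectation (\<lambda>\<omega>. exp (- \<theta> * aligned \<sigma> 0 (A \<omega>) (min i j, max i j)))
            = \<alpha> * (a * a) * exp (- \<theta>) + \<alpha> * (b * b) * exp \<theta> + (1 - \<alpha>)"
          using entry_law[OF pair_in_upper_pairs[OF that], of j "\<lambda>x. exp (- \<theta> * x)"] ab by simp
        also have "\<dots> = 1 - \<alpha> * (a * a + b * b - 2 * (a * b)) + \<alpha> * ((a * a + b * b) - 1)"
          unfolding \<theta> using ab(1,2) by (simp add: field_simps)
        also have "\<dots> = 1 - cbm_rate \<alpha> \<epsilon>"
          unfolding I using ab by (simp add: power2_eq_square algebra_simps)
        finally show "expectation (\<lambda>\<omega>. exp (- \<theta> * aligned \<sigma> 0 (A \<omega>) (min i j, max i j))) = 1 - cbm_rate \<alpha> \<epsilon>" .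
      qed
      also have "\<dots> = (1 - cbm_rate \<alpha> \<epsilon>) ^ n" by simp
      also have "\<dots> \<le> exp (- cbm_rate \<alpha> \<epsilon>) ^ n"
        using I_le \<alpha> exp_ge_add_one_self[of "- cbm_rate \<alpha> \<epsilon>"] by (intro power_mono) auto
      finally show ?thesis by (simp add: exp_of_nat_mult[symmetric])
    qed
    have "sqrt (real n * cbm_rate \<alpha> \<epsilon>) = sqrt (\<alpha> * real n) * (a - b)"
      unfolding I using ab by (simp add: real_sqrt_mult mult_ac)
    moreover have "s = 2 * sqrt (2 * walk_const * exp 2) * sqrt (\<alpha> * real n)"
      by (simp add: s_def real_sqrt_mult)
    ultimately show "\<theta> * s \<le> cbm_const \<epsilon> * sqrt (real n * cbm_rate \<alpha> \<epsilon>)"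
      using ab by (simp add: cbm_const_def \<theta>_def a_def[symmetric] b_def[symmetric])
  qed simp
qed

section \<open>The stochastic block model\<close>

text \<open>Multiplying the balance condition by \<open>\<sigma> i\<close> shows that each row has
  as many agreeing as disagreeing positions. The diagonal position counts as agreeing, so both
  numbers are exactly n/2.\<close>

lemma balanced_label_agreement_count:
  assumes "label_vector n \<sigma>" "(\<Sum>j<n. \<sigma> j) = 0" "i < n"
  shows "\<exists>c. n = 2 * c \<and> card ({..<n} \<inter> {j. \<sigma> i * \<sigma> j = 1}) = c
    \<and> card ({..<n} \<inter> - {j. \<sigma> i * \<sigma> j = 1}) = c"
proof -
  let ?P = "{..<n} \<inter> {j. \<sigma> i * \<sigma> j = 1}" and ?N = "{..<n} \<inter> - {j. \<sigma> i * \<sigma> j = 1}"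
  have pm: "\<sigma> i * \<sigma> j = 1 \<or> \<sigma> i * \<sigma> j = -1" if "j < n" for j
  proof -
    have "\<sigma> i \<in> {-1, 1}" "\<sigma> j \<in> {-1, 1}" using assms(1,3) that by (auto simp: label_vector_def)
    then show ?thesis by auto
  qed
  have "0 = \<sigma> i * (\<Sum>j<n. \<sigma> j)" by (simp add: assms(2))
  also have "\<dots> = (\<Sum>j<n. if \<sigma> i * \<sigma> j = 1 then 1 else -1)"
    unfolding sum_distrib_left by (intro sum.cong refl) (use pm in auto)
  also have "\<dots> = real (card ?P) - real (card ?N)"
    by (subst sum.If_cases) (auto simp: Int_def)
  finally have eq: "card ?P = card ?N" by simp
  have "{..<n} = ?P \<union> ?N" by blast
  then have "n = card ?P + card ?N"
    by (metis (no_types, lifting) card_Un_disjoint card_lessThan disjoint_iff finite_Int finite_lessThan IntE ComplD)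
  then show ?thesis using eq by (intro exI[of _ "card ?P"]) simp
qed

lemma exp_neg_half_sbm_rate:
  assumes "0 < q" "q < p" "p < 1"
  shows "exp (- (sbm_rate p q / 2)) = sqrt (p * q) + sqrt ((1 - p) * (1 - q))"
proof -
  have "0 < sqrt (p * q) + sqrt ((1 - p) * (1 - q))"
    using assms by (intro add_pos_pos) auto
  then show ?thesis by (simp add: sbm_rate_def)
qed

text \<open>exp(-I*/2) is the Hellinger affinity of the two Bernoulli laws. Bounding its second term
  by the arithmetic mean leaves 1 - (sqrt p - sqrt q)^2 / 2.\<close>

lemma sbm_rate_ge:
  assumes "0 < q" "q < p" "p < 1"
  shows "(sqrt p - sqrt q)\<^sup>2 \<le> sbm_rate p q"
proof -
  have "(sqrt (1 - p) - sqrt (1 - q))\<^sup>2 \<ge> 0" by simp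
  then have "2 * sqrt ((1 - p) * (1 - q)) \<le> (1 - p) + (1 - q)"
    using assms by (simp add: power2_diff real_sqrt_mult)
  moreover have "(sqrt p - sqrt q)\<^sup>2 = p + q - 2 * sqrt (p * q)"
    using assms by (simp add: power2_diff real_sqrt_mult)
  ultimately have "sqrt (p * q) + sqrt ((1 - p) * (1 - q)) \<le> 1 + - ((sqrt p - sqrt q)\<^sup>2 / 2)"
    by (simp add: field_simps)
  also have "\<dots> \<le> exp (- ((sqrt p - sqrt q)\<^sup>2 / 2))" by (rule exp_ge_add_one_self)
  finally show ?thesis unfolding exp_neg_half_sbm_rate[OF assms, symmetric] by simp
qed

text \<open>Keeping only the second term of the affinity, which is at least 1 - p, bounds the rate
  by a multiple of \<open>p\<close> when p <= 1 - c1. This turns the rate hypothesis into p n >= c1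
  log n, the density needed for the trace bound.\<close>

lemma sbm_rate_le:
  assumes "0 < q" "q < p" "p < 1"
  shows "sbm_rate p q / 2 \<le> p / (1 - p)"
proof -
  have "(1 - p) * (1 - p) \<le> (1 - p) * (1 - q)" using assms by (intro mult_left_mono) auto
  then have "1 - p \<le> sqrt ((1 - p) * (1 - q))" by (intro real_le_rsqrt) (simp add: power2_eq_square)
  also have "\<dots> \<le> exp (- (sbm_rate p q / 2))"
    unfolding exp_neg_half_sbm_rate[OF assms] using assms by simp
  finally have "exp (sbm_rate p q / 2) \<le> 1 / (1 - p)"
    using assms by (simp add: exp_minus field_simps)
  then have "1 + sbm_rate p q / 2 \<le> 1 / (1 - p)"
    using exp_ge_add_one_self[of "sbm_rate p q / 2"] by linarith
  also have "1 / (1 - p) = 1 + p / (1 - p)" using assms by (simp add: field_simps)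
  finally show ?thesis by simp
qed

text \<open>Half the logarithm of the odds ratio of \<open>p\<close> and \<open>q\<close>. It
  minimises (p e^(-\<theta>) + 1 - p)(q e^\<theta> + 1 - q), the moment generating function of one
  agreeing and one disagreeing entry together, by balancing the two terms that depend on
  \<theta>.\<close>

definition sbm_tilt :: "real \<Rightarrow> real \<Rightarrow> real" where
  "sbm_tilt p q = ln (sqrt (p * (1 - q)) / sqrt (q * (1 - p)))"

lemma sbm_tilt_pos:
  assumes "0 < q" "q < p" "p < 1"
  shows "0 < sbm_tilt p q"
proof -
  have "q * (1 - p) < p * (1 - q)" using assms by (simp add: algebra_simps)
  moreover have "0 < q * (1 - p)" using assms by simp
  ultimately have "1 < sqrt (p * (1 - q)) / sqrt (q * (1 - p))" by simp
  then show ?thesis unfolding sbm_tilt_def by (rule ln_gt_zero)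
qed

lemma sbm_tilt_mgf:
  assumes "0 < q" "q < p" "p < 1"
  shows "(p * exp (- sbm_tilt p q) + (1 - p)) * (q * exp (sbm_tilt p q) + (1 - q)) = exp (- sbm_rate p q)"
proof -
  define a b c d where "a = sqrt p" and "b = sqrt q" and "c = sqrt (1 - p)" and "d = sqrt (1 - q)"
  have pos: "0 < a" "0 < b" "0 < c" "0 < d" using assms by (simp_all add: a_def b_def c_def d_def)
  have sq: "p = a * a" "q = b * b" "1 - p = c * c" "1 - q = d * d"
    using assms by (simp_all add: a_def b_def c_def d_def)
  have E: "sbm_tilt p q = ln ((a * d) / (b * c))"
    by (simp add: sbm_tilt_def a_def b_def c_def d_def real_sqrt_mult)
  have e: "exp (sbm_tilt p q) = (a * d) / (b * c)" "exp (- sbm_tilt p q) = (b * c) / (a * d)"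
    unfolding E exp_minus using pos by simp_all
  have "exp (- sbm_rate p q) = (exp (- (sbm_rate p q / 2)))\<^sup>2" by (simp add: power2_eq_square exp_add[symmetric])
  also have "\<dots> = (a * b + c * d)\<^sup>2"
    unfolding exp_neg_half_sbm_rate[OF assms] by (simp add: a_def b_def c_def d_def real_sqrt_mult)
  also have "\<dots> = (a * a * ((b * c) / (a * d)) + c * c) * (b * b * ((a * d) / (b * c)) + d * d)"
    using pos by (simp add: field_simps power2_eq_square)
  finally show ?thesis unfolding sq[symmetric] e by (rule sym)
qed

text \<open>Here \<open>q\<close> comparable to \<open>p\<close> and \<open>p\<close> bounded away
  from 1 enter: ln(x/y) <= (x - y)/y bounds the tilt by (1/c0 + 1/c1)(p - q)/(2p). Times
  \<open>sqrt p\<close>, the quotient is at most sqrt p - sqrt q, hence at most the square root of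
  the rate.\<close>

lemma sbm_tilt_le:
  assumes "0 < c0" "0 < c1" "c0 * p \<le> q" "0 < q" "q < p" "p \<le> 1 - c1" "p < 1"
  shows "sbm_tilt p q * sqrt p \<le> (1 / c0 + 1 / c1) * sqrt (sbm_rate p q)"
proof -
  have ln_le: "ln (x / y) \<le> (x - y) / y" if "0 < x" "0 < y" for x y :: real
    using ln_le_minus_one[of "x / y"] that by (simp add: diff_divide_distrib)
  have "sqrt (p * (1 - q)) / sqrt (q * (1 - p)) = sqrt ((p / q) * ((1 - q) / (1 - p)))"
    by (simp add: real_sqrt_divide)
  then have "sbm_tilt p q = ln (sqrt ((p / q) * ((1 - q) / (1 - p))))"
    unfolding sbm_tilt_def by (rule arg_cong)
  also have "\<dots> = ln ((p / q) * ((1 - q) / (1 - p))) / 2"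
    using assms by (intro ln_sqrt mult_pos_pos) auto
  also have "\<dots> = (ln (p / q) + ln ((1 - q) / (1 - p))) / 2"
    using assms by (subst ln_mult_pos) auto
  also have "\<dots> \<le> ((p - q) / q + ((1 - q) - (1 - p)) / (1 - p)) / 2"
    using assms by (intro divide_right_mono add_mono ln_le) auto
  also have "\<dots> \<le> ((p - q) / (c0 * p) + (p - q) / (c1 * p)) / 2"
  proof (intro divide_right_mono add_mono)
    show "(p - q) / q \<le> (p - q) / (c0 * p)" using assms by (intro divide_left_mono) auto
    have "c1 * p \<le> 1 - p" using assms mult_left_le[of p c1] by linarith
    then show "((1 - q) - (1 - p)) / (1 - p) \<le> (p - q) / (c1 * p)"
      using assms by (simp add: frac_le)
  qed simp
  also have "\<dots> = (1 / c0 + 1 / c1) * ((p - q) / (2 * p))"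
    using assms by (simp add: field_simps)
  finally have "sbm_tilt p q * sqrt p \<le> (1 / c0 + 1 / c1) * ((p - q) / (2 * p)) * sqrt p"
    using assms by (intro mult_right_mono) auto
  also have "\<dots> \<le> (1 / c0 + 1 / c1) * sqrt (sbm_rate p q)"
    unfolding mult.assoc
  proof (rule mult_left_mono)
    define a b where "a = sqrt p" and "b = sqrt q"
    have ab: "0 < b" "b < a" "a * a = p" "b * b = q" using assms by (simp_all add: a_def b_def)
    have "(p - q) / (2 * p) * sqrt p = (a - b) * (a + b) / (2 * a)"
      unfolding a_def[symmetric] ab(3,4)[symmetric] using ab(1,2) by (simp add: field_simps)
    also have "\<dots> \<le> (a - b) * (2 * a) / (2 * a)"
      using ab by (intro divide_right_mono mult_left_mono) auto
    also have "\<dots> = a - b" using ab by simp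
    also have "\<dots> \<le> sqrt (sbm_rate p q)"
      unfolding a_def b_def using sbm_rate_ge[of q p] assms by (intro real_le_rsqrt) auto
    finally show "(p - q) / (2 * p) * sqrt p \<le> sqrt (sbm_rate p q)" .
  qed (use assms in auto)
  finally show ?thesis .
qed

text \<open>The constant of the tilt bound times the spectral constant for p n >= c1 log n;
  \<open>sqrt 2\<close> accounts for nbar = n/2.\<close>

definition sbm_const :: "real \<Rightarrow> real \<Rightarrow> real" where
  "sbm_const c0 c1 = (1 / c0 + 1 / c1) * sqrt (2 * walk_const * exp (2 / c1)) * sqrt 2"

lemma sbm_exact_recovery_probability:
  assumes model: "stochastic_block_model M n \<sigma> p q A"
    and c: "0 < c0" "0 < c1" "c0 * p \<le> q" "p \<le> 1 - c1"
    and rate: "ln (real n) \<le> real n / 2 * sbm_rate p q" "1 \<le> c1 * ln (real n)"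
  shows "1 - 1 / real n - real n * exp (sbm_const c0 c1 * sqrt (real n / 2 * sbm_rate p q) - real n / 2 * sbm_rate p q)
    \<le> measure M {\<omega> \<in> space M. exact_recovery (balanced_elliptope n) (truth_mat n \<sigma>) (A \<omega>)}"
proof -
  have label: "label_vector n \<sigma>" and bal: "(\<Sum>i<n. \<sigma> i) = 0" and A: "indep_symmetric_mat M n A"
    and pq: "0 < q" "q < p" "p < 1"
    and dist: "\<And>i j. i \<le> j \<Longrightarrow> j < n \<Longrightarrow> distr M borel (\<lambda>\<omega>. A \<omega> $$ (i, j)) =
        distr (measure_pmf (bernoulli_pmf (if \<sigma> i * \<sigma> j = 1 then p else q))) borel (of_bool :: bool \<Rightarrow> real)"
    using model by (auto simp: stochastic_block_model_def)
  interpret prob_space M using A by (simp add: indep_symmetric_mat_def)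
  have n: "0 < n" using rate(2) by (cases "n = 0") auto
  define I where "I = sbm_rate p q"
  have pn: "c1 * ln (real n) \<le> p * real n"
  proof -
    have "I / 2 \<le> p / (1 - p)" unfolding I_def by (rule sbm_rate_le[OF pq])
    also have "\<dots> \<le> p / c1" using c pq by (intro divide_left_mono) auto
    finally have "real n * (I / 2) \<le> real n * (p / c1)" by (intro mult_left_mono) auto
    moreover have "ln (real n) \<le> real n * (I / 2)" using rate(1) by (simp add: I_def)
    ultimately have "ln (real n) \<le> real n * (p / c1)" by linarith
    then show ?thesis using c by (simp add: field_simps)
  qed
  then have pn1: "1 \<le> p * real n" using rate(2) by linarith
  \<comment> \<open>Centring at the midpoint gives agreeing and disagreeing pairs the same mean
    after alignment, since p - \<rho> = \<rho> - q = \<mu>.\<close>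
  define \<rho> \<mu> where "\<rho> = (p + q) / 2" and "\<mu> = (p - q) / 2"
  have law: "integrable M (\<lambda>\<omega>. h (aligned \<sigma> \<rho> (A \<omega>) e)) \<and>
      expectation (\<lambda>\<omega>. h (aligned \<sigma> \<rho> (A \<omega>) e)) =
        (if \<sigma> (fst e) * \<sigma> (snd e) = 1 then p * h (1 - \<rho>) + (1 - p) * h (- \<rho>)
         else q * h (\<rho> - 1) + (1 - q) * h \<rho>)"
    if e: "e \<in> upper_pairs n" and h: "h \<in> borel_measurable borel" for h :: "real \<Rightarrow> real" and e
  proof -
    define m where "m = \<sigma> (fst e) * \<sigma> (snd e)"
    have m: "m = 1 \<or> m = -1" using label_product[OF label e] by (auto simp: m_def)
    define r where "r = (if m = 1 then p else q)"
    have r: "0 \<le> r" "r \<le> 1" using pq by (auto simp: r_def)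
    define f where "f a = h (m * (a - \<rho>))" for a
    have f: "f \<in> borel_measurable borel" unfolding f_def using h by measurable
    have d: "distr M borel (\<lambda>\<omega>. A \<omega> $$ e) = distr (measure_pmf (bernoulli_pmf r)) borel (of_bool :: bool \<Rightarrow> real)"
      using dist[of "fst e" "snd e"] e by (auto simp: m_def r_def upper_pairs_def)
    have rv: "(\<lambda>\<omega>. A \<omega> $$ e) \<in> borel_measurable M"
      using A e by (cases e) (auto simp: indep_symmetric_mat_def indep_vars_def upper_pairs_def)
    have "integrable (distr M borel (\<lambda>\<omega>. A \<omega> $$ e)) f"
      unfolding d using f by (subst integrable_distr_eq) (auto intro: integrable_measure_pmf_finite)
    then have int: "integrable M (\<lambda>\<omega>. f (A \<omega> $$ e))"
      using f rv by (subst (asm) integrable_distr_eq) auto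
    have "expectation (\<lambda>\<omega>. f (A \<omega> $$ e)) = integral\<^sup>L (distr M borel (\<lambda>\<omega>. A \<omega> $$ e)) f"
      using f rv by (subst integral_distr) auto
    also have "\<dots> = r * f 1 + (1 - r) * f 0"
      unfolding d using f r by (subst integral_distr) auto
    finally have ex: "expectation (\<lambda>\<omega>. f (A \<omega> $$ e)) = r * f 1 + (1 - r) * f 0" .
    have al: "h (aligned \<sigma> \<rho> (A \<omega>) e) = f (A \<omega> $$ e)" for \<omega> by (simp add: f_def aligned_def m_def)
    show ?thesis
      unfolding al m_def[symmetric] using int ex m by (auto simp: r_def f_def)
  qed
  define X where "X e \<omega> = aligned \<sigma> \<rho> (A \<omega>) e - \<mu>" for e \<omega>
  have ind: "indep_vars (\<lambda>_. borel) X (upper_pairs n)"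
    using indep_vars_aligned[OF A, of "\<lambda>a. a - \<mu>" \<sigma> \<rho>] by (simp add: X_def[abs_def])
  have moments: "integrable M (\<lambda>\<omega>. X e \<omega> ^ k) \<and> expectation (\<lambda>\<omega>. X e \<omega> ^ k) =
      (if \<sigma> (fst e) * \<sigma> (snd e) = 1 then p * (1 - p) ^ k + (1 - p) * (- p) ^ k
       else q * (q - 1) ^ k + (1 - q) * q ^ k)"
    if "e \<in> upper_pairs n" for e k
  proof -
    have shift: "1 - \<rho> - \<mu> = 1 - p" "- \<rho> - \<mu> = - p" "\<rho> - 1 - \<mu> = q - 1" "\<rho> - \<mu> = q"
      by (simp_all add: \<rho>_def \<mu>_def field_simps)
    have "(\<lambda>a. (a - \<mu>) ^ k) \<in> borel_measurable borel" by measurable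
    from law[OF that this] show ?thesis unfolding X_def by (simp only: shift)
  qed
  have mean: "expectation (X e) = 0" if "e \<in> upper_pairs n" for e
  proof -
    have "p * (1 - p) + (1 - p) * (- p) = 0" "q * (q - 1) + (1 - q) * q = 0" by (simp_all add: algebra_simps)
    then show ?thesis using moments[OF that, of 1] by (simp only: power_one_right if_cancel)
  qed
  have moment: "\<bar>expectation (\<lambda>\<omega>. X e \<omega> ^ k)\<bar> \<le> p" if "e \<in> upper_pairs n" "2 \<le> k" for e k
  proof -
    \<comment> \<open>Fixing only the squares of \<open>u\<close> and \<open>v\<close> covers both
      sign patterns, that of agreeing pairs with \<open>r = p\<close> and that of disagreeing pairs
      with \<open>r = q\<close>. The intermediate bound r (1 - r) is the Bernoulli variance.\<close>
    have var: "\<bar>r * u ^ k + (1 - r) * v ^ k\<bar> \<le> r"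
      if "0 < r" "r < 1" "u\<^sup>2 = (1 - r)\<^sup>2" "v\<^sup>2 = r\<^sup>2" "\<bar>u\<bar> \<le> 1" "\<bar>v\<bar> \<le> 1" for r u v :: real
    proof -
      have "\<bar>r * u ^ k + (1 - r) * v ^ k\<bar> \<le> r * \<bar>u ^ k\<bar> + (1 - r) * \<bar>v ^ k\<bar>"
        using abs_triangle_ineq[of "r * u ^ k" "(1 - r) * v ^ k"] that by (simp add: abs_mult)
      also have "\<dots> \<le> r * (1 - r)\<^sup>2 + (1 - r) * r\<^sup>2"
        using abs_power_le_square[OF that(5) \<open>2 \<le> k\<close>] abs_power_le_square[OF that(6) \<open>2 \<le> k\<close>] that(1-4)
        by (intro add_mono mult_left_mono) auto
      also have "\<dots> = r * (1 - r)" by (simp add: power2_eq_square algebra_simps)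
      also have "\<dots> \<le> r" using that by (simp add: mult_left_le)
      finally show ?thesis .
    qed
    have "\<bar>p * (1 - p) ^ k + (1 - p) * (- p) ^ k\<bar> \<le> p" using pq by (intro var) auto
    moreover have "\<bar>q * (q - 1) ^ k + (1 - q) * q ^ k\<bar> \<le> q" using pq by (intro var) (auto simp: power2_commute)
    ultimately show ?thesis using moments[OF that(1), of k] pq by auto
  qed
  define s where "s = sqrt (2 * walk_const * exp (2 / c1) * (p * real n))"
  have W: "\<exists>F\<in>events. prob F \<le> 1 / real n \<and> (\<forall>\<omega>\<in>space M - F. \<forall>x.
      dot n x (apply_mat n (sym_extend (\<lambda>e. aligned \<sigma> \<rho> (A \<omega>) e - \<mu>)) x) \<le> s * dot n x x)"
    unfolding s_def X_def[symmetric]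
    by (rule sparse_quadratic_form_bound[OF ind _ mean moment]) (use moments pq pn pn1 c n in auto)
  have C: "balanced_elliptope n \<subseteq> elliptope n" by (auto simp: balanced_elliptope_def)
  define \<theta> where "\<theta> = sbm_tilt p q"
  have \<theta>: "0 < \<theta>" unfolding \<theta>_def by (rule sbm_tilt_pos[OF pq])
  show ?thesis
  proof (rule exact_recovery_probability[OF A label C truth_mat_in_balanced_elliptope[OF label bal]
        compact_mat_fun_balanced_elliptope _ W \<theta>])
    show "\<rho> * entry_sum Y = \<rho> * entry_sum (truth_mat n \<sigma>)" if "Y \<in> balanced_elliptope n" for Y
      using that truth_mat_in_balanced_elliptope[OF label bal] by (simp add: balanced_elliptope_def)
    show "integrable M (\<lambda>\<omega>. exp (- \<theta> * aligned \<sigma> \<rho> (A \<omega>) e))" if "e \<in> upper_pairs n" for e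
      using law[OF that, of "\<lambda>x. exp (- \<theta> * x)"] by simp
    show "(\<Prod>j<n. expectation (\<lambda>\<omega>. exp (- \<theta> * aligned \<sigma> \<rho> (A \<omega>) (min i j, max i j))))
        \<le> exp (- (real n / 2 * sbm_rate p q))" if "i < n" for i
    proof -
      note agreement = balanced_label_agreement_count[OF label bal that]
      obtain c where c: "n = 2 * c" "card ({..<n} \<inter> {j. \<sigma> i * \<sigma> j = 1}) = c"
        "card ({..<n} \<inter> - {j. \<sigma> i * \<sigma> j = 1}) = c"
        using agreement by blast
      \<comment> \<open>The recentring factors are inverse to each other and occur equally often, so
        the exponent is unaffected by \<open>\<rho>\<close>.\<close>
      define g1 g2 where "g1 = exp (\<theta> * \<rho>) * (p * exp (- \<theta>) + (1 - p))"
        and "g2 = exp (- (\<theta> * \<rho>)) * (q * exp \<theta> + (1 - q))"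
      have "(\<Prod>j<n. expectation (\<lambda>\<omega>. exp (- \<theta> * aligned \<sigma> \<rho> (A \<omega>) (min i j, max i j))))
          = (\<Prod>j<n. if \<sigma> i * \<sigma> j = 1 then g1 else g2)"
      proof (intro prod.cong refl)
        fix j assume "j \<in> {..<n}"
        then have e: "(min i j, max i j) \<in> upper_pairs n" using that pair_in_upper_pairs by simp
        have sym: "\<sigma> (min i j) * \<sigma> (max i j) = \<sigma> i * \<sigma> j" by (auto simp: min_def max_def)
        have "p * exp (- \<theta> * (1 - \<rho>)) + (1 - p) * exp (- \<theta> * (- \<rho>)) = g1"
          "q * exp (- \<theta> * (\<rho> - 1)) + (1 - q) * exp (- \<theta> * \<rho>) = g2"
          by (simp_all add: g1_def g2_def algebra_simps exp_add exp_diff exp_minus divide_inverse)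
        then show "expectation (\<lambda>\<omega>. exp (- \<theta> * aligned \<sigma> \<rho> (A \<omega>) (min i j, max i j)))
            = (if \<sigma> i * \<sigma> j = 1 then g1 else g2)"
          using law[OF e, of "\<lambda>x. exp (- \<theta> * x)"] by (simp add: sym)
      qed
      also have "\<dots> = g1 ^ c * g2 ^ c"
        by (subst prod.If_cases) (simp_all add: c(2,3))
      also have "\<dots> = (g1 * g2) ^ c" by (simp add: power_mult_distrib)
      also have "g1 * g2 = (p * exp (- \<theta>) + (1 - p)) * (q * exp \<theta> + (1 - q)) * (exp (\<theta> * \<rho>) * exp (- (\<theta> * \<rho>)))"
        by (simp only: g1_def g2_def mult_ac)
      also have "\<dots> = exp (- sbm_rate p q)"
        unfolding \<theta>_def sbm_tilt_mgf[OF pq] by (simp add: exp_add[symmetric])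
      also have "exp (- sbm_rate p q) ^ c = exp (- (real n / 2 * sbm_rate p q))"
        using c(1) by (simp add: exp_of_nat_mult[symmetric])
      finally show ?thesis by simp
    qed
    define L where "L = sqrt (2 * walk_const * exp (2 / c1))"
    have "\<theta> * s = L * (sbm_tilt p q * sqrt p) * sqrt (real n)"
      by (simp add: s_def L_def \<theta>_def real_sqrt_mult mult_ac)
    also have "\<dots> \<le> L * ((1 / c0 + 1 / c1) * sqrt I) * sqrt (real n)"
      unfolding I_def using c pq walk_const_pos
      by (intro mult_right_mono mult_left_mono sbm_tilt_le) (auto simp: L_def)
    also have "\<dots> = sbm_const c0 c1 * sqrt (real n / 2 * I)"
    proof -
      have "sqrt 2 * sqrt (real n / 2 * I) = sqrt (real n) * sqrt I"
        by (simp add: real_sqrt_mult[symmetric])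
      then show ?thesis by (simp add: sbm_const_def L_def mult_ac)
    qed
    finally show "\<theta> * s \<le> sbm_const c0 c1 * sqrt (real n / 2 * sbm_rate p q)" by (simp add: I_def)
  qed
qed

section \<open>The asymptotic statements\<close>

lemma ln_nat_eventually_ge: "\<forall>\<^sub>F n in sequentially. c \<le> ln (real n)"
proof -
  have "filterlim (\<lambda>n. ln (real n)) at_top sequentially" by real_asymp
  then show ?thesis by (simp add: filterlim_at_top)
qed

text \<open>Balanced labels force \<open>n\<close> to be even, so the block model limit is taken
  along even \<open>n\<close>. In each model the loss constant depends only on the fixed parameters,
  so a single \<open>K\<close> serves all \<open>n\<close> in the limit lemma.\<close>

theorem mainTheorem6:
  fixes c0 c1 \<delta> :: real
    and M :: "nat \<Rightarrow> 'w measure"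
    and A :: "nat \<Rightarrow> 'w \<Rightarrow> real mat"
    and \<sigma> :: "nat \<Rightarrow> nat \<Rightarrow> real"
  assumes "0 < c0" "c0 < 1" "0 < c1" "c1 < 1" "0 < \<delta>"
  shows
    "(\<forall>\<tau>.
        (\<forall>\<^sub>F n in sequentially.
           z2_synchronization (M n) n (\<sigma> n) (\<tau> n) (A n) \<and>
           (1 + \<delta>) * ln (real n) \<le> real n * z2_rate (\<tau> n)) \<longrightarrow>
        ((\<lambda>n. measure (M n) {\<omega> \<in> space (M n).
             exact_recovery (elliptope n) (truth_mat n (\<sigma> n)) (A n \<omega>)})
           \<longlongrightarrow> 1) sequentially) \<and>
     (\<forall>\<alpha> \<epsilon>.
        (\<forall>\<^sub>F n in sequentially.
           censored_block_model (M n) n (\<sigma> n) (\<alpha> n) \<epsilon> (A n) \<and>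
           (1 + \<delta>) * ln (real n) \<le> real n * cbm_rate (\<alpha> n) \<epsilon>) \<longrightarrow>
        ((\<lambda>n. measure (M n) {\<omega> \<in> space (M n).
             exact_recovery (elliptope n) (truth_mat n (\<sigma> n)) (A n \<omega>)})
           \<longlongrightarrow> 1) sequentially) \<and>
     (\<forall>p q.
        (\<forall>\<^sub>F n in inf sequentially (principal {n. even n}).
           stochastic_block_model (M n) n (\<sigma> n) (p n) (q n) (A n) \<and>
           0 < c0 * p n \<and> c0 * p n \<le> q n \<and> q n < p n \<and> p n \<le> 1 - c1 \<and>
           (1 + \<delta>) * ln (real n) \<le> real n / 2 * sbm_rate (p n) (q n)) \<longrightarrow>
        ((\<lambda>n. measure (M n) {\<omega> \<in> space (M n).
             exact_recovery (balanced_elliptope n) (truth_mat n (\<sigma> n)) (A n \<omega>)})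
           \<longlongrightarrow> 1) (inf sequentially (principal {n. even n})))"
proof (intro conjI allI impI)
  fix \<tau> :: "nat \<Rightarrow> real"
  assume model: "\<forall>\<^sub>F n in sequentially. z2_synchronization (M n) n (\<sigma> n) (\<tau> n) (A n) \<and>
    (1 + \<delta>) * ln (real n) \<le> real n * z2_rate (\<tau> n)"
  show "((\<lambda>n. measure (M n) {\<omega> \<in> space (M n).
      exact_recovery (elliptope n) (truth_mat n (\<sigma> n)) (A n \<omega>)}) \<longlongrightarrow> 1) sequentially"
  proof (rule tendsto_1_if_rate[OF order_refl \<open>0 < \<delta>\<close>])
    show "\<forall>\<^sub>F n in sequentially. (1 + \<delta>) * ln (real n) \<le> real n * z2_rate (\<tau> n)"
      using model by eventually_elim simp
    show "\<forall>\<^sub>F n in sequentially. 1 - 1 / real n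
        - real n * exp (32 * sqrt 2 * sqrt (real n * z2_rate (\<tau> n)) - real n * z2_rate (\<tau> n))
      \<le> measure (M n) {\<omega> \<in> space (M n). exact_recovery (elliptope n) (truth_mat n (\<sigma> n)) (A n \<omega>)}"
      using model eventually_gt_at_top[of 0]
      by eventually_elim (rule z2_exact_recovery_probability, auto)
    show "\<forall>\<^sub>F n in sequentially. measure (M n) {\<omega> \<in> space (M n).
        exact_recovery (elliptope n) (truth_mat n (\<sigma> n)) (A n \<omega>)} \<le> 1"
      using model
      by eventually_elim
        (auto simp: z2_synchronization_def indep_symmetric_mat_def intro: prob_space.prob_le_1)
  qed
next
  fix \<alpha> :: "nat \<Rightarrow> real" and \<epsilon> :: real
  assume model: "\<forall>\<^sub>F n in sequentially. censored_block_model (M n) n (\<sigma> n) (\<alpha> n) \<epsilon> (A n) \<and>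
    (1 + \<delta>) * ln (real n) \<le> real n * cbm_rate (\<alpha> n) \<epsilon>"
  show "((\<lambda>n. measure (M n) {\<omega> \<in> space (M n).
      exact_recovery (elliptope n) (truth_mat n (\<sigma> n)) (A n \<omega>)}) \<longlongrightarrow> 1) sequentially"
  proof (rule tendsto_1_if_rate[OF order_refl \<open>0 < \<delta>\<close>])
    show "\<forall>\<^sub>F n in sequentially. (1 + \<delta>) * ln (real n) \<le> real n * cbm_rate (\<alpha> n) \<epsilon>"
      using model by eventually_elim simp
    show "\<forall>\<^sub>F n in sequentially. 1 - 1 / real n
        - real n * exp (cbm_const \<epsilon> * sqrt (real n * cbm_rate (\<alpha> n) \<epsilon>) - real n * cbm_rate (\<alpha> n) \<epsilon>)
      \<le> measure (M n) {\<omega> \<in> space (M n). exact_recovery (elliptope n) (truth_mat n (\<sigma> n)) (A n \<omega>)}"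
      using model ln_nat_eventually_ge[of 1]
    proof eventually_elim
      case (elim n)
      have "1 * ln (real n) \<le> (1 + \<delta>) * ln (real n)"
        using elim(2) \<open>0 < \<delta>\<close> by (intro mult_right_mono) auto
      then have "ln (real n) \<le> real n * cbm_rate (\<alpha> n) \<epsilon>" using elim(1) by simp
      then show ?case using elim by (intro cbm_exact_recovery_probability) auto
    qed
    show "\<forall>\<^sub>F n in sequentially. measure (M n) {\<omega> \<in> space (M n).
        exact_recovery (elliptope n) (truth_mat n (\<sigma> n)) (A n \<omega>)} \<le> 1"
      using model
      by eventually_elim
        (auto simp: censored_block_model_def indep_symmetric_mat_def intro: prob_space.prob_le_1)
  qed
next
  fix p q :: "nat \<Rightarrow> real"
  let ?F = "inf sequentially (principal {n. even n})"
  assume model: "\<forall>\<^sub>F n in ?F. stochastic_block_model (M n) n (\<sigma> n) (p n) (q n) (A n) \<and>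
    0 < c0 * p n \<and> c0 * p n \<le> q n \<and> q n < p n \<and> p n \<le> 1 - c1 \<and>
    (1 + \<delta>) * ln (real n) \<le> real n / 2 * sbm_rate (p n) (q n)"
  \<comment> \<open>The bound \<open>1 / c1\<close> yields c1 log n >= 1 and hence p n >= 1, so that
    a power of two between p n and 2 p n exists.\<close>
  have large: "\<forall>\<^sub>F n in ?F. max 1 (1 / c1) \<le> ln (real n)"
    by (rule filter_leD[OF inf_le1 ln_nat_eventually_ge])
  show "((\<lambda>n. measure (M n) {\<omega> \<in> space (M n).
      exact_recovery (balanced_elliptope n) (truth_mat n (\<sigma> n)) (A n \<omega>)}) \<longlongrightarrow> 1) ?F"
  proof (rule tendsto_1_if_rate[OF inf_le1 \<open>0 < \<delta>\<close>])
    show "\<forall>\<^sub>F n in ?F. (1 + \<delta>) * ln (real n) \<le> real n / 2 * sbm_rate (p n) (q n)"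
      using model by eventually_elim simp
    show "\<forall>\<^sub>F n in ?F. 1 - 1 / real n - real n * exp (sbm_const c0 c1
        * sqrt (real n / 2 * sbm_rate (p n) (q n)) - real n / 2 * sbm_rate (p n) (q n))
      \<le> measure (M n) {\<omega> \<in> space (M n). exact_recovery (balanced_elliptope n) (truth_mat n (\<sigma> n)) (A n \<omega>)}"
      using model large
    proof eventually_elim
      case (elim n)
      have "1 * ln (real n) \<le> (1 + \<delta>) * ln (real n)"
        using elim(2) \<open>0 < \<delta>\<close> by (intro mult_right_mono) auto
      then have "ln (real n) \<le> real n / 2 * sbm_rate (p n) (q n)" using elim(1) by simp
      moreover have "1 \<le> c1 * ln (real n)" using elim(2) \<open>0 < c1\<close> by (simp add: field_simps)
      ultimately show ?case using elim assms by (intro sbm_exact_recovery_probability) auto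
    qed
    show "\<forall>\<^sub>F n in ?F. measure (M n) {\<omega> \<in> space (M n).
        exact_recovery (balanced_elliptope n) (truth_mat n (\<sigma> n)) (A n \<omega>)} \<le> 1"
      using model
      by eventually_elim
        (auto simp: stochastic_block_model_def indep_symmetric_mat_def intro: prob_space.prob_le_1)
  qed
qed

end
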